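(* Every infinite introenumerable set $A\subseteq\omega$ has an infinite uniformly introenumerable subset. In fact, for every infinite introenumerable set $A\subseteq\omega$ there exist a nonempty $\Sigma^1_1(A)$ class $\mathcal K\subseteq[A]^\omega$ and Turing functionals $\Psi,\Theta$ with $$\Psi^D=A\quad\text{and}\quad \Theta^D=R\qquad(R\in\mathcal K,\ D\in[R]^\omega),$$ and, for this class $\mathcal K$, there is a single positive enumeration operator $\Lambda$ such that $$\Lambda(D)=R\qquad(R\in\mathcal K,\ D\in[R]^\omega).$$
   Context: $\omega=\{0,1,2,\dots\}$. For $B\subseteq\omega$, $[B]^\omega$ is the collection of all infinite subsets of $B$. Sets are identified with their characteristic functions. For a Turing functional $\Phi$ and an oracle $D$, $\Phi^D=A$ means that $\Phi^D$ is total and equals the characteristic function of $A$. Functionals and operators are ordinary: they receive only the displayed oracle. A positive enumeration operator $\Lambda$ is given by a c.e. set of axioms $(F,n)$, with $F\subseteq\omega$ finite and $n\in\omega$; for $D\subseteq\omega$, $\Lambda(D)=\{n: (F,n)\text{ is an axiom for some finite }F\subseteq D\}$. An infinite set $A$ is introenumerable if $A$ is c.e. relative to $D$ for every $D\in[A]^\omega$ (the c.e. index may depend on $D$). An infinite set $R$ is uniformly introenumerable if there is a single index $e$ such that $W_e^D=R$ for every $D\in[R]^\omega$, where $W_e^D$ is the $e$-th set c.e. relative to $D$. A $\Sigma^1_1(A)$ class is a class of subsets of $\omega$ of the form $\{R:\exists f\in\omega^\omega\ \varphi(R,f,A)\}$ with $\varphi$ arithmetical. *)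

theory Defs
  imports Main "HOL-Library.Nat_Bijection"
begin

section \<open>Oracle computability\<close>

text \<open>
  Turing functionals are presented by programs for the partial recursive functions with an
  additional basic function that queries the oracle. The programs themselves serve as indices.
\<close>

datatype prog =
    Zero
  | Succ
  | Proj nat
  | Query
  | Comp prog "prog list"
  | PrimRec prog prog
  | Mu prog

inductive computes :: "nat set \<Rightarrow> prog \<Rightarrow> nat list \<Rightarrow> nat \<Rightarrow> bool" for D :: "nat set" where
  zero: "computes D Zero xs 0"
| succ: "computes D Succ (x # xs) (Suc x)"
| proj: "i < length xs \<Longrightarrow> computes D (Proj i) xs (xs ! i)"
| query: "computes D Query (x # xs) (if x \<in> D then 1 else 0)"
| comp: "list_all2 (\<lambda>g y. computes D g xs y) gs ys \<Longrightarrow> computes D h ys z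
    \<Longrightarrow> computes D (Comp h gs) xs z"
| primrec_0: "computes D g xs z \<Longrightarrow> computes D (PrimRec g h) (0 # xs) z"
| primrec_Suc: "computes D (PrimRec g h) (n # xs) y \<Longrightarrow> computes D h (n # y # xs) z
    \<Longrightarrow> computes D (PrimRec g h) (Suc n # xs) z"
| mu: "computes D g (n # xs) 0 \<Longrightarrow> (\<forall>m<n. \<exists>y. computes D g (m # xs) (Suc y))
    \<Longrightarrow> computes D (Mu g) xs n"

inductive_cases computes_ZeroE: "computes D Zero xs z"
inductive_cases computes_SuccE: "computes D Succ xs z"
inductive_cases computes_ProjE: "computes D (Proj i) xs z"
inductive_cases computes_QueryE: "computes D Query xs z"
inductive_cases computes_CompE: "computes D (Comp h gs) xs z"
inductive_cases computes_PrimRecE: "computes D (PrimRec g h) xs z"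
inductive_cases computes_MuE: "computes D (Mu g) xs z"

lemma computes_functional:
  assumes "computes D p xs y" and "computes D p xs z"
  shows "y = z"
  using assms
proof (induction arbitrary: z rule: computes.induct)
  case (comp xs gs ys h z')
  from comp.prems obtain ys' where
    ys': "list_all2 (\<lambda>g y. computes D g xs y) gs ys'" "computes D h ys' z"
    by (blast elim: computes_CompE)
  have "ys = ys'"
  proof (rule nth_equalityI)
    show "length ys = length ys'"
      using comp.IH(1) ys'(1) by (simp add: list_all2_conv_all_nth)
  next
    fix i assume "i < length ys"
    then show "ys ! i = ys' ! i"
      using comp.IH(1) ys'(1) by (simp add: list_all2_conv_all_nth)
  qed
  with comp.IH(2) ys'(2) show ?case by blast
next
  case (mu g n xs)
  from mu.prems have z: "computes D g (z # xs) 0" "\<forall>m<z. \<exists>y. computes D g (m # xs) (Suc y)"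
    by (auto elim: computes_MuE)
  show ?case
  proof (cases n z rule: linorder_cases)
    case less
    with z(2) mu.IH(1) show ?thesis by blast
  next
    case greater
    with mu.IH(2) z(1) show ?thesis by blast
  qed
qed (blast elim: computes_ZeroE computes_SuccE computes_ProjE computes_QueryE computes_PrimRecE)+

text \<open>
  \<open>functional_eq \<Phi> D A\<close> means $\Phi^D = A$. Since values are unique by
  \<open>computes_functional\<close>, it says that $\Phi^D$ is total and is the characteristic
  function of \<open>A\<close>.
\<close>

definition functional_eq :: "prog \<Rightarrow> nat set \<Rightarrow> nat set \<Rightarrow> bool" where
  "functional_eq \<Phi> D A \<longleftrightarrow> (\<forall>n. computes D \<Phi> [n] (if n \<in> A then 1 else 0))"

definition W :: "prog \<Rightarrow> nat set \<Rightarrow> nat set" where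
  "W e D = {n. \<exists>y. computes D e [n] y}"

definition ce_in :: "nat set \<Rightarrow> nat set \<Rightarrow> bool" where
  "ce_in D A \<longleftrightarrow> (\<exists>e. W e D = A)"

abbreviation ce :: "nat set \<Rightarrow> bool" where
  "ce \<equiv> ce_in {}"


section \<open>Positive enumeration operators\<close>

text \<open>An operator is its set of axioms; finite sets are coded by canonical indices.\<close>

definition enumeration_operator :: "(nat set \<times> nat) set \<Rightarrow> bool" where
  "enumeration_operator \<Lambda> \<longleftrightarrow>
     (\<forall>(F, n) \<in> \<Lambda>. finite F) \<and> ce ((\<lambda>(F, n). prod_encode (set_encode F, n)) ` \<Lambda>)"

definition enum_apply :: "(nat set \<times> nat) set \<Rightarrow> nat set \<Rightarrow> nat set" where
  "enum_apply \<Lambda> D = {n. \<exists>F. finite F \<and> F \<subseteq> D \<and> (F, n) \<in> \<Lambda>}"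


section \<open>Introenumerable sets\<close>

definition infinite_subsets :: "nat set \<Rightarrow> nat set set" where
  "infinite_subsets B = {D. D \<subseteq> B \<and> infinite D}"

definition introenumerable :: "nat set \<Rightarrow> bool" where
  "introenumerable A \<longleftrightarrow> infinite A \<and> (\<forall>D \<in> infinite_subsets A. ce_in D A)"

definition uniformly_introenumerable :: "nat set \<Rightarrow> bool" where
  "uniformly_introenumerable R \<longleftrightarrow>
     infinite R \<and> (\<exists>e. \<forall>D \<in> infinite_subsets R. W e D = R)"


section \<open>Relativized analytic classes\<close>

text \<open>
  Arithmetical formulas $\varphi(R,f,A)$: first-order formulas over the natural numbers with
  0, successor, addition and multiplication, a function symbol for \<open>f\<close> and predicate
  symbols for \<open>R\<close> and \<open>A\<close>. Number variables are de Bruijn indices.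
\<close>

datatype arith_term =
    Var nat
  | Zer
  | Suc_of arith_term
  | Plus arith_term arith_term
  | Times arith_term arith_term
  | Fun_f arith_term

datatype arith_formula =
    Eq arith_term arith_term
  | In_R arith_term
  | In_A arith_term
  | Neg arith_formula
  | Conj arith_formula arith_formula
  | Exists arith_formula

primrec term_val :: "(nat \<Rightarrow> nat) \<Rightarrow> (nat \<Rightarrow> nat) \<Rightarrow> arith_term \<Rightarrow> nat" where
  "term_val f s (Var i) = s i"
| "term_val f s Zer = 0"
| "term_val f s (Suc_of t) = Suc (term_val f s t)"
| "term_val f s (Plus t u) = term_val f s t + term_val f s u"
| "term_val f s (Times t u) = term_val f s t * term_val f s u"
| "term_val f s (Fun_f t) = f (term_val f s t)"

primrec sat :: "nat set \<Rightarrow> (nat \<Rightarrow> nat) \<Rightarrow> nat set \<Rightarrow> (nat \<Rightarrow> nat) \<Rightarrow> arith_formula \<Rightarrow> bool" where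
  "sat R f A s (Eq t u) \<longleftrightarrow> term_val f s t = term_val f s u"
| "sat R f A s (In_R t) \<longleftrightarrow> term_val f s t \<in> R"
| "sat R f A s (In_A t) \<longleftrightarrow> term_val f s t \<in> A"
| "sat R f A s (Neg \<phi>) \<longleftrightarrow> \<not> sat R f A s \<phi>"
| "sat R f A s (Conj \<phi> \<psi>) \<longleftrightarrow> sat R f A s \<phi> \<and> sat R f A s \<psi>"
| "sat R f A s (Exists \<phi>) \<longleftrightarrow> (\<exists>n. sat R f A (case_nat n s) \<phi>)"

text \<open>
  Evaluating under the zero assignment amounts to substituting the numeral 0 for any free number
  variable of \<open>\<phi>\<close>, so \<open>\<phi>\<close> need not be required to be a sentence.
\<close>

definition Sigma11_class :: "nat set \<Rightarrow> nat set set \<Rightarrow> bool" where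
  "Sigma11_class A K \<longleftrightarrow> (\<exists>\<phi>. K = {R. \<exists>f. sat R f A (\<lambda>_. 0) \<phi>})"

end

theory Submission
  imports Defs "HOL-Library.Countable" "HOL-Library.Infinite_Set"
begin

text \<open>
  Forcing with conditions that consist of a finite part of a subset of \<open>A\<close> and a semidecidable
  family of forbidden finite sets yields a positive enumeration operator \<open>\<Gamma>\<close> with
  \<open>A \<subseteq> \<Gamma>(D)\<close> for all \<open>D \<in> [A]\<^sup>\<omega>\<close> and \<open>\<Gamma>(Y) = A\<close> for some \<open>Y \<in> [A]\<^sup>\<omega>\<close>: otherwise a sufficiently
  generic subset of \<open>A\<close> would not enumerate \<open>A\<close>. Each \<open>n \<in> A\<close> is thus a clock: every
  \<open>D \<in> [A]\<^sup>\<omega>\<close> eventually lists \<open>n\<close>, so the question which \<open>m\<close> have been listed by then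
  has a computable answer for each \<open>D\<close>.

  A free ultrafilter containing \<open>Y\<close> assigns to these questions generic answers for every finite
  starting part \<open>H\<close>. A set \<open>R\<close> is built greedily, each new element being the least one that
  preserves the generic answers for \<^emph>\<open>all\<close> \<open>H\<close> considered so far and not only for the \<open>H \<subseteq> R\<close>.
  Hence every \<open>D \<in> [R]\<^sup>\<omega>\<close> finds the generic answers by running the clock on itself, and can
  repeat the greedy construction of \<open>R\<close> from them. Some index \<open>e\<close> satisfies \<open>W\<^sub>e\<^sup>R = A\<close>, and a
  sparse subset of \<open>R\<close> bounds the stages of this enumeration, which gives \<open>\<Psi>\<close> and \<open>\<Theta>\<close>.

  Both functionals are total on all of \<open>[A]\<^sup>\<omega>\<close>. The class \<open>K\<close> can therefore be defined arithmetically: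
  no finite \<open>E \<subseteq> R\<close> computes a wrong value.
\<close>

section \<open>Total functions computable uniformly on a class of oracles\<close>

text \<open>The obstacle: an infinite \<open>D \<subseteq> R\<close> does not know which elements of
  \<open>R\<close> it has lost, so the rule that builds \<open>R\<close> may refer only to data that
  every such \<open>D\<close> recovers. These data are the values
  \<open>val U \<rho> (hit n) H\<close> for finite \<open>H \<subseteq> B\<close>, where
  \<open>B\<close>, the set of generically listed numbers, stands in for \<open>A\<close>. To
  recover a value, extend \<open>H\<close> by elements of \<open>D\<close> until
  \<open>\<rho>\<close> holds; each step preserves the value, and at the end \<open>hit\<close>
  gives it. Sets \<open>H\<close> with elements outside \<open>R\<close> cannot be avoided: testing
  a candidate \<open>y\<close> compares the values at \<open>H\<close> and at
  \<open>insert y H\<close>, and \<open>y\<close> may be rejected.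

  Two demands shape the clock \<open>\<rho>\<close>. It must run long enough for
  \<open>U\<close>-almost all numbers to lie in \<open>B\<close>, yet its search has to stop on
  every infinite subset of \<open>A\<close>, not only below \<open>R\<close>. The latter makes
  correctness on all infinite \<open>D \<subseteq> R\<close> a statement about finite sets: a total
  functional is correct as soon as no finite part gives a wrong value. No quantifier over
  \<open>D\<close> remains, and the function quantifier of the class merely supplies codes of finite
  sequences.\<close>

definition computable_on :: "nat set set \<Rightarrow> nat \<Rightarrow> (nat set \<Rightarrow> nat list \<Rightarrow> nat) \<Rightarrow> bool" where
  "computable_on \<D> k f \<longleftrightarrow>
     (\<exists>p. \<forall>D \<in> \<D>. \<forall>xs. length xs = k \<longrightarrow> computes D p xs (f D xs))"

definition decidable_on :: "nat set set \<Rightarrow> nat \<Rightarrow> (nat set \<Rightarrow> nat list \<Rightarrow> bool) \<Rightarrow> bool" where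
  "decidable_on \<D> k P \<longleftrightarrow> computable_on \<D> k (\<lambda>D xs. of_bool (P D xs))"

text \<open>Reading past the end gives 0, so functions of argument lists can be written without side
  conditions on lengths.\<close>

definition arg :: "nat list \<Rightarrow> nat \<Rightarrow> nat" where
  "arg xs j = (if j < length xs then xs ! j else 0)"

lemma arg_tl [simp]: "arg (tl xs) j = arg xs (Suc j)"
  by (cases xs) (auto simp: arg_def)

lemma arg_Cons_0 [simp]: "arg (x # xs) 0 = x"
  by (simp add: arg_def)

lemma arg_Cons_Suc [simp]: "arg (x # xs) (Suc j) = arg xs j"
  by (simp add: arg_def)

lemma computable_on_cong:
  assumes "computable_on \<D> k f" and "\<And>D xs. D \<in> \<D> \<Longrightarrow> length xs = k \<Longrightarrow> f D xs = g D xs"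
  shows "computable_on \<D> k g"
proof -
  obtain p where "\<And>D xs. D \<in> \<D> \<Longrightarrow> length xs = k \<Longrightarrow> computes D p xs (f D xs)"
    using assms(1) unfolding computable_on_def by blast
  then show ?thesis
    unfolding computable_on_def using assms(2) by (intro exI[of _ p]) auto
qed

lemma decidable_on_cong:
  assumes "decidable_on \<D> k P" and "\<And>D xs. D \<in> \<D> \<Longrightarrow> length xs = k \<Longrightarrow> P D xs = Q D xs"
  shows "decidable_on \<D> k Q"
  using assms unfolding decidable_on_def by (elim computable_on_cong) simp

lemma computable_on_mono: "computable_on \<D> k f \<Longrightarrow> \<E> \<subseteq> \<D> \<Longrightarrow> computable_on \<E> k f"
  unfolding computable_on_def by blast

lemma decidable_on_mono: "decidable_on \<D> k f \<Longrightarrow> \<E> \<subseteq> \<D> \<Longrightarrow> decidable_on \<E> k f"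
  unfolding decidable_on_def by (rule computable_on_mono)

named_theorems comp_intros

lemma computable_arg [comp_intros]:
  assumes "j < k"
  shows "computable_on \<D> k (\<lambda>D xs. arg xs j)"
  unfolding computable_on_def using assms
  by (intro exI[of _ "Proj j"]) (auto simp: arg_def intro: computes.proj)

lemma computable_comp:
  assumes f: "computable_on \<D> (length gs) f" and gs: "\<And>g. g \<in> set gs \<Longrightarrow> computable_on \<D> k g"
  shows "computable_on \<D> k (\<lambda>D xs. f D (map (\<lambda>g. g D xs) gs))"
proof -
  obtain p where p: "\<And>D xs. D \<in> \<D> \<Longrightarrow> length xs = length gs \<Longrightarrow> computes D p xs (f D xs)"
    using f unfolding computable_on_def by blast
  obtain q where q: "\<And>g D xs. g \<in> set gs \<Longrightarrow> D \<in> \<D> \<Longrightarrow> length xs = k \<Longrightarrow> computes D (q g) xs (g D xs)"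
    using gs unfolding computable_on_def by metis
  have "computes D (Comp p (map q gs)) xs (f D (map (\<lambda>g. g D xs) gs))"
    if "D \<in> \<D>" "length xs = k" for D xs
    using that by (intro computes.comp[where ys = "map (\<lambda>g. g D xs) gs"])
      (auto simp: list_all2_conv_all_nth intro: p q)
  then show ?thesis unfolding computable_on_def by blast
qed

lemma computable_comp1:
  assumes "computable_on \<D> 1 (\<lambda>D xs. F D (arg xs 0))" "computable_on \<D> k a"
  shows "computable_on \<D> k (\<lambda>D xs. F D (a D xs))"
  using computable_comp[of \<D> "[a]" "\<lambda>D xs. F D (arg xs 0)" k] assms by simp

lemma computable_comp2:
  assumes "computable_on \<D> 2 (\<lambda>D xs. F D (arg xs 0) (arg xs 1))"
    "computable_on \<D> k a" "computable_on \<D> k b"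
  shows "computable_on \<D> k (\<lambda>D xs. F D (a D xs) (b D xs))"
  using computable_comp[of \<D> "[a, b]" "\<lambda>D xs. F D (arg xs 0) (arg xs 1)" k] assms
  by (auto simp: numeral_2_eq_2)

lemma computable_comp3:
  assumes "computable_on \<D> 3 (\<lambda>D xs. F D (arg xs 0) (arg xs 1) (arg xs 2))"
    "computable_on \<D> k a" "computable_on \<D> k b" "computable_on \<D> k c"
  shows "computable_on \<D> k (\<lambda>D xs. F D (a D xs) (b D xs) (c D xs))"
  using computable_comp[of \<D> "[a, b, c]" "\<lambda>D xs. F D (arg xs 0) (arg xs 1) (arg xs 2)" k] assms
  by (auto simp: numeral_2_eq_2 numeral_3_eq_3)

lemma computable_comp5:
  assumes "computable_on \<D> 5 (\<lambda>D xs. F D (arg xs 0) (arg xs 1) (arg xs 2) (arg xs 3) (arg xs 4))"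
    "computable_on \<D> k a" "computable_on \<D> k b" "computable_on \<D> k c"
    "computable_on \<D> k d" "computable_on \<D> k e"
  shows "computable_on \<D> k (\<lambda>D xs. F D (a D xs) (b D xs) (c D xs) (d D xs) (e D xs))"
  using computable_comp[of \<D> "[a, b, c, d, e]"
      "\<lambda>D xs. F D (arg xs 0) (arg xs 1) (arg xs 2) (arg xs 3) (arg xs 4)" k] assms
  by (auto simp: eval_nat_numeral)

lemmas decidable_comp1 = computable_comp1[where F = "\<lambda>D x. of_bool (P D x)" for P, folded decidable_on_def]
lemmas decidable_comp2 = computable_comp2[where F = "\<lambda>D x y. of_bool (P D x y)" for P, folded decidable_on_def]
lemmas decidable_comp3 = computable_comp3[where F = "\<lambda>D x y z. of_bool (P D x y z)" for P, folded decidable_on_def]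
lemmas decidable_comp5 = computable_comp5[where F = "\<lambda>D x y z u v. of_bool (P D x y z u v)" for P, folded decidable_on_def]

section \<open>Closure under arithmetic, recursion and Boolean operations\<close>

lemma computable_Suc [comp_intros]:
  assumes "computable_on \<D> k f"
  shows "computable_on \<D> k (\<lambda>D xs. Suc (f D xs))"
proof (rule computable_comp1[OF _ assms])
  show "computable_on \<D> 1 (\<lambda>D xs. Suc (arg xs 0))"
    unfolding computable_on_def
    by (rule exI[of _ Succ]) (auto simp: length_Suc_conv intro: computes.succ)
qed

lemma computable_zero: "computable_on \<D> k (\<lambda>D xs. 0)"
  unfolding computable_on_def by (blast intro: computes.zero)

lemma computable_const [comp_intros]: "computable_on \<D> k (\<lambda>D xs. c)"
proof (induction c)
  case 0
  show ?case by (rule computable_zero)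
next
  case (Suc c)
  then show ?case by (rule computable_Suc)
qed

lemma decidable_const [comp_intros]: "decidable_on \<D> k (\<lambda>D xs. c)"
  unfolding decidable_on_def by (rule computable_const)

lemma computable_of_bool [comp_intros]:
  "decidable_on \<D> k P \<Longrightarrow> computable_on \<D> k (\<lambda>D xs. of_bool (P D xs))"
  unfolding decidable_on_def .

lemma decidable_oracle [comp_intros]:
  assumes "computable_on \<D> k f"
  shows "decidable_on \<D> k (\<lambda>D xs. f D xs \<in> D)"
proof (rule decidable_comp1[OF _ assms])
  show "decidable_on \<D> 1 (\<lambda>D xs. arg xs 0 \<in> D)"
    unfolding computable_on_def decidable_on_def
  proof (intro exI[of _ Query] ballI allI impI)
    fix D :: "nat set" and xs :: "nat list" assume "length xs = 1"
    then obtain x where "xs = [x]" by (auto simp: length_Suc_conv)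
    then show "computes D Query xs (of_bool (arg xs 0 \<in> D))"
      using computes.query[of D x "[]"] by (simp add: of_bool_def)
  qed
qed

lemma computable_rec_base:
  assumes f: "computable_on \<D> k f"
    and g: "computable_on \<D> (Suc (Suc k)) (\<lambda>D ys. g D (arg ys 0) (arg ys 1) (tl (tl ys)))"
  shows "computable_on \<D> (Suc k) (\<lambda>D ys. rec_nat (f D (tl ys)) (\<lambda>n r. g D n r (tl ys)) (arg ys 0))"
proof -
  obtain p where p: "\<And>D xs. D \<in> \<D> \<Longrightarrow> length xs = k \<Longrightarrow> computes D p xs (f D xs)"
    using f unfolding computable_on_def by blast
  obtain q where q: "\<And>D n r xs. D \<in> \<D> \<Longrightarrow> length xs = k \<Longrightarrow> computes D q (n # r # xs) (g D n r xs)"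
  proof -
    obtain q where "\<And>D ys. D \<in> \<D> \<Longrightarrow> length ys = Suc (Suc k) \<Longrightarrow>
        computes D q ys (g D (arg ys 0) (arg ys 1) (tl (tl ys)))"
      using g unfolding computable_on_def by blast
    from this[of _ "n # r # xs" for n r xs] show ?thesis by (intro that[of q]) auto
  qed
  have "computes D (PrimRec p q) (n # xs) (rec_nat (f D xs) (\<lambda>n r. g D n r xs) n)"
    if "D \<in> \<D>" "length xs = k" for D n xs
    using that by (induction n) (auto intro: computes.intros p q)
  then show ?thesis
    unfolding computable_on_def by (intro exI[of _ "PrimRec p q"]) (auto simp: length_Suc_conv)
qed

text \<open>Substitution for a new first argument that leaves the whole old list available as
  parameters; the old list is rebuilt from its projections.\<close>

lemma computable_args:
  assumes "computable_on \<D> k n" "computable_on \<D> (Suc k) (\<lambda>D ys. F D (arg ys 0) (tl ys))"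
  shows "computable_on \<D> k (\<lambda>D xs. F D (n D xs) xs)"
proof -
  let ?gs = "n # map (\<lambda>j D xs. arg xs j) [0..<k]"
  have "computable_on \<D> k (\<lambda>D xs. (\<lambda>D ys. F D (arg ys 0) (tl ys)) D (map (\<lambda>g. g D xs) ?gs))"
    using assms by (intro computable_comp) (auto intro: comp_intros)
  then show ?thesis
  proof (rule computable_on_cong)
    fix D :: "nat set" and xs :: "nat list" assume "length xs = k"
    then have "map (arg xs) [0..<k] = xs"
      by (auto intro!: nth_equalityI simp: arg_def)
    then show "F D (arg (map (\<lambda>g. g D xs) ?gs) 0) (tl (map (\<lambda>g. g D xs) ?gs)) = F D (n D xs) xs"
      by (simp add: comp_def)
  qed
qed

lemma computable_rec [comp_intros]:
  assumes "computable_on \<D> k n" "computable_on \<D> k f"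
    and "computable_on \<D> (Suc (Suc k)) (\<lambda>D ys. g D (arg ys 0) (arg ys 1) (tl (tl ys)))"
  shows "computable_on \<D> k (\<lambda>D xs. rec_nat (f D xs) (\<lambda>n r. g D n r xs) (n D xs))"
  using computable_args[OF assms(1) computable_rec_base[OF assms(2,3)]] .

lemma computable_tl:
  assumes "computable_on \<D> k f"
  shows "computable_on \<D> (Suc k) (\<lambda>D xs. f D (tl xs))"
proof -
  have "computable_on \<D> (Suc k) (\<lambda>D xs. f D (map (\<lambda>g. g D xs) (map (\<lambda>j D xs. arg xs (Suc j)) [0..<k])))"
    using assms by (intro computable_comp) (auto intro: computable_arg)
  then show ?thesis
  proof (rule computable_on_cong)
    fix D :: "nat set" and xs :: "nat list" assume "length xs = Suc k"
    then have "map (\<lambda>g. g D xs) (map (\<lambda>j D xs. arg xs (Suc j)) [0..<k]) = tl xs"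
      by (intro nth_equalityI) (auto simp: arg_def nth_tl)
    then show "f D (map (\<lambda>g. g D xs) (map (\<lambda>j D xs. arg xs (Suc j)) [0..<k])) = f D (tl xs)"
      by simp
  qed
qed

lemma computable_if [comp_intros]:
  assumes "decidable_on \<D> k P" "computable_on \<D> k f" "computable_on \<D> k g"
  shows "computable_on \<D> k (\<lambda>D xs. if P D xs then f D xs else g D xs)"
proof -
  \<comment> \<open>Branching is a recursion of length 0 or 1: the single step replaces the start
    value \<open>g\<close> by \<open>f\<close>.\<close>
  have "computable_on \<D> k (\<lambda>D xs. rec_nat (g D xs) (\<lambda>n r. f D xs) (of_bool (P D xs)))"
    by (rule computable_rec[OF computable_of_bool[OF assms(1)] assms(3)
          computable_tl[OF computable_tl[OF assms(2)]]])
  then show ?thesis by (rule computable_on_cong) auto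
qed

lemma computable_add [comp_intros]:
  assumes "computable_on \<D> k f" "computable_on \<D> k g"
  shows "computable_on \<D> k (\<lambda>D xs. f D xs + g D xs)"
proof (rule computable_comp2[OF _ assms])
  have "computable_on \<D> 2 (\<lambda>D xs. rec_nat (arg xs 0) (\<lambda>n r. Suc r) (arg xs 1))"
    by (intro comp_intros) auto
  moreover have "rec_nat a (\<lambda>n r. Suc r) b = a + b" for a b :: nat
    by (induction b) auto
  ultimately show "computable_on \<D> 2 (\<lambda>D xs. arg xs 0 + arg xs 1)" by simp
qed

lemma computable_mult [comp_intros]:
  assumes "computable_on \<D> k f" "computable_on \<D> k g"
  shows "computable_on \<D> k (\<lambda>D xs. f D xs * g D xs)"
proof (rule computable_comp2[OF _ assms])
  have "computable_on \<D> 2 (\<lambda>D xs. rec_nat 0 (\<lambda>n r. r + arg xs 0) (arg xs 1))"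
    by (intro comp_intros; simp; intro comp_intros; simp)
  moreover have "rec_nat 0 (\<lambda>n r. r + a) b = a * b" for a b :: nat
    by (induction b) auto
  ultimately show "computable_on \<D> 2 (\<lambda>D xs. arg xs 0 * arg xs 1)" by simp
qed

lemma computable_power2 [comp_intros]:
  assumes "computable_on \<D> k f"
  shows "computable_on \<D> k (\<lambda>D xs. 2 ^ f D xs)"
proof (rule computable_comp1[OF _ assms])
  have "computable_on \<D> 1 (\<lambda>D xs. rec_nat 1 (\<lambda>n r. 2 * r) (arg xs 0))"
    by (intro comp_intros) auto
  moreover have "rec_nat 1 (\<lambda>n r. 2 * r) b = (2 ^ b :: nat)" for b :: nat
    by (induction b) auto
  ultimately show "computable_on \<D> 1 (\<lambda>D xs. 2 ^ arg xs 0)" by simp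
qed

lemma computable_pred [comp_intros]:
  assumes "computable_on \<D> k f"
  shows "computable_on \<D> k (\<lambda>D xs. f D xs - 1)"
proof (rule computable_comp1[OF _ assms])
  have "computable_on \<D> 1 (\<lambda>D xs. rec_nat 0 (\<lambda>n r. n) (arg xs 0))"
    by (intro comp_intros) auto
  moreover have "rec_nat 0 (\<lambda>n r. n) b = b - 1" for b :: nat
    by (cases b) auto
  ultimately show "computable_on \<D> 1 (\<lambda>D xs. arg xs 0 - 1)" by simp
qed

lemmas computable_pred_Suc_0 [comp_intros] = computable_pred[unfolded One_nat_def]

lemma computable_diff [comp_intros]:
  assumes "computable_on \<D> k f" "computable_on \<D> k g"
  shows "computable_on \<D> k (\<lambda>D xs. f D xs - g D xs)"
proof (rule computable_comp2[OF _ assms])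
  have "computable_on \<D> 2 (\<lambda>D xs. rec_nat (arg xs 0) (\<lambda>n r. r - 1) (arg xs 1))"
    by (intro comp_intros) auto
  moreover have "rec_nat a (\<lambda>n r. r - 1) b = a - b" for a b :: nat
    by (induction b) auto
  ultimately show "computable_on \<D> 2 (\<lambda>D xs. arg xs 0 - arg xs 1)" by simp
qed

lemma decidable_not [comp_intros]:
  assumes "decidable_on \<D> k P"
  shows "decidable_on \<D> k (\<lambda>D xs. \<not> P D xs)"
proof -
  have "computable_on \<D> k (\<lambda>D xs. if P D xs then 0 else 1)"
    using assms by (intro comp_intros)
  then show ?thesis unfolding decidable_on_def by (rule computable_on_cong) auto
qed

lemma decidable_conj [comp_intros]:
  assumes "decidable_on \<D> k P" "decidable_on \<D> k Q"
  shows "decidable_on \<D> k (\<lambda>D xs. P D xs \<and> Q D xs)"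
proof -
  have "computable_on \<D> k (\<lambda>D xs. of_bool (P D xs) * of_bool (Q D xs))"
    using assms by (intro comp_intros)
  then show ?thesis unfolding decidable_on_def by (rule computable_on_cong) auto
qed

lemma decidable_disj [comp_intros]:
  assumes "decidable_on \<D> k P" "decidable_on \<D> k Q"
  shows "decidable_on \<D> k (\<lambda>D xs. P D xs \<or> Q D xs)"
proof -
  have "decidable_on \<D> k (\<lambda>D xs. \<not> (\<not> P D xs \<and> \<not> Q D xs))"
    using assms by (intro comp_intros)
  then show ?thesis by simp
qed

lemma decidable_imp [comp_intros]:
  assumes "decidable_on \<D> k P" "decidable_on \<D> k Q"
  shows "decidable_on \<D> k (\<lambda>D xs. P D xs \<longrightarrow> Q D xs)"
proof -
  have "decidable_on \<D> k (\<lambda>D xs. \<not> P D xs \<or> Q D xs)"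
    using assms by (intro comp_intros)
  then show ?thesis by (simp only: imp_conv_disj)
qed

lemma decidable_less [comp_intros]:
  assumes "computable_on \<D> k f" "computable_on \<D> k g"
  shows "decidable_on \<D> k (\<lambda>D xs. f D xs < g D xs)"
proof -
  have "computable_on \<D> k (\<lambda>D xs. 1 - (1 - (g D xs - f D xs)))"
    using assms by (intro comp_intros)
  then show ?thesis unfolding decidable_on_def by (rule computable_on_cong) auto
qed

lemma decidable_le [comp_intros]:
  assumes "computable_on \<D> k f" "computable_on \<D> k g"
  shows "decidable_on \<D> k (\<lambda>D xs. f D xs \<le> g D xs)"
proof -
  have "decidable_on \<D> k (\<lambda>D xs. \<not> g D xs < f D xs)"
    using assms by (intro comp_intros)
  then show ?thesis by (simp add: not_less)
qed

lemma decidable_eq [comp_intros]: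
  assumes "computable_on \<D> k f" "computable_on \<D> k g"
  shows "decidable_on \<D> k (\<lambda>D xs. f D xs = g D xs)"
proof -
  have "decidable_on \<D> k (\<lambda>D xs. f D xs \<le> g D xs \<and> g D xs \<le> f D xs)"
    using assms by (intro comp_intros)
  then show ?thesis by (rule decidable_on_cong) auto
qed

lemma decidable_iff [comp_intros]:
  assumes "decidable_on \<D> k P" "decidable_on \<D> k Q"
  shows "decidable_on \<D> k (\<lambda>D xs. P D xs = Q D xs)"
proof -
  have "decidable_on \<D> k (\<lambda>D xs. (P D xs \<longrightarrow> Q D xs) \<and> (Q D xs \<longrightarrow> P D xs))"
    using assms by (intro comp_intros)
  then show ?thesis by (rule decidable_on_cong) auto
qed

section \<open>Bounded quantifiers, unbounded search and codes\<close>

lemma decidable_bex_less [comp_intros]: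
  assumes "computable_on \<D> k f"
    and P: "decidable_on \<D> (Suc k) (\<lambda>D ys. P D (arg ys 0) (tl ys))"
  shows "decidable_on \<D> k (\<lambda>D xs. \<exists>i<f D xs. P D i xs)"
proof -
  have P': "decidable_on \<D> (Suc (Suc k)) (\<lambda>D ys. P D (arg ys 0) (tl (tl ys)))"
  proof -
    \<comment> \<open>Recursion supplies counter, accumulator and parameters. These projections drop
      argument 1, the accumulator, because \<open>P\<close> sees only the counter and the
      parameters.\<close>
    let ?gs = "map (\<lambda>j (D :: nat set) xs. arg xs (if j = 0 then 0 else Suc j)) [0..<Suc k]"
    let ?f = "\<lambda>D ys. of_bool (P D (arg ys 0) (tl ys))"
    have f: "computable_on \<D> (length ?gs) ?f"
      using P by (simp add: decidable_on_def)
    have gs: "computable_on \<D> (Suc (Suc k)) g" if "g \<in> set ?gs" for g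
    proof -
      from that have "g \<in> (\<lambda>j D xs. arg xs (if j = 0 then 0 else Suc j)) ` {0..<Suc k}"
        unfolding set_map set_upt .
      then obtain j where "j \<in> {0..<Suc k}" "g = (\<lambda>D xs. arg xs (if j = 0 then 0 else Suc j))"
        by (rule imageE)
      then show ?thesis by (cases "j = 0") (auto intro: computable_arg)
    qed
    have "computable_on \<D> (Suc (Suc k)) (\<lambda>D ys. ?f D (map (\<lambda>g. g D ys) ?gs))"
      using computable_comp[of \<D> ?gs ?f "Suc (Suc k)", OF f gs] .
    then show ?thesis unfolding decidable_on_def
    proof (rule computable_on_cong)
      fix D :: "nat set" and ys :: "nat list" assume l: "length ys = Suc (Suc k)"
      let ?zs = "map (\<lambda>g. g D ys) ?gs"
      have "?zs = arg ys 0 # tl (tl ys)"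
        using l by (intro nth_equalityI)
          (auto simp: arg_def nth_tl nth_Cons simp del: upt_Suc split: nat.split)
      then show "of_bool (P D (arg ?zs 0) (tl ?zs)) = (of_bool (P D (arg ys 0) (tl (tl ys))) :: nat)"
        by simp
    qed
  qed
  have "computable_on \<D> k (\<lambda>D xs. rec_nat 0 (\<lambda>n r. if P D n xs then 1 else r) (f D xs))"
    by (rule computable_rec[OF assms(1) computable_const],
        rule computable_if[OF P' computable_const computable_arg]) simp
  moreover have "rec_nat 0 (\<lambda>n r. if Q n then 1 else r) b = (of_bool (\<exists>i<b. Q i) :: nat)" for Q b
    by (induction b) (auto simp: less_Suc_eq)
  ultimately show ?thesis unfolding decidable_on_def by simp
qed

lemma decidable_bex_le [comp_intros]:
  assumes "computable_on \<D> k f" "decidable_on \<D> (Suc k) (\<lambda>D ys. P D (arg ys 0) (tl ys))"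
  shows "decidable_on \<D> k (\<lambda>D xs. \<exists>i\<le>f D xs. P D i xs)"
proof -
  have "decidable_on \<D> k (\<lambda>D xs. \<exists>i<Suc (f D xs). P D i xs)"
    using assms by (intro comp_intros)
  then show ?thesis by (simp add: less_Suc_eq_le)
qed

lemma decidable_ball_less [comp_intros]:
  assumes "computable_on \<D> k f" "decidable_on \<D> (Suc k) (\<lambda>D ys. P D (arg ys 0) (tl ys))"
  shows "decidable_on \<D> k (\<lambda>D xs. \<forall>i<f D xs. P D i xs)"
proof -
  have "decidable_on \<D> k (\<lambda>D xs. \<not> (\<exists>i<f D xs. \<not> P D i xs))"
    using assms by (intro comp_intros)
  then show ?thesis by simp
qed

lemma decidable_ball_le [comp_intros]:
  assumes "computable_on \<D> k f" "decidable_on \<D> (Suc k) (\<lambda>D ys. P D (arg ys 0) (tl ys))"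
  shows "decidable_on \<D> k (\<lambda>D xs. \<forall>i\<le>f D xs. P D i xs)"
proof -
  have "decidable_on \<D> k (\<lambda>D xs. \<forall>i<Suc (f D xs). P D i xs)"
    using assms by (intro comp_intros)
  then show ?thesis by (simp add: less_Suc_eq_le)
qed

text \<open>The one unbounded search. It has to terminate only for oracles in \<open>\<D>\<close>,
  which is the reason for relativizing computability to a class of oracles.\<close>

lemma computable_Least [comp_intros]:
  assumes P: "decidable_on \<D> (Suc k) (\<lambda>D ys. P D (arg ys 0) (tl ys))"
    and ex: "\<And>D xs. D \<in> \<D> \<Longrightarrow> length xs = k \<Longrightarrow> \<exists>n. P D n xs"
  shows "computable_on \<D> k (\<lambda>D xs. LEAST n. P D n xs)"
proof -
  have "computable_on \<D> (Suc k) (\<lambda>D ys. of_bool (\<not> P D (arg ys 0) (tl ys)))"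
    using assms by (intro comp_intros)
  then obtain p where "\<And>D ys. D \<in> \<D> \<Longrightarrow> length ys = Suc k \<Longrightarrow>
      computes D p ys (of_bool (\<not> P D (arg ys 0) (tl ys)))"
    unfolding computable_on_def by blast
  from this[of _ "n # xs" for n xs]
  have p: "computes D p (n # xs) (of_bool (\<not> P D n xs))" if "D \<in> \<D>" "length xs = k" for D n xs
    using that by simp
  have "computes D (Mu p) xs (LEAST n. P D n xs)" if D: "D \<in> \<D>" "length xs = k" for D xs
  proof (rule computes.mu)
    have "P D (LEAST n. P D n xs) xs" using ex[OF D] by (rule LeastI_ex)
    then show "computes D p ((LEAST n. P D n xs) # xs) 0" using p[OF D, of "LEAST n. P D n xs"] by simp
    show "\<forall>m<(LEAST n. P D n xs). \<exists>y. computes D p (m # xs) (Suc y)"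
      using p[OF D] not_less_Least by (metis One_nat_def of_bool_eq(2))
  qed
  then show ?thesis unfolding computable_on_def by blast
qed

lemma decidable_set_decode [comp_intros]:
  assumes "computable_on \<D> k f" "computable_on \<D> k g"
  shows "decidable_on \<D> k (\<lambda>D xs. f D xs \<in> set_decode (g D xs))"
proof (rule decidable_comp2[OF _ assms])
  \<comment> \<open>Bit \<open>x\<close> of \<open>y\<close> is set iff the quotient of
    \<open>y\<close> by \<open>2 ^ x\<close> is odd, that is, of the form \<open>2 * q + 1\<close>.
    Quotient and remainder are found by bounded search instead of division.\<close>
  have "decidable_on \<D> 2 (\<lambda>D xs. \<exists>q\<le>arg xs 1. \<exists>r\<le>arg xs 1.
      arg xs 1 = (2 * q + 1) * 2 ^ arg xs 0 + r \<and> r < 2 ^ arg xs 0)"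
    by (intro comp_intros; simp; intro comp_intros; simp)
  moreover have "(\<exists>q\<le>y. \<exists>r\<le>y. y = (2 * q + 1) * 2 ^ x + r \<and> r < 2 ^ x) \<longleftrightarrow> x \<in> set_decode y" for x y :: nat
  proof
    assume "\<exists>q\<le>y. \<exists>r\<le>y. y = (2 * q + 1) * 2 ^ x + r \<and> r < 2 ^ x"
    then obtain q r where "y = (2 * q + 1) * 2 ^ x + r" "r < 2 ^ x" by blast
    then have "y div 2 ^ x = 2 * q + 1"
      by (intro div_nat_eqI) (auto simp: algebra_simps)
    then show "x \<in> set_decode y" by (simp add: set_decode_def)
  next
    assume "x \<in> set_decode y"
    then have o: "odd (y div 2 ^ x)" by (simp add: set_decode_def)
    then obtain q where q: "y div 2 ^ x = 2 * q + 1" by (elim oddE)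
    then have "y = (2 * q + 1) * 2 ^ x + y mod 2 ^ x" by (metis div_mult_mod_eq)
    moreover have "q \<le> y" using q div_le_dividend[of y "2 ^ x"] by linarith
    moreover have "y mod 2 ^ x < 2 ^ x" by simp
    ultimately show "\<exists>q\<le>y. \<exists>r\<le>y. y = (2 * q + 1) * 2 ^ x + r \<and> r < 2 ^ x"
      by (metis mod_less_eq_dividend)
  qed
  ultimately show "decidable_on \<D> 2 (\<lambda>D xs. arg xs 0 \<in> set_decode (arg xs 1))" by simp
qed

lemma computable_prod_encode [comp_intros]:
  assumes "computable_on \<D> k f" "computable_on \<D> k g"
  shows "computable_on \<D> k (\<lambda>D xs. prod_encode (f D xs, g D xs))"
proof (rule computable_comp2[OF _ assms])
  have "computable_on \<D> 2 (\<lambda>D xs. rec_nat 0 (\<lambda>n r. r + Suc n) (arg xs 0 + arg xs 1) + arg xs 0)"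
    by (intro comp_intros) auto
  moreover have "rec_nat 0 (\<lambda>n r. r + Suc n) b = triangle b" for b :: nat
    by (induction b) auto
  ultimately show "computable_on \<D> 2 (\<lambda>D xs. prod_encode (arg xs 0, arg xs 1))"
    by (simp add: prod_encode_def)
qed

section \<open>Stagewise simulation of oracle programs\<close>

text \<open>
  \<open>t s x xs\<close> runs \<open>p\<close> for \<open>s\<close> stages with the finite oracle coded by \<open>x\<close>, of which only the part
  below \<open>s\<close> may be queried; the value 0 means that there is no output yet, \<open>Suc y\<close> that the
  output is \<open>y\<close>.
\<close>

definition simulates :: "(nat \<Rightarrow> nat \<Rightarrow> nat list \<Rightarrow> nat) \<Rightarrow> prog \<Rightarrow> nat \<Rightarrow> bool" where
  "simulates t p k \<longleftrightarrow>
     computable_on UNIV (Suc (Suc k)) (\<lambda>D ys. t (arg ys 0) (arg ys 1) (tl (tl ys))) \<and>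
     (\<forall>s x xs D y. length xs = k \<longrightarrow> t s x xs = Suc y \<longrightarrow> D \<inter> {..<s} = set_decode x \<inter> {..<s}
        \<longrightarrow> computes D p xs y) \<and>
     (\<forall>D xs y. length xs = k \<longrightarrow> computes D p xs y \<longrightarrow>
        (\<exists>s0. \<forall>s\<ge>s0. \<forall>x. D \<inter> {..<s} = set_decode x \<inter> {..<s} \<longrightarrow> t s x xs = Suc y))"

lemma simulatesI:
  assumes "computable_on UNIV (Suc (Suc k)) (\<lambda>D ys. t (arg ys 0) (arg ys 1) (tl (tl ys)))"
    and "\<And>s x xs D y. length xs = k \<Longrightarrow> t s x xs = Suc y \<Longrightarrow>
      D \<inter> {..<s} = set_decode x \<inter> {..<s} \<Longrightarrow> computes D p xs y"
    and "\<And>D xs y. length xs = k \<Longrightarrow> computes D p xs y \<Longrightarrow>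
      \<exists>s0. \<forall>s\<ge>s0. \<forall>x. D \<inter> {..<s} = set_decode x \<inter> {..<s} \<longrightarrow> t s x xs = Suc y"
  shows "simulates t p k"
  unfolding simulates_def by (intro conjI allI impI; (rule assms; assumption)?)

lemma simulates_sound:
  "simulates t p k \<Longrightarrow> length xs = k \<Longrightarrow> t s x xs = Suc y \<Longrightarrow>
    D \<inter> {..<s} = set_decode x \<inter> {..<s} \<Longrightarrow> computes D p xs y"
  unfolding simulates_def by blast

lemma simulates_complete:
  assumes "simulates t p k" "length xs = k" "computes D p xs y"
  obtains s0 where "\<And>s x. s \<ge> s0 \<Longrightarrow> D \<inter> {..<s} = set_decode x \<inter> {..<s} \<Longrightarrow> t s x xs = Suc y"
proof -
  have "\<exists>s0. \<forall>s\<ge>s0. \<forall>x. D \<inter> {..<s} = set_decode x \<inter> {..<s} \<longrightarrow> t s x xs = Suc y"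
    using assms(1)[unfolded simulates_def, THEN conjunct2, THEN conjunct2] assms(2,3) by blast
  then show ?thesis using that by blast
qed

lemma simulates_computable:
  assumes "simulates t p m" "length gs = m" "computable_on \<D> k a" "computable_on \<D> k b"
    and "\<And>g. g \<in> set gs \<Longrightarrow> computable_on \<D> k g"
  shows "computable_on \<D> k (\<lambda>D xs. t (a D xs) (b D xs) (map (\<lambda>g. g D xs) gs))"
proof -
  have "computable_on \<D> (length (a # b # gs)) (\<lambda>D ys. t (arg ys 0) (arg ys 1) (tl (tl ys)))"
    using assms(1,2) computable_on_mono unfolding simulates_def by fastforce
  from computable_comp[OF this, of k] assms(3-5) show ?thesis by auto
qed

lemma map_arg_upt: "map (\<lambda>j. arg xs (m + j)) [0..<n] = drop m xs" if "length xs = m + n"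
  using that by (intro nth_equalityI) (auto simp: arg_def)

lemma map_arg_tl:
  "length xs = Suc (Suc k) \<Longrightarrow> map (\<lambda>j. arg xs (Suc (Suc j))) [0..<k] = tl (tl xs)"
  "length xs = Suc (Suc (Suc k)) \<Longrightarrow> map (\<lambda>j. arg xs (Suc (Suc (Suc j)))) [0..<k] = tl (tl (tl xs))"
  "length xs = Suc (Suc (Suc (Suc (Suc k)))) \<Longrightarrow>
    map (\<lambda>j. arg xs (Suc (Suc (Suc (Suc (Suc j)))))) [0..<k] = tl (tl (tl (tl (tl xs))))"
  using map_arg_upt[of xs 2 k] map_arg_upt[of xs 3 k] map_arg_upt[of xs 5 k]
  by (auto simp: eval_nat_numeral drop_Suc)

lemma decidable_list_all [comp_intros]:
  assumes "\<And>g. g \<in> set gs \<Longrightarrow> decidable_on \<D> k (P g)"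
  shows "decidable_on \<D> k (\<lambda>D xs. \<forall>g\<in>set gs. P g D xs)"
  using assms
proof (induction gs)
  case Nil
  show ?case by (simp add: decidable_const)
next
  case (Cons g gs)
  then have "decidable_on \<D> k (\<lambda>D xs. P g D xs \<and> (\<forall>g\<in>set gs. P g D xs))"
    by (intro decidable_conj) auto
  then show ?case by simp
qed

lemma simulates_Comp:
  assumes h: "simulates th h (length gs)" and g: "\<And>g. g \<in> set gs \<Longrightarrow> simulates (tg g) g k"
  shows "\<exists>t. simulates t (Comp h gs) k"
proof -
  define t where "t s x xs = (if \<forall>g\<in>set gs. tg g s x xs \<noteq> 0
      then th s x (map (\<lambda>g. tg g s x xs - 1) gs) else 0)" for s x xs
  have "simulates t (Comp h gs) k"
  proof (rule simulatesI)
    let ?g = "\<lambda>g D ys. tg g (arg ys 0) (arg ys 1) (tl (tl ys)) - 1"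
    have g0: "computable_on UNIV (Suc (Suc k)) (\<lambda>D ys. tg g (arg ys 0) (arg ys 1) (tl (tl ys)))"
      if "g \<in> set gs" for g
      using g[OF that] unfolding simulates_def by blast
    have "computable_on UNIV (Suc (Suc k)) (\<lambda>D ys. if \<forall>g\<in>set gs. \<not> tg g (arg ys 0) (arg ys 1) (tl (tl ys)) = 0
        then th (arg ys 0) (arg ys 1) (map (\<lambda>f. f D ys) (map ?g gs)) else 0)"
      by (intro computable_if decidable_list_all decidable_not decidable_eq computable_const g0
          simulates_computable[OF h] computable_arg) (auto intro!: computable_pred_Suc_0 g0[unfolded One_nat_def])
    then show "computable_on UNIV (Suc (Suc k)) (\<lambda>D ys. t (arg ys 0) (arg ys 1) (tl (tl ys)))"
      unfolding t_def by (simp only: map_map comp_def)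
  next
    fix s x xs D y
    assume l: "length xs = k" and t: "t s x xs = Suc y" and D: "D \<inter> {..<s} = set_decode x \<inter> {..<s}"
    have nz: "\<forall>g\<in>set gs. tg g s x xs \<noteq> 0" using t unfolding t_def by (metis nat.distinct(1))
    show "computes D (Comp h gs) xs y"
    proof (rule computes.comp)
      show "list_all2 (\<lambda>g y. computes D g xs y) gs (map (\<lambda>g. tg g s x xs - 1) gs)"
        using nz simulates_sound[OF g l _ D]
        by (auto simp: list_all2_conv_all_nth)
      show "computes D h (map (\<lambda>g. tg g s x xs - 1) gs) y"
        using simulates_sound[OF h _ _ D, of "map (\<lambda>g. tg g s x xs - 1) gs"] t nz by (simp add: t_def)
    qed
  next
    fix D xs y assume l: "length xs = k" and c: "computes D (Comp h gs) xs y"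
    from c obtain ys where ys: "list_all2 (\<lambda>g y. computes D g xs y) gs ys" "computes D h ys y"
      by (blast elim: computes_CompE)
    have len: "length ys = length gs" using ys(1) by (simp add: list_all2_lengthD)
    from simulates_complete[OF h len ys(2)] obtain s1 where
      s1: "\<And>s x. s \<ge> s1 \<Longrightarrow> D \<inter> {..<s} = set_decode x \<inter> {..<s} \<Longrightarrow> th s x ys = Suc y" by blast
    have "\<exists>s0. \<forall>s\<ge>s0. \<forall>x. D \<inter> {..<s} = set_decode x \<inter> {..<s} \<longrightarrow> tg (gs ! i) s x xs = Suc (ys ! i)"
      if "i < length gs" for i
      using simulates_complete[OF g l, of "gs ! i" D "ys ! i"] ys(1) that
      by (metis list_all2_conv_all_nth nth_mem)
    then obtain S where S: "\<And>i s x. i < length gs \<Longrightarrow> s \<ge> S i \<Longrightarrow> D \<inter> {..<s} = set_decode x \<inter> {..<s} \<Longrightarrow>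
        tg (gs ! i) s x xs = Suc (ys ! i)" by metis
    define s0 where "s0 = s1 + (\<Sum>i<length gs. S i)"
    have "t s x xs = Suc y" if "s \<ge> s0" "D \<inter> {..<s} = set_decode x \<inter> {..<s}" for s x
    proof -
      have eq: "tg (gs ! i) s x xs = Suc (ys ! i)" if i: "i < length gs" for i
      proof (rule S[OF i])
        have "S i \<le> (\<Sum>i<length gs. S i)" using i by (intro member_le_sum) auto
        then show "s \<ge> S i" using \<open>s \<ge> s0\<close> by (simp add: s0_def)
      qed fact
      have "map (\<lambda>g. tg g s x xs - 1) gs = ys"
        using len eq by (intro nth_equalityI) auto
      moreover have "\<forall>g\<in>set gs. tg g s x xs \<noteq> 0"
        using eq by (metis in_set_conv_nth nat.distinct(1))
      ultimately show ?thesis using s1[of s x] that by (simp add: t_def s0_def)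
    qed
    then show "\<exists>s0. \<forall>s\<ge>s0. \<forall>x. D \<inter> {..<s} = set_decode x \<inter> {..<s} \<longrightarrow> t s x xs = Suc y" by blast
  qed
  then show ?thesis by blast
qed

lemma simulates_PrimRec:
  assumes g: "simulates tg g k" and h: "simulates th h (Suc (Suc k))"
  shows "\<exists>t. simulates t (PrimRec g h) (Suc k)"
proof -
  \<comment> \<open>The accumulator holds the successor of the value, and 0 is absorbing: if one
    step gives no output within \<open>s\<close> stages, no later step does.\<close>
  define r where "r s x xs = rec_nat (tg s x xs) (\<lambda>n r. if r = 0 then 0 else th s x (n # (r - 1) # xs))" for s x xs
  have r_0: "r s x xs 0 = tg s x xs" and
    r_Suc: "r s x xs (Suc n) = (if r s x xs n = 0 then 0 else th s x (n # (r s x xs n - 1) # xs))" for s x xs n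
    by (simp_all add: r_def)
  have "simulates (\<lambda>s x ys. r s x (tl ys) (arg ys 0)) (PrimRec g h) (Suc k)"
  proof (rule simulatesI)
    let ?xs = "map (\<lambda>j (D :: nat set) ys. arg ys (3 + j)) [0..<k]"
    let ?xs' = "map (\<lambda>j (D :: nat set) ys. arg ys (5 + j)) [0..<k]"
    let ?h = "(\<lambda>D ys. arg ys 0) # (\<lambda>D ys. arg ys 1 - 1) # ?xs'"
    have "computable_on UNIV (Suc (Suc (Suc k))) (\<lambda>D ys. tg (arg ys 0) (arg ys 1) (map (\<lambda>f. f D ys) ?xs))"
      by (rule simulates_computable[OF g]) (auto intro!: comp_intros)
    then have tg: "computable_on UNIV (Suc (Suc (Suc k))) (\<lambda>D ys. tg (arg ys 0) (arg ys 1) (tl (tl (tl ys))))"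
      by (rule computable_on_cong) (auto simp: comp_def map_arg_tl eval_nat_numeral)
    have "computable_on UNIV (Suc (Suc (Suc (Suc (Suc k))))) (\<lambda>D ys. th (arg ys 2) (arg ys 3) (map (\<lambda>f. f D ys) ?h))"
      by (rule simulates_computable[OF h]) (auto intro!: comp_intros)
    then have "computable_on UNIV (Suc (Suc (Suc (Suc (Suc k))))) (\<lambda>D ys. th (arg ys 2) (arg ys 3)
        (arg ys 0 # (arg ys 1 - 1) # tl (tl (tl (tl (tl ys))))))"
      by (rule computable_on_cong) (auto simp: comp_def map_arg_tl eval_nat_numeral)
    then have "computable_on UNIV (Suc (Suc (Suc (Suc (Suc k))))) (\<lambda>D ys. if arg ys 1 = 0 then 0 else
        th (arg (tl (tl ys)) 0) (arg (tl (tl ys)) 1) (arg ys 0 # (arg ys 1 - 1) # tl (tl (tl (tl (tl ys))))))"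
      by (intro computable_if decidable_eq computable_const computable_arg) (auto simp: eval_nat_numeral)
    from computable_rec[OF _ tg this, of "\<lambda>D ys. arg ys 2"]
    show "computable_on UNIV (Suc (Suc (Suc k))) (\<lambda>D ys. r (arg ys 0) (arg ys 1) (tl (tl (tl ys))) (arg (tl (tl ys)) 0))"
      unfolding r_def by (auto simp: eval_nat_numeral intro: computable_arg)
  next
    fix s x ys D y
    assume l: "length ys = Suc k" and t: "r s x (tl ys) (arg ys 0) = Suc y"
      and D: "D \<inter> {..<s} = set_decode x \<inter> {..<s}"
    obtain n xs where ys: "ys = n # xs" and lx: "length xs = k" using l by (cases ys) auto
    have "r s x xs n = Suc y \<Longrightarrow> computes D (PrimRec g h) (n # xs) y"
    proof (induction n arbitrary: y)
      case 0
      then show ?case using simulates_sound[OF g lx _ D] by (auto simp: r_0 intro: computes.primrec_0)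
    next
      case (Suc n)
      from Suc.prems have "r s x xs n \<noteq> 0" by (metis r_Suc nat.distinct(1))
      then obtain z where z: "r s x xs n = Suc z" by (metis not0_implies_Suc)
      with Suc.prems have "th s x (n # z # xs) = Suc y" by (simp add: r_Suc)
      then have "computes D h (n # z # xs) y" using simulates_sound[OF h _ _ D, of "n # z # xs"] lx by simp
      with Suc.IH[OF z] show ?case by (rule computes.primrec_Suc)
    qed
    with t ys show "computes D (PrimRec g h) ys y" by simp
  next
    fix D ys y assume l: "length ys = Suc k" and c: "computes D (PrimRec g h) ys y"
    obtain n xs where ys: "ys = n # xs" and lx: "length xs = k" using l by (cases ys) auto
    have "computes D (PrimRec g h) (n # xs) y \<Longrightarrow>
        \<exists>s0. \<forall>s\<ge>s0. \<forall>x. D \<inter> {..<s} = set_decode x \<inter> {..<s} \<longrightarrow> r s x xs n = Suc y"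
    proof (induction n arbitrary: y)
      case 0
      then have "computes D g xs y" by (auto elim: computes_PrimRecE)
      then show ?case using simulates_complete[OF g lx] by (metis r_0)
    next
      case (Suc n)
      then obtain z where z: "computes D (PrimRec g h) (n # xs) z" "computes D h (n # z # xs) y"
        by (auto elim: computes_PrimRecE)
      from Suc.IH[OF z(1)] obtain s1 where
        s1: "\<And>s x. s \<ge> s1 \<Longrightarrow> D \<inter> {..<s} = set_decode x \<inter> {..<s} \<Longrightarrow> r s x xs n = Suc z" by blast
      from simulates_complete[OF h _ z(2)] lx obtain s2 where
        s2: "\<And>s x. s \<ge> s2 \<Longrightarrow> D \<inter> {..<s} = set_decode x \<inter> {..<s} \<Longrightarrow> th s x (n # z # xs) = Suc y" by auto
      show ?case
        by (rule exI[of _ "max s1 s2"]) (simp add: r_Suc s1 s2)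
    qed
    with c ys show "\<exists>s0. \<forall>s\<ge>s0. \<forall>x. D \<inter> {..<s} = set_decode x \<inter> {..<s} \<longrightarrow> r s x (tl ys) (arg ys 0) = Suc y"
      by simp
  qed
  then show ?thesis by blast
qed

lemma simulates_Mu:
  assumes g: "simulates tg g (Suc k)"
  shows "\<exists>t. simulates t (Mu g) k"
proof -
  \<comment> \<open>The values 0 and 1 of \<open>tg\<close> mean no output yet and output 0. The
    search stops at either, and \<open>s \<le> n\<close> makes it total; \<open>t\<close> then
    accepts only a stop below \<open>s\<close> with value 1.\<close>
  define M where "M s x xs = (LEAST n. s \<le> n \<or> tg s x (n # xs) \<le> 1)" for s x xs
  define t where "t s x xs = (if M s x xs < s \<and> tg s x (M s x xs # xs) = 1 then Suc (M s x xs) else 0)" for s x xs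
  have "simulates t (Mu g) k"
  proof (rule simulatesI)
    let ?xs = "map (\<lambda>j (D :: nat set) ys. arg ys (2 + j)) [0..<k]"
    let ?xs' = "map (\<lambda>j (D :: nat set) ys. arg ys (3 + j)) [0..<k]"
    have "computable_on UNIV (Suc (Suc (Suc k)))
        (\<lambda>D ys. tg (arg ys 1) (arg ys 2) (map (\<lambda>f. f D ys) ((\<lambda>D ys. arg ys 0) # ?xs')))"
      by (rule simulates_computable[OF g]) (auto intro!: comp_intros)
    then have tg: "computable_on UNIV (Suc (Suc (Suc k))) (\<lambda>D ys. tg (arg ys 1) (arg ys 2) (arg ys 0 # tl (tl (tl ys))))"
      by (rule computable_on_cong) (auto simp: comp_def map_arg_tl eval_nat_numeral)
    then have "computable_on UNIV (Suc (Suc k)) (\<lambda>D ys. LEAST n. arg ys 0 \<le> n \<or> tg (arg ys 0) (arg ys 1) (n # tl (tl ys)) \<le> 1)"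
      by (intro computable_Least decidable_disj decidable_le computable_const computable_arg)
        (auto simp: eval_nat_numeral intro: computable_arg)
    then have M: "computable_on UNIV (Suc (Suc k)) (\<lambda>D ys. M (arg ys 0) (arg ys 1) (tl (tl ys)))"
      unfolding M_def .
    have "computable_on UNIV (Suc (Suc k))
        (\<lambda>D ys. tg (arg ys 0) (arg ys 1) (map (\<lambda>f. f D ys) ((\<lambda>D ys. M (arg ys 0) (arg ys 1) (tl (tl ys))) # ?xs)))"
      by (rule simulates_computable[OF g]) (auto intro!: comp_intros M[unfolded One_nat_def])
    then have "computable_on UNIV (Suc (Suc k)) (\<lambda>D ys. tg (arg ys 0) (arg ys 1) (M (arg ys 0) (arg ys 1) (tl (tl ys)) # tl (tl ys)))"
      by (rule computable_on_cong) (auto simp: comp_def map_arg_tl eval_nat_numeral)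
    then show "computable_on UNIV (Suc (Suc k)) (\<lambda>D ys. t (arg ys 0) (arg ys 1) (tl (tl ys)))"
      unfolding t_def
      by (intro computable_if decidable_conj decidable_less decidable_eq computable_const computable_Suc M computable_arg)
        (auto intro: M[unfolded One_nat_def])
  next
    fix s x xs D y
    assume l: "length xs = k" and t: "t s x xs = Suc y" and D: "D \<inter> {..<s} = set_decode x \<inter> {..<s}"
    then have y: "y = M s x xs" "y < s" "tg s x (y # xs) = Suc 0"
      by (auto simp: t_def split: if_splits)
    show "computes D (Mu g) xs y"
    proof (rule computes.mu)
      show "computes D g (y # xs) 0" using simulates_sound[OF g _ y(3) D] l by simp
      show "\<forall>m<y. \<exists>z. computes D g (m # xs) (Suc z)"
      proof (intro allI impI)
        fix m assume "m < y"
        then have "\<not> tg s x (m # xs) \<le> 1" using not_less_Least unfolding y(1) M_def by blast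
        then obtain z where "tg s x (m # xs) = Suc (Suc z)"
          by (metis One_nat_def le_SucI le_zero_eq not0_implies_Suc le_refl)
        then show "\<exists>z. computes D g (m # xs) (Suc z)" using simulates_sound[OF g _ _ D] l
          by (metis length_Cons)
      qed
    qed
  next
    fix D xs y assume l: "length xs = k" and c: "computes D (Mu g) xs y"
    then have y: "computes D g (y # xs) 0" "\<forall>m<y. \<exists>z. computes D g (m # xs) (Suc z)"
      by (auto elim: computes_MuE)
    from simulates_complete[OF g _ y(1)] l obtain s1 where
      s1: "\<And>s x. s \<ge> s1 \<Longrightarrow> D \<inter> {..<s} = set_decode x \<inter> {..<s} \<Longrightarrow> tg s x (y # xs) = Suc 0" by auto
    have "\<exists>s0. \<forall>s\<ge>s0. \<forall>x. D \<inter> {..<s} = set_decode x \<inter> {..<s} \<longrightarrow> tg s x (m # xs) > 1" if "m < y" for m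
    proof -
      from y(2) that obtain z where "computes D g (m # xs) (Suc z)" by blast
      from simulates_complete[OF g _ this] l show ?thesis by (metis length_Cons less_Suc_eq_le One_nat_def Suc_le_mono zero_le)
    qed
    then obtain S where S: "\<And>m s x. m < y \<Longrightarrow> s \<ge> S m \<Longrightarrow> D \<inter> {..<s} = set_decode x \<inter> {..<s} \<Longrightarrow>
        tg s x (m # xs) > 1" by metis
    define s0 where "s0 = s1 + Suc y + (\<Sum>i<y. S i)"
    have "t s x xs = Suc y" if s: "s \<ge> s0" and D: "D \<inter> {..<s} = set_decode x \<inter> {..<s}" for s x
    proof -
      have ls: "\<not> (s \<le> m \<or> tg s x (m # xs) \<le> 1)" if m: "m < y" for m
      proof -
        have "S m \<le> (\<Sum>i<y. S i)" using m by (intro member_le_sum) auto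
        then have "s \<ge> S m" using s by (simp add: s0_def)
        then show ?thesis using S[OF m _ D] m s by (simp add: s0_def)
      qed
      have "M s x xs = y" unfolding M_def
        using ls s1[OF _ D] s by (intro Least_equality) (auto simp: s0_def not_less[symmetric])
      then show ?thesis using s1[OF _ D] s by (simp add: t_def s0_def)
    qed
    then show "\<exists>s0. \<forall>s\<ge>s0. \<forall>x. D \<inter> {..<s} = set_decode x \<inter> {..<s} \<longrightarrow> t s x xs = Suc y" by blast
  qed
  then show ?thesis by blast
qed

lemma computes_imp_simulates_zero:
  assumes "\<And>D xs y. length xs = k \<Longrightarrow> \<not> computes D p xs y"
  shows "simulates (\<lambda>s x xs. 0) p k"
  using assms by (intro simulatesI) (auto intro: computable_const)

theorem simulation_exists: "\<exists>t. simulates t p k"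
proof (induction p arbitrary: k)
  case Zero
  have "simulates (\<lambda>s x xs. 1) Zero k"
    by (intro simulatesI) (auto intro!: computable_const computes.zero elim: computes_ZeroE)
  then show ?case by blast
next
  case Succ
  have "simulates (\<lambda>s x xs. Suc (Suc (arg xs 0))) Succ k" if "k > 0"
  proof (rule simulatesI)
    show "computable_on UNIV (Suc (Suc k)) (\<lambda>D ys. Suc (Suc (arg (tl (tl ys)) 0)))"
      using that by (auto intro!: comp_intros)
  next
    fix s x and xs :: "nat list" and D y
    assume "length xs = k" "Suc (Suc (arg xs 0)) = Suc y"
    with that obtain z zs where "xs = z # zs" "y = Suc z" by (cases xs) auto
    then show "computes D Succ xs y" by (simp add: computes.succ)
  qed (auto elim!: computes_SuccE)
  moreover have "simulates (\<lambda>s x xs. 0) Succ k" if "k = 0"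
    using that by (intro computes_imp_simulates_zero) (auto elim: computes_SuccE)
  ultimately show ?case by blast
next
  case (Proj i)
  have "simulates (\<lambda>s x xs. Suc (arg xs i)) (Proj i) k" if "i < k"
  proof (rule simulatesI)
    show "computable_on UNIV (Suc (Suc k)) (\<lambda>D ys. Suc (arg (tl (tl ys)) i))"
      using that by (auto intro!: comp_intros)
  next
    fix s x and xs :: "nat list" and D y
    assume "length xs = k" "Suc (arg xs i) = Suc y"
    with that show "computes D (Proj i) xs y"
      by (auto simp: arg_def intro: computes.proj)
  qed (auto elim!: computes_ProjE simp: arg_def)
  moreover have "simulates (\<lambda>s x xs. 0) (Proj i) k" if "\<not> i < k"
    using that by (intro computes_imp_simulates_zero) (auto elim: computes_ProjE)
  ultimately show ?case by blast
next
  case Query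
  have "simulates (\<lambda>s x xs. if arg xs 0 < s then Suc (of_bool (arg xs 0 \<in> set_decode x)) else 0) Query k" if "k > 0"
  proof (rule simulatesI)
    show "computable_on UNIV (Suc (Suc k)) (\<lambda>D ys. if arg (tl (tl ys)) 0 < arg ys 0
        then Suc (of_bool (arg (tl (tl ys)) 0 \<in> set_decode (arg ys 1))) else 0)"
      using that by (auto intro!: comp_intros)
  next
    fix s x and xs :: "nat list" and D y
    assume l: "length xs = k" and t: "(if arg xs 0 < s then Suc (of_bool (arg xs 0 \<in> set_decode x)) else 0) = Suc y"
      and D: "D \<inter> {..<s} = set_decode x \<inter> {..<s}"
    with that obtain z zs where xs: "xs = z # zs" by (cases xs) auto
    from t xs have "z < s" "y = of_bool (z \<in> set_decode x)" by (auto split: if_splits)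
    moreover from this D have "z \<in> set_decode x \<longleftrightarrow> z \<in> D" by blast
    ultimately show "computes D Query xs y" using computes.query[of D z zs] xs by (simp add: of_bool_def)
  next
    fix D xs y assume "computes D Query xs y"
    then obtain z zs where xs: "xs = z # zs" "y = (if z \<in> D then 1 else 0)" by (auto elim: computes_QueryE)
    show "\<exists>s0. \<forall>s\<ge>s0. \<forall>x. D \<inter> {..<s} = set_decode x \<inter> {..<s} \<longrightarrow>
      (if arg xs 0 < s then Suc (of_bool (arg xs 0 \<in> set_decode x)) else 0) = Suc y"
    proof (intro exI[of _ "Suc z"] allI impI)
      fix s x assume s: "Suc z \<le> s" and eq: "D \<inter> {..<s} = set_decode x \<inter> {..<s}"
      have "z \<in> {..<s}" using s by simp
      with eq have "z \<in> set_decode x \<longleftrightarrow> z \<in> D" by blast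
      with xs s show "(if arg xs 0 < s then Suc (of_bool (arg xs 0 \<in> set_decode x)) else 0) = Suc y"
        by simp
    qed
  qed
  moreover have "simulates (\<lambda>s x xs. 0) Query k" if "k = 0"
    using that by (intro computes_imp_simulates_zero) (auto elim: computes_QueryE)
  ultimately show ?case by blast
next
  case (Comp h gs)
  have "\<forall>g\<in>set gs. \<exists>t. simulates t g k" using Comp.IH(2) by blast
  from bchoice[OF this] obtain tg where "\<And>g. g \<in> set gs \<Longrightarrow> simulates (tg g) g k" by blast
  moreover obtain th where "simulates th h (length gs)" using Comp.IH(1) by blast
  ultimately show ?case by (intro simulates_Comp) auto
next
  case (PrimRec g h)
  show ?case
  proof (cases k)
    case 0
    then have "simulates (\<lambda>s x xs. 0) (PrimRec g h) k"
      by (intro computes_imp_simulates_zero) (auto elim: computes_PrimRecE)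
    then show ?thesis by blast
  next
    case (Suc k')
    obtain tg where "simulates tg g k'" using PrimRec.IH(1) by blast
    moreover obtain th where "simulates th h (Suc (Suc k'))" using PrimRec.IH(2) by blast
    ultimately show ?thesis unfolding Suc by (rule simulates_PrimRec)
  qed
next
  case (Mu g)
  then obtain tg where "simulates tg g (Suc k)" by blast
  then show ?case by (rule simulates_Mu)
qed

text \<open>The use principle: a simulation that has halted by stage \<open>s\<close> has read the
  oracle only below \<open>s\<close>.\<close>

corollary computes_use:
  assumes "computes D p xs y"
  obtains s where "\<And>E. E \<inter> {..<s} = D \<inter> {..<s} \<Longrightarrow> computes E p xs y"
proof -
  obtain t where t: "simulates t p (length xs)" using simulation_exists by blast
  obtain s where s: "\<And>r x. r \<ge> s \<Longrightarrow> D \<inter> {..<r} = set_decode x \<inter> {..<r} \<Longrightarrow> t r x xs = Suc y"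
    using simulates_complete[OF t refl assms] by metis
  let ?x = "set_encode (D \<inter> {..<s})"
  have x: "set_decode ?x = D \<inter> {..<s}" by simp
  have "computes E p xs y" if "E \<inter> {..<s} = D \<inter> {..<s}" for E
  proof (rule simulates_sound[OF t refl])
    show "t s ?x xs = Suc y" by (rule s) (auto simp: x)
    show "E \<inter> {..<s} = set_decode ?x \<inter> {..<s}" using that x by auto
  qed
  then show ?thesis using that by blast
qed

section \<open>A universal enumeration by forcing with closed conditions\<close>

lemma W_use:
  assumes "n \<in> W e D"
  obtains s where "\<And>E. E \<inter> {..<s} = D \<inter> {..<s} \<Longrightarrow> n \<in> W e E"
proof -
  from assms obtain y where y: "computes D e [n] y" by (auto simp: W_def)
  obtain s where s: "\<And>E. E \<inter> {..<s} = D \<inter> {..<s} \<Longrightarrow> computes E e [n] y"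
    using computes_use[OF y] by metis
  have "n \<in> W e E" if "E \<inter> {..<s} = D \<inter> {..<s}" for E
    using s[OF that] by (auto simp: W_def)
  then show ?thesis by (rule that)
qed

lemma set_decode_less:
  assumes "i \<in> set_decode x"
  shows "i < x"
proof -
  have "set_decode (set_encode {i}) \<subseteq> set_decode x"
    using assms by (subst set_encode_inverse) auto
  then have "set_encode {i} \<le> x" by (rule subset_decode_imp_le)
  then have "2 ^ i \<le> x" by (simp add: set_encode_def)
  with less_exp[of i] show ?thesis by (rule less_le_trans)
qed

text \<open>A condition may forbid only a c.e. family of finite sets, presented by decidable stages
  \<open>q\<close>; these stages later become part of the axioms of the universal
  enumeration.\<close>

definition semidecidable :: "nat set set \<Rightarrow> bool" where
  "semidecidable X \<longleftrightarrow> (\<exists>q. decidable_on UNIV 2 (\<lambda>D xs. q (arg xs 0) (arg xs 1)) \<and>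
     (\<forall>x. set_decode x \<in> X \<longleftrightarrow> (\<exists>s. q s x)))"

lemma semidecidable_empty: "semidecidable {}"
  unfolding semidecidable_def
  by (rule exI[of _ "\<lambda>s x. False"]) (auto intro: decidable_const)

lemma semidecidable_Un:
  assumes "semidecidable X" "semidecidable Y"
  shows "semidecidable (X \<union> Y)"
proof -
  from assms obtain p q where
    p: "decidable_on UNIV 2 (\<lambda>D xs. p (arg xs 0) (arg xs 1))" "\<And>x. set_decode x \<in> X \<longleftrightarrow> (\<exists>s. p s x)" and
    q: "decidable_on UNIV 2 (\<lambda>D xs. q (arg xs 0) (arg xs 1))" "\<And>x. set_decode x \<in> Y \<longleftrightarrow> (\<exists>s. q s x)"
    unfolding semidecidable_def by blast
  have "decidable_on UNIV 2 (\<lambda>D xs. p (arg xs 0) (arg xs 1) \<or> q (arg xs 0) (arg xs 1))"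
    using p(1) q(1) by (rule decidable_disj)
  then show ?thesis unfolding semidecidable_def
    by (intro exI[of _ "\<lambda>s x. p s x \<or> q s x"]) (auto simp: p(2) q(2))
qed

lemma decidable_subset_decode:
  assumes "finite F" "computable_on \<D> k f"
  shows "decidable_on \<D> k (\<lambda>D xs. F \<subseteq> set_decode (f D xs))"
proof (rule decidable_comp1[OF _ assms(2)])
  have "decidable_on \<D> 1 (\<lambda>D xs. \<forall>i<set_encode F. i \<in> set_decode (set_encode F) \<longrightarrow> i \<in> set_decode (arg xs 0))"
    by (auto intro!: comp_intros)
  moreover have "(\<forall>i<set_encode F. i \<in> set_decode (set_encode F) \<longrightarrow> i \<in> set_decode x) \<longleftrightarrow> F \<subseteq> set_decode x" for x
    using set_decode_less[of _ "set_encode F"] assms(1) by auto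
  ultimately show "decidable_on \<D> 1 (\<lambda>D xs. F \<subseteq> set_decode (arg xs 0))" by simp
qed

lemma semidecidable_W_family:
  assumes "finite F"
  shows "\<exists>q. decidable_on UNIV 3 (\<lambda>D xs. q (arg xs 0) (arg xs 1) (arg xs 2)) \<and>
    (\<forall>n x. F \<subseteq> set_decode x \<and> n \<in> W e (set_decode x) \<longleftrightarrow> (\<exists>s. q s n x))"
proof -
  obtain t where t: "simulates t e 1" using simulation_exists by blast
  have "computable_on UNIV 3 (\<lambda>D xs. t (arg xs 0) (arg xs 2) (map (\<lambda>g. g D xs) [\<lambda>D xs. arg xs 1]))"
    by (rule simulates_computable[OF t]) (auto intro: computable_arg)
  then have "decidable_on UNIV 3 (\<lambda>D xs. F \<subseteq> set_decode (arg xs 2) \<and> \<not> t (arg xs 0) (arg xs 2) [arg xs 1] = 0)"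
    by (intro decidable_conj decidable_not decidable_eq decidable_subset_decode assms computable_const computable_arg)
      auto
  moreover have "F \<subseteq> set_decode x \<and> n \<in> W e (set_decode x) \<longleftrightarrow> (\<exists>s. F \<subseteq> set_decode x \<and> \<not> t s x [n] = 0)" for n x
  proof -
    have "n \<in> W e (set_decode x)" if "t s x [n] \<noteq> 0" for s
    proof -
      from that obtain y where "t s x [n] = Suc y" by (meson not0_implies_Suc)
      then have "computes (set_decode x) e [n] y" using simulates_sound[OF t, of "[n]"] by simp
      then show ?thesis by (auto simp: W_def)
    qed
    moreover have "\<exists>s. t s x [n] \<noteq> 0" if "n \<in> W e (set_decode x)"
    proof -
      from that obtain y where y: "computes (set_decode x) e [n] y" by (auto simp: W_def)
      have "length [n] = 1" by simp
      from simulates_complete[OF t this y] show ?thesis by (metis nat.distinct(1) order_refl)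
    qed
    ultimately show ?thesis by blast
  qed
  ultimately show ?thesis
    by (intro exI[of _ "\<lambda>s n x. F \<subseteq> set_decode x \<and> \<not> t s x [n] = 0"] conjI) blast+
qed

lemma semidecidable_W:
  assumes "finite F"
  shows "semidecidable {E. F \<subseteq> E \<and> n \<in> W e E}"
proof -
  obtain q where q: "decidable_on UNIV 3 (\<lambda>D xs. q (arg xs 0) (arg xs 1) (arg xs 2))"
    "\<And>n x. F \<subseteq> set_decode x \<and> n \<in> W e (set_decode x) \<longleftrightarrow> (\<exists>s. q s n x)"
    using semidecidable_W_family[OF assms, of e] by blast
  have "decidable_on UNIV 2 (\<lambda>D xs. q (arg xs 0) n (arg xs 1))"
    by (rule decidable_comp3[where P = "\<lambda>D. q", OF q(1)]) (auto intro!: comp_intros)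
  then show ?thesis unfolding semidecidable_def using q(2)
    by (intro exI[of _ "\<lambda>s x. q s n x"]) auto
qed

section \<open>Closed conditions and the generic sequence\<close>

definition initial :: "nat set \<Rightarrow> nat set \<Rightarrow> bool" where
  "initial F D \<longleftrightarrow> F \<subseteq> D \<and> (\<forall>x\<in>D - F. \<forall>y\<in>F. y < x)"

lemma initialD: "initial F D \<Longrightarrow> x \<in> D \<Longrightarrow> y \<in> F \<Longrightarrow> x \<le> y \<Longrightarrow> x \<in> F"
  unfolding initial_def by (meson DiffI leD)

text \<open>All finite subsets are tested against \<open>X\<close>, not only initial segments. Hence
  the class passes to every infinite subset that still has \<open>F\<close> as an initial
  part.\<close>

definition closed_class :: "nat set \<Rightarrow> nat set \<Rightarrow> nat set set \<Rightarrow> nat set set" where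
  "closed_class A F X =
     {R. R \<subseteq> A \<and> infinite R \<and> initial F R \<and> (\<forall>E. finite E \<longrightarrow> E \<subseteq> R \<longrightarrow> E \<notin> X)}"

text \<open>The oracles are arbitrary finite sets between \<open>F\<close> and \<open>R\<close>, so
  that listing \<open>n\<close> depends on positive information about \<open>R\<close>
  alone.\<close>

definition enumerates_on :: "nat set \<Rightarrow> nat set \<Rightarrow> nat set set \<Rightarrow> prog \<Rightarrow> bool" where
  "enumerates_on A F X e \<longleftrightarrow> (\<forall>R\<in>closed_class A F X. \<forall>n.
     n \<in> A \<longleftrightarrow> (\<exists>E. finite E \<and> F \<subseteq> E \<and> E \<subseteq> R \<and> n \<in> W e E))"

text \<open>A failure at \<open>n\<close> has one of two forms. If \<open>n \<notin> A\<close> but a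
  finite \<open>E\<close> lists \<open>n\<close>, the new condition commits to \<open>E\<close> up
  to the use of that computation. If \<open>n \<in> A\<close> but no \<open>E\<close> lists
  \<open>n\<close>, the sets listing \<open>n\<close> are forbidden, and \<open>R\<close> itself
  shows that the new class is nonempty.\<close>

lemma force_not_enumerates:
  assumes F: "finite F" and X: "semidecidable X" and ne: "\<not> enumerates_on A F X e"
  shows "\<exists>F' X'. finite F' \<and> semidecidable X' \<and> initial F F' \<and> F \<noteq> F' \<and> X \<subseteq> X' \<and>
    closed_class A F' X' \<noteq> {} \<and> (\<forall>D\<in>closed_class A F' X'. W e D \<noteq> A)"
proof -
  from ne obtain R n where R: "R \<in> closed_class A F X" and
    n: "\<not> (n \<in> A \<longleftrightarrow> (\<exists>E. finite E \<and> F \<subseteq> E \<and> E \<subseteq> R \<and> n \<in> W e E))"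
    unfolding enumerates_on_def by blast
  from R have R': "R \<subseteq> A" "infinite R" "initial F R" "\<And>E. finite E \<Longrightarrow> E \<subseteq> R \<Longrightarrow> E \<notin> X"
    unfolding closed_class_def by blast+
  show ?thesis
  proof (cases "n \<in> A")
    case False
    with n obtain E where E: "finite E" "F \<subseteq> E" "E \<subseteq> R" "n \<in> W e E" by blast
    obtain s where s: "\<And>D. D \<inter> {..<s} = E \<inter> {..<s} \<Longrightarrow> n \<in> W e D" using W_use[OF E(4)] by metis
    \<comment> \<open>With \<open>r\<close> beyond the use and adjoined to the finite part, no set
      obeying the new condition can gain further elements below \<open>s\<close>.\<close>
    obtain r where r: "r \<in> R" "r > Max (insert s E)"
      using R'(2) by (meson infinite_nat_iff_unbounded)
    from r(2) E(1) have r': "r > s" "\<And>x. x \<in> E \<Longrightarrow> x < r" by auto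
    let ?F = "insert r E" and ?R = "E \<union> {x\<in>R. r \<le> x}"
    have "finite ?F" using E(1) by simp
    moreover have "initial F ?F"
      using R'(3) E(2,3) r(1) r'(2) unfolding initial_def by blast
    moreover have "F \<noteq> ?F" using E(2) r'(2) by blast
    moreover have "?R \<in> closed_class A ?F X"
      unfolding closed_class_def
    proof (intro CollectI conjI allI impI)
      show "?R \<subseteq> A" using E(3) R'(1) by blast
      have "R \<subseteq> ?R \<union> {..<r}" by auto
      then show "infinite ?R" using R'(2) by (meson finite_Un finite_lessThan finite_subset)
      show "initial ?F ?R" using r(1) r'(2) unfolding initial_def
        by (auto simp: order.strict_iff_order intro: less_imp_le order.trans)
      show "G \<notin> X" if "finite G" "G \<subseteq> ?R" for G using that R'(4) E(3) by blast
    qed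
    moreover have "W e D \<noteq> A" if "D \<in> closed_class A ?F X" for D
    proof -
      from that have D: "initial ?F D" unfolding closed_class_def by blast
      have "D \<inter> {..<s} = E \<inter> {..<s}"
      proof
        show "E \<inter> {..<s} \<subseteq> D \<inter> {..<s}" using D unfolding initial_def by blast
        show "D \<inter> {..<s} \<subseteq> E \<inter> {..<s}"
        proof
          fix x assume "x \<in> D \<inter> {..<s}"
          with r'(1) have "x \<in> D" "x < s" "x < r" by auto
          with initialD[OF D, of x r] have "x \<in> ?F" by simp
          with \<open>x < s\<close> \<open>x < r\<close> show "x \<in> E \<inter> {..<s}" by simp
        qed
      qed
      from s[OF this] False show ?thesis by blast
    qed
    ultimately show ?thesis using X by blast
  next
    case True
    with n have nE: "\<And>E. finite E \<Longrightarrow> F \<subseteq> E \<Longrightarrow> E \<subseteq> R \<Longrightarrow> n \<notin> W e E" by blast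
    \<comment> \<open>Adjoining one element makes the finite part grow strictly, which keeps the
      union of a sequence of such extensions infinite. The least one is chosen so that the new part
      is initial in \<open>R\<close>.\<close>
    define r where "r = (LEAST x. x \<in> R - F)"
    have "infinite (R - F)" using R'(2) F by simp
    then have r: "r \<in> R - F" unfolding r_def by (metis LeastI ex_in_conv finite.emptyI)
    have r_le: "r \<le> x" if "x \<in> R - F" for x using that unfolding r_def by (rule Least_le)
    let ?F = "insert r F" and ?X = "X \<union> {E. F \<subseteq> E \<and> n \<in> W e E}"
    have "finite ?F" using F by simp
    moreover have "semidecidable ?X" using X semidecidable_W[OF F] by (rule semidecidable_Un)
    moreover have "initial F ?F" using R'(3) r unfolding initial_def by blast
    moreover have "F \<noteq> ?F" using r by blast
    moreover have "R \<in> closed_class A ?F ?X"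
      unfolding closed_class_def
    proof (intro CollectI conjI allI impI R'(1,2))
      show "initial ?F R" using R'(3) r r_le unfolding initial_def
        by (auto simp: order.strict_iff_order)
      show "G \<notin> ?X" if "finite G" "G \<subseteq> R" for G using that R'(4) nE by blast
    qed
    moreover have "W e D \<noteq> A" if D: "D \<in> closed_class A ?F ?X" for D
    proof
      assume "W e D = A"
      with True have "n \<in> W e D" by blast
      then obtain s where s: "\<And>E. E \<inter> {..<s} = D \<inter> {..<s} \<Longrightarrow> n \<in> W e E" using W_use by metis
      let ?E = "(D \<inter> {..<s}) \<union> F"
      from D have "F \<subseteq> D" unfolding closed_class_def initial_def by blast
      then have "n \<in> W e ?E" by (intro s) blast
      then have "?E \<in> ?X" by blast
      moreover have "finite ?E" "?E \<subseteq> D" using F \<open>F \<subseteq> D\<close> by auto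
      ultimately show False using D unfolding closed_class_def by blast
    qed
    ultimately show ?thesis by blast
  qed
qed

instance prog :: countable
  by countable_datatype

lemma exists_enumerates_on:
  assumes "introenumerable A"
  obtains F X e where "finite F" "semidecidable X" "closed_class A F X \<noteq> {}" "enumerates_on A F X e"
proof (rule ccontr)
  assume "\<not> thesis"
  with that have ne: "\<And>F X e. finite F \<Longrightarrow> semidecidable X \<Longrightarrow> closed_class A F X \<noteq> {} \<Longrightarrow> \<not> enumerates_on A F X e"
    by blast
  let ?P = "\<lambda>(n :: nat) (F, X). finite F \<and> semidecidable X \<and> closed_class A F X \<noteq> {}"
  let ?Q = "\<lambda>n (F, X) (F', X'). initial F F' \<and> F \<noteq> F' \<and> X \<subseteq> X' \<and>
    (\<forall>D\<in>closed_class A F' X'. W (from_nat n) D \<noteq> A)"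
  have "\<exists>f. \<forall>n. ?P n (f n) \<and> ?Q n (f n) (f (Suc n))"
  proof (rule dependent_nat_choice)
    have "A \<in> closed_class A {} {}"
      using assms by (auto simp: closed_class_def initial_def introenumerable_def)
    then have "?P 0 ({}, {})" using semidecidable_empty by auto
    then show "\<exists>x. ?P 0 x" by blast
  next
    fix c :: "nat set \<times> nat set set" and n :: nat
    assume P: "?P n c"
    obtain F X where c: "c = (F, X)" by (cases c)
    from P c have FX: "finite F" "semidecidable X" "closed_class A F X \<noteq> {}" by auto
    from force_not_enumerates[OF FX(1,2) ne[OF FX], of "from_nat n"] obtain F' X' where
      "?P (Suc n) (F', X')" "?Q n c (F', X')" unfolding c by auto
    then show "\<exists>y. ?P (Suc n) y \<and> ?Q n c y" by blast
  qed
  then obtain f where "\<forall>n. ?P n (f n) \<and> ?Q n (f n) (f (Suc n))" by (rule exE)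
  then have f: "?P n (f n)" "?Q n (f n) (f (Suc n))" for n by simp_all
  define F where "F n = fst (f n)" for n
  define X where "X n = snd (f n)" for n
  have P: "finite (F n)" "closed_class A (F n) (X n) \<noteq> {}" for n
    using f(1)[of n] by (auto simp: F_def X_def split_beta)
  have Q: "initial (F n) (F (Suc n))" "F n \<noteq> F (Suc n)" "X n \<subseteq> X (Suc n)"
    "\<And>D. D \<in> closed_class A (F (Suc n)) (X (Suc n)) \<Longrightarrow> W (from_nat n) D \<noteq> A" for n
    using f(2)[of n] by (auto simp: F_def X_def split_beta)
  have F_mono: "F m \<subseteq> F n" if "m \<le> n" for m n
    using that by (rule lift_Suc_mono_le[rotated]) (use Q(1) in \<open>auto simp: initial_def\<close>)
  have X_mono: "X m \<subseteq> X n" if "m \<le> n" for m n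
    using that by (rule lift_Suc_mono_le[rotated]) (use Q(3) in auto)
  have F_init: "initial (F m) (F n)" if "m \<le> n" for m n
    using that
  proof (induction rule: dec_induct)
    case base
    show ?case by (simp add: initial_def)
  next
    case (step k)
    then show ?case using Q(1)[of k] unfolding initial_def by blast
  qed
  define D where "D = (\<Union>n. F n)"
  have init: "initial (F m) D" for m
    unfolding initial_def
  proof (intro conjI ballI)
    show "F m \<subseteq> D" by (auto simp: D_def)
    fix x y assume x: "x \<in> D - F m" and y: "y \<in> F m"
    then obtain n where "x \<in> F n" by (auto simp: D_def)
    then have "x \<in> F (max m n)" using F_mono[of n "max m n"] by auto
    moreover have "initial (F m) (F (max m n))" by (rule F_init) simp
    ultimately show "y < x" using x y unfolding initial_def by blast
  qed
  have "card (F n) \<ge> n" for n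
  proof (induction n)
    case (Suc n)
    have "F n \<subset> F (Suc n)" using Q(1,2)[of n] unfolding initial_def by blast
    then have "card (F n) < card (F (Suc n))" using P(1) by (intro psubset_card_mono)
    with Suc show ?case by simp
  qed simp
  then have inf: "infinite D"
    by (metis D_def UN_upper card_mono le_trans UNIV_I not_less_eq_eq)
  have "D \<in> closed_class A (F m) (X m)" for m
    unfolding closed_class_def
  proof (intro CollectI conjI allI impI init inf)
    have "F n \<subseteq> A" for n using P(2)[of n] unfolding closed_class_def initial_def by blast
    then show "D \<subseteq> A" by (auto simp: D_def)
    fix E assume E: "finite E" "E \<subseteq> D"
    then obtain k where k: "E \<subseteq> F k"
    proof -
      have "\<forall>x\<in>E. \<exists>n. x \<in> F n" using E(2) by (auto simp: D_def)
      then obtain g where g: "\<And>x. x \<in> E \<Longrightarrow> x \<in> F (g x)" by metis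
      have "E \<subseteq> F (\<Sum>x\<in>E. g x)"
        using g F_mono E(1) member_le_sum[of _ E g] by blast
      then show ?thesis using that by blast
    qed
    \<comment> \<open>\<open>E\<close> lies in the finite part of some stage, hence inside a member
      of a class from stage \<open>m\<close> or later, and that class already forbids everything in
      \<open>X m\<close>.\<close>
    obtain R where R: "R \<in> closed_class A (F (max k m)) (X (max k m))" using P(2) by blast
    then have "F (max k m) \<subseteq> R" and nX: "\<And>G. finite G \<Longrightarrow> G \<subseteq> R \<Longrightarrow> G \<notin> X (max k m)"
      unfolding closed_class_def initial_def by blast+
    moreover have "F k \<subseteq> F (max k m)" by (rule F_mono) simp
    ultimately have "E \<subseteq> R" using k by blast
    then have "E \<notin> X (max k m)" by (rule nX[OF E(1)])
    moreover have "X m \<subseteq> X (max k m)" by (rule X_mono) simp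
    ultimately show "E \<notin> X m" by blast
  qed
  then have "W (from_nat n) D \<noteq> A" for n using Q(4) by blast
  then have "W e D \<noteq> A" for e by (metis from_nat_to_nat)
  moreover have "D \<subseteq> A" using \<open>D \<in> closed_class A (F 0) (X 0)\<close> unfolding closed_class_def by blast
  ultimately show False using assms inf
    unfolding introenumerable_def infinite_subsets_def ce_in_def by blast
qed

text \<open>
  A positive enumeration operator with decidable stages. The stages are bounded by elements of the
  set itself, which makes the operator monotone and continuous on finite and infinite sets alike.
\<close>

definition hits :: "nat set \<Rightarrow> (nat \<Rightarrow> nat \<Rightarrow> nat \<Rightarrow> bool) \<Rightarrow> nat \<Rightarrow> nat set \<Rightarrow> bool" where
  "hits F q n S \<longleftrightarrow> (\<exists>e\<in>S. \<exists>E\<le>e. \<exists>s\<le>e. set_decode E \<subseteq> F \<union> S \<and> q s n E)"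

lemma hits_mono: "hits F q n S \<Longrightarrow> S \<subseteq> T \<Longrightarrow> hits F q n T"
  unfolding hits_def by blast

lemma hitsI:
  assumes "infinite S" "set_decode E \<subseteq> F \<union> S" "q s n E"
  shows "hits F q n S"
proof -
  obtain e where "e \<in> S" "e > max E s" using assms(1) by (meson infinite_nat_iff_unbounded)
  then have "e \<in> S" "E \<le> e" "s \<le> e" by auto
  then show ?thesis using assms(2,3) unfolding hits_def by blast
qed

lemma hits_cont:
  assumes "hits F q n S"
  shows "\<exists>b. hits F q n (S \<inter> {..b})"
proof -
  from assms obtain e E s where e: "e \<in> S" "E \<le> e" "s \<le> e" "set_decode E \<subseteq> F \<union> S" "q s n E"
    unfolding hits_def by blast
  have "set_decode E \<subseteq> F \<union> (S \<inter> {..e})" using e(2,4) set_decode_less[of _ E] by fastforce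
  moreover have "e \<in> S \<inter> {..e}" using e(1) by simp
  ultimately show ?thesis using e(2,3,5) unfolding hits_def by blast
qed

text \<open>An axiom fires if \<open>E\<close> is forbidden or if \<open>E\<close> lists
  \<open>n\<close>. An infinite \<open>D \<subseteq> A\<close>, adjusted to start with
  \<open>F\<close>, either contains a forbidden set, which lists every number, or obeys the
  condition, and then the enumeration is right; so no \<open>n \<in> A\<close> is missed. A set
  obeying the condition contains no forbidden set, so nothing outside \<open>A\<close> is listed
  there.\<close>

theorem universal_hits:
  assumes "introenumerable A"
  shows "\<exists>F q Y. finite F \<and> decidable_on UNIV 3 (\<lambda>D xs. q (arg xs 0) (arg xs 1) (arg xs 2)) \<and>
    (\<forall>n\<in>A. \<forall>D. D \<subseteq> A \<longrightarrow> infinite D \<longrightarrow> hits F q n D) \<and>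
    Y \<subseteq> A \<and> infinite Y \<and> (\<forall>n. n \<notin> A \<longrightarrow> \<not> hits F q n Y)"
proof -
  obtain F X e where F: "finite F" and X: "semidecidable X" and "closed_class A F X \<noteq> {}"
    and e: "enumerates_on A F X e"
    using exists_enumerates_on[OF assms] by metis
  then obtain R where R: "R \<in> closed_class A F X" by blast
  from X obtain p where p: "decidable_on UNIV 2 (\<lambda>D xs. p (arg xs 0) (arg xs 1))"
    "\<And>x. set_decode x \<in> X \<longleftrightarrow> (\<exists>s. p s x)" unfolding semidecidable_def by blast
  obtain w where w: "decidable_on UNIV 3 (\<lambda>D xs. w (arg xs 0) (arg xs 1) (arg xs 2))"
    "\<And>n x. F \<subseteq> set_decode x \<and> n \<in> W e (set_decode x) \<longleftrightarrow> (\<exists>s. w s n x)"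
    using semidecidable_W_family[OF F, of e] by blast
  define q where "q s n x \<longleftrightarrow> p s x \<or> w s n x" for s n x
  have q_iff: "(\<exists>s. q s n x) \<longleftrightarrow> set_decode x \<in> X \<or> (F \<subseteq> set_decode x \<and> n \<in> W e (set_decode x))" for n x
    unfolding q_def p(2) w(2) by blast
  show ?thesis
  proof (rule exI[of _ F], rule exI[of _ q], rule exI[of _ "R - F"], intro conjI ballI allI impI)
    show "finite F" by fact
    have "decidable_on UNIV 3 (\<lambda>D xs. p (arg xs 0) (arg xs 2))"
      by (rule decidable_comp2[where P = "\<lambda>D. p", OF p(1)]) (auto intro: computable_arg)
    then show "decidable_on UNIV 3 (\<lambda>D xs. q (arg xs 0) (arg xs 1) (arg xs 2))"
      unfolding q_def using w(1) by (rule decidable_disj)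
    show "R - F \<subseteq> A" "infinite (R - F)" using R F unfolding closed_class_def by auto
  next
    fix n D assume n: "n \<in> A" and D: "D \<subseteq> A" "infinite D"
    \<comment> \<open>Elements of \<open>D\<close> that are not above \<open>F\<close> are dropped
      to make \<open>F\<close> initial.\<close>
    let ?R = "F \<union> {x\<in>D. \<forall>y\<in>F. y < x}"
    have inf: "infinite {x\<in>D. \<forall>y\<in>F. y < x}"
    proof
      assume "finite {x\<in>D. \<forall>y\<in>F. y < x}"
      moreover have "D \<subseteq> {x\<in>D. \<forall>y\<in>F. y < x} \<union> (\<Union>y\<in>F. {..y})" by (auto simp: not_less)
      ultimately show False using D(2) F finite_subset by blast
    qed
    have "\<exists>E. finite E \<and> E \<subseteq> ?R \<and> (E \<in> X \<or> (F \<subseteq> E \<and> n \<in> W e E))"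
    proof (cases "?R \<in> closed_class A F X")
      case True
      with e have "n \<in> A \<longleftrightarrow> (\<exists>E. finite E \<and> F \<subseteq> E \<and> E \<subseteq> ?R \<and> n \<in> W e E)"
        unfolding enumerates_on_def by blast
      with n obtain E where "finite E" "F \<subseteq> E" "E \<subseteq> ?R" "n \<in> W e E" by (elim iffE) blast
      then show ?thesis by (intro exI[of _ E]) simp
    next
      case False
      have "F \<subseteq> A" using R unfolding closed_class_def initial_def by blast
      then have "?R \<subseteq> A" using D(1) by blast
      moreover have "infinite ?R" using inf by simp
      moreover have "initial F ?R" unfolding initial_def by blast
      ultimately have "\<not> (\<forall>E. finite E \<longrightarrow> E \<subseteq> ?R \<longrightarrow> E \<notin> X)"
        using False unfolding closed_class_def by simp
      then have "\<exists>E. finite E \<and> E \<subseteq> ?R \<and> E \<in> X" by simp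
      then show ?thesis by (rule ex_forward) simp
    qed
    then obtain E where E: "finite E" "E \<subseteq> ?R" "E \<in> X \<or> (F \<subseteq> E \<and> n \<in> W e E)" by blast
    then obtain s where s: "q s n (set_encode E)" using q_iff[of n "set_encode E"] by auto
    have "set_decode (set_encode E) \<subseteq> F \<union> D" using E(1,2) by auto
    then show "hits F q n D" by (rule hitsI[OF D(2)]) (rule s)
  next
    fix n assume n: "n \<notin> A"
    show "\<not> hits F q n (R - F)"
    proof
      assume "hits F q n (R - F)"
      then obtain E s where E: "set_decode E \<subseteq> F \<union> (R - F)" "q s n E" unfolding hits_def by blast
      from E(2) q_iff have "set_decode E \<in> X \<or> (F \<subseteq> set_decode E \<and> n \<in> W e (set_decode E))" by blast
      moreover have "set_decode E \<subseteq> R" using E(1) R unfolding closed_class_def initial_def by blast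
      moreover have "set_decode E \<notin> X"
        using R \<open>set_decode E \<subseteq> R\<close> finite_set_decode unfolding closed_class_def by blast
      ultimately have "\<exists>E. finite E \<and> F \<subseteq> E \<and> E \<subseteq> R \<and> n \<in> W e E"
        by (intro exI[of _ "set_decode E"]) simp
      with e R n show False unfolding enumerates_on_def by blast
    qed
  qed
qed

section \<open>Thinning a set along a filter\<close>

text \<open>The stagewise form serves computability by primitive recursion;
  \<open>in_thin_iff\<close> is the form for reasoning.\<close>

primrec thin_upto :: "nat set \<Rightarrow> (nat \<Rightarrow> nat \<Rightarrow> bool) \<Rightarrow> nat \<Rightarrow> nat set" where
  "thin_upto B ok 0 = {}"
| "thin_upto B ok (Suc y) =
     (if y \<in> B \<and> (\<forall>x\<in>thin_upto B ok y. ok x y) then insert y (thin_upto B ok y) else thin_upto B ok y)"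

definition thin :: "nat set \<Rightarrow> (nat \<Rightarrow> nat \<Rightarrow> bool) \<Rightarrow> nat set" where
  "thin B ok = (\<Union>y. thin_upto B ok y)"

lemma thin_upto_less: "x \<in> thin_upto B ok y \<Longrightarrow> x < y"
  by (induction y) (auto split: if_splits simp: less_Suc_eq)

lemma thin_upto_mono: "y \<le> z \<Longrightarrow> thin_upto B ok y \<subseteq> thin_upto B ok z"
  by (rule lift_Suc_mono_le[of "thin_upto B ok"]) auto

lemma thin_upto_eq: "thin_upto B ok y = thin B ok \<inter> {..<y}"
proof
  show "thin_upto B ok y \<subseteq> thin B ok \<inter> {..<y}"
    using thin_upto_less unfolding thin_def by blast
  have step: "x \<in> thin_upto B ok z \<Longrightarrow> x < y \<Longrightarrow> x \<in> thin_upto B ok y" for x z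
  proof (induction z)
    case (Suc z)
    show ?case
    proof (cases "x \<in> thin_upto B ok z")
      case False
      with Suc.prems have "x = z" by (auto split: if_splits)
      with Suc.prems have "x \<in> thin_upto B ok (Suc x)" "Suc x \<le> y" by auto
      then show ?thesis using thin_upto_mono by blast
    qed (use Suc in auto)
  qed simp
  then show "thin B ok \<inter> {..<y} \<subseteq> thin_upto B ok y"
    unfolding thin_def by blast
qed

lemma in_thin_iff: "y \<in> thin B ok \<longleftrightarrow> y \<in> B \<and> (\<forall>x\<in>thin B ok. x < y \<longrightarrow> ok x y)"
proof -
  have "y \<in> thin B ok \<longleftrightarrow> y \<in> thin_upto B ok (Suc y)"
    by (simp only: thin_upto_eq) simp
  also have "\<dots> \<longleftrightarrow> y \<in> B \<and> (\<forall>x\<in>thin_upto B ok y. ok x y)"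
    using thin_upto_less[of y B ok y] by auto
  finally show ?thesis by (auto simp: thin_upto_eq)
qed

lemma thin_subset: "thin B ok \<subseteq> B"
  using in_thin_iff by blast

text \<open>If only finitely many elements were taken, \<open>U\<close>-almost every
  \<open>y\<close> would pass all of their tests, and such a \<open>y\<close> beyond the maximum
  would have been taken too.\<close>

lemma infinite_thin:
  assumes U: "U \<noteq> bot" and large: "\<And>m. eventually (\<lambda>y. m < y) U"
    and B: "eventually (\<lambda>y. y \<in> B) U" and ok: "\<And>x. x \<in> B \<Longrightarrow> eventually (\<lambda>y. ok x y) U"
  shows "infinite (thin B ok)"
proof
  assume fin: "finite (thin B ok)"
  define m where "m = Max (insert 0 (thin B ok))"
  have "eventually (\<lambda>y. \<forall>x\<in>thin B ok. ok x y) U"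
    using fin ok thin_subset[of B ok] by (intro eventually_ball_finite) auto
  with B large[of m] have "eventually (\<lambda>y. y \<in> thin B ok \<and> m < y) U"
    by eventually_elim (subst in_thin_iff, blast)
  then obtain y where "y \<in> thin B ok" "m < y"
    using U eventually_happens by blast
  then show False using fin unfolding m_def by (auto simp: not_less[symmetric])
qed

section \<open>Values along an ultrafilter\<close>

locale free_ultrafilter =
  fixes U :: "nat filter"
  assumes proper: "U \<noteq> bot"
    and ultra: "eventually P U \<or> eventually (\<lambda>x. \<not> P x) U"
    and large: "eventually (\<lambda>x. m < x) U"

text \<open>Zorn's lemma in the reversed order, finer filters being smaller. The infimum of a chain
  stays proper because whatever holds eventually in it holds eventually in some member.\<close>

lemma exists_ultrafilter:
  fixes G :: "'a filter"
  assumes "G \<noteq> bot"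
  shows "\<exists>U. U \<le> G \<and> U \<noteq> bot \<and> (\<forall>P. eventually P U \<or> eventually (\<lambda>x. \<not> P x) U)"
proof -
  let ?A = "{F. F \<le> G \<and> F \<noteq> bot}" and ?ge = "\<lambda>F F' :: 'a filter. F' \<le> F"
  have "\<exists>U\<in>?A. \<forall>F\<in>?A. ?ge U F \<longrightarrow> F = U"
  proof (rule predicate_Zorn)
    show "partial_order_on ?A (relation_of ?ge ?A)"
      by (rule partial_order_on_relation_ofI) auto
    fix C assume C: "C \<in> Chains (relation_of ?ge ?A)"
    then have CA: "C \<subseteq> ?A" and chain: "\<And>F F'. F \<in> C \<Longrightarrow> F' \<in> C \<Longrightarrow> F \<le> F' \<or> F' \<le> F"
      by (auto simp: Chains_def relation_of_def)
    show "\<exists>u\<in>?A. \<forall>a\<in>C. ?ge a u"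
    proof (cases "C = {}")
      case True
      with assms show ?thesis by auto
    next
      case False
      have ev: "eventually P (Inf C) \<longleftrightarrow> (\<exists>F\<in>C. eventually P F)" for P
      proof (rule eventually_Inf_base[OF False])
        fix F F' assume F: "F \<in> C" "F' \<in> C"
        from chain[OF this] show "\<exists>H\<in>C. H \<le> inf F F'"
        proof
          assume "F \<le> F'"
          then have "F \<le> inf F F'" by simp
          with F(1) show ?thesis by blast
        next
          assume "F' \<le> F"
          then have "F' \<le> inf F F'" by simp
          with F(2) show ?thesis by blast
        qed
      qed
      have "\<not> eventually (\<lambda>x. False) F" if "F \<in> C" for F
        using CA that unfolding trivial_limit_def by blast
      then have "Inf C \<noteq> bot" unfolding trivial_limit_def ev by blast
      moreover obtain F where F: "F \<in> C" using False by blast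
      then have "Inf C \<le> G" using CA Inf_lower[OF F] by (blast intro: order_trans)
      ultimately have "Inf C \<in> ?A" by simp
      moreover have "\<forall>F\<in>C. Inf C \<le> F" using Inf_lower by blast
      ultimately show ?thesis by (rule bexI[rotated])
    qed
  qed
  then obtain U where U: "U \<le> G" "U \<noteq> bot" "\<And>F. F \<le> G \<Longrightarrow> F \<noteq> bot \<Longrightarrow> F \<le> U \<Longrightarrow> F = U" by blast
  have "eventually P U \<or> eventually (\<lambda>x. \<not> P x) U" for P
  proof (rule disjCI)
    assume "\<not> eventually (\<lambda>x. \<not> P x) U"
    then have "inf U (principal {x. P x}) \<noteq> bot"
      by (simp add: trivial_limit_def eventually_inf_principal)
    then have eq: "inf U (principal {x. P x}) = U" using U(1) by (intro U(3)) (auto intro: le_infI1)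
    have "eventually P (inf U (principal {x. P x}))" by (simp add: eventually_inf_principal)
    then show "eventually P U" unfolding eq .
  qed
  with U show ?thesis by blast
qed

lemma exists_free_ultrafilter:
  assumes "infinite Y"
  obtains U where "free_ultrafilter U" "eventually (\<lambda>y. y \<in> Y) U"
proof -
  let ?G = "inf at_top (principal Y) :: nat filter"
  have "?G \<noteq> bot"
    unfolding trivial_limit_def
    using assms by (auto simp: eventually_inf_principal eventually_at_top_linorder infinite_nat_iff_unbounded_le)
  from exists_ultrafilter[OF this] obtain U where U: "U \<le> ?G" "U \<noteq> bot"
    "\<And>P. eventually P U \<or> eventually (\<lambda>x. \<not> P x) U" by blast
  have "eventually (\<lambda>x. m < x) U" for m
    using U(1) eventually_gt_at_top[of m] by (meson filter_leD le_inf_iff)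
  moreover have "eventually (\<lambda>y. y \<in> Y) U"
    using U(1) by (meson filter_leD le_inf_iff eventually_principal)
  ultimately show ?thesis using U(2,3) that[of U] by (simp add: free_ultrafilter_def)
qed

text \<open>The implication form that the inductive definition of \<open>val\<close> needs in order
  to recurse under \<open>eventually\<close>.\<close>

lemma eventually_mono_imp: "(\<And>x. P x \<longrightarrow> Q x) \<Longrightarrow> eventually P F \<longrightarrow> eventually Q F"
  by (blast intro: eventually_mono)

text \<open>
  The eventual truth value of \<open>t\<close> at the first \<open>\<rho>\<close>-extension of \<open>H\<close> by elements that are added one
  after the other, each of them \<open>U\<close>-generically.
\<close>

inductive val :: "nat filter \<Rightarrow> (nat set \<Rightarrow> bool) \<Rightarrow> (nat set \<Rightarrow> bool) \<Rightarrow> nat set \<Rightarrow> bool"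
  for U \<rho> t where
  leaf: "\<rho> H \<Longrightarrow> t H \<Longrightarrow> val U \<rho> t H"
| node: "\<not> \<rho> H \<Longrightarrow> eventually (\<lambda>y. val U \<rho> t (insert y H)) U \<Longrightarrow> val U \<rho> t H"
monos eventually_mono_imp

lemma val_leaf: "\<rho> H \<Longrightarrow> val U \<rho> t H \<longleftrightarrow> t H"
  by (auto intro: leaf elim: val.cases)

lemma val_node: "\<not> \<rho> H \<Longrightarrow> val U \<rho> t H \<longleftrightarrow> eventually (\<lambda>y. val U \<rho> t (insert y H)) U"
  by (auto intro: node elim: val.cases)

context free_ultrafilter
begin

lemma not_eventually_iff: "\<not> eventually P U \<longleftrightarrow> eventually (\<lambda>x. \<not> P x) U"
proof
  assume "\<not> eventually P U"
  then show "eventually (\<lambda>x. \<not> P x) U" using ultra by blast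
next
  assume n: "eventually (\<lambda>x. \<not> P x) U"
  show "\<not> eventually P U"
  proof
    assume "eventually P U"
    with n have "eventually (\<lambda>x. False) U" by eventually_elim simp
    then show False using proper by (simp add: trivial_limit_def)
  qed
qed

text \<open>The false case is where \<open>U\<close> has to be an ultrafilter: not being eventually
  true must mean being eventually false.\<close>

lemma val_generic:
  assumes "\<not> \<rho> H"
  shows "eventually (\<lambda>y. val U \<rho> t (insert y H) = val U \<rho> t H) U"
proof (cases "val U \<rho> t H")
  case True
  then have "eventually (\<lambda>y. val U \<rho> t (insert y H)) U"
    using val_node[of \<rho> H, OF assms] by blast
  then show ?thesis by (rule eventually_mono) (simp add: True)
next
  case False
  then have "\<not> eventually (\<lambda>y. val U \<rho> t (insert y H)) U"
    using val_node[of \<rho> H, OF assms] by blast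
  then have "eventually (\<lambda>y. \<not> val U \<rho> t (insert y H)) U" unfolding not_eventually_iff .
  then show ?thesis by (rule eventually_mono) (simp add: False)
qed

text \<open>A true value has a derivation. Since \<open>U\<close>-almost all elements lie in
  \<open>Y\<close>, the derivation has a branch inside \<open>Y\<close>, and it would end in a leaf
  \<open>S \<subseteq> Y\<close> with \<open>t S\<close>.\<close>

lemma val_false:
  assumes Y: "eventually (\<lambda>y. y \<in> Y) U" and t: "\<And>S. S \<subseteq> Y \<Longrightarrow> \<not> t S" and "val U \<rho> t H" "H \<subseteq> Y"
  shows False
  using assms(3,4)
proof (induction rule: val.induct)
  case (leaf H)
  then show ?case using t by blast
next
  case (node H)
  have "eventually (\<lambda>y. False) U"
    using node.IH Y by eventually_elim (use node.prems in blast)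
  then show ?case using proper by (simp add: trivial_limit_def)
qed

lemma eventually_above: "finite H \<Longrightarrow> eventually (\<lambda>y. \<forall>x\<in>H. x < y) U"
  using large by (intro eventually_ball_finite) auto

end

section \<open>Barriers and bar induction\<close>

locale barrier = free_ultrafilter +
  fixes A :: "nat set" and \<rho> :: "nat set \<Rightarrow> bool"
  assumes A_large: "eventually (\<lambda>y. y \<in> A) U"
    and bar: "\<And>D. D \<subseteq> A \<Longrightarrow> infinite D \<Longrightarrow> \<exists>b. \<rho> (D \<inter> {..b})"
    and bar_initial: "\<And>S T. \<rho> S \<Longrightarrow> initial S T \<Longrightarrow> finite T \<Longrightarrow> \<rho> T"
begin

text \<open>A failure of \<open>P\<close> propagates to one-point end extensions. Dependent choice
  then yields an infinite subset of \<open>A\<close> no stage of which satisfies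
  \<open>\<rho>\<close>, against \<open>bar\<close>; \<open>bar_initial\<close> carries
  \<open>\<rho>\<close> from a segment of that set to a stage containing it.\<close>

lemma bar_induct:
  assumes step: "\<And>H. finite H \<Longrightarrow> H \<subseteq> A \<Longrightarrow>
      (\<not> \<rho> H \<Longrightarrow> (\<And>y. y \<in> A \<Longrightarrow> \<forall>x\<in>H. x < y \<Longrightarrow> P (insert y H))) \<Longrightarrow> P H"
    and H: "finite H" "H \<subseteq> A"
  shows "P H"
proof (rule ccontr)
  assume "\<not> P H"
  let ?P = "\<lambda>(n :: nat) S. finite S \<and> S \<subseteq> A \<and> \<not> P S"
  let ?Q = "\<lambda>(n :: nat) S T. \<not> \<rho> S \<and> (\<exists>y. (\<forall>x\<in>S. x < y) \<and> T = insert y S)"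
  have "\<exists>f. \<forall>n. ?P n (f n) \<and> ?Q n (f n) (f (Suc n))"
  proof (rule dependent_nat_choice)
    show "\<exists>S. ?P 0 S" using H \<open>\<not> P H\<close> by blast
    fix S and n :: nat assume S: "?P n S"
    then have "\<not> (\<not> \<rho> S \<longrightarrow> (\<forall>y. y \<in> A \<longrightarrow> (\<forall>x\<in>S. x < y) \<longrightarrow> P (insert y S)))"
      using step[of S] by blast
    then obtain y where "\<not> \<rho> S" "y \<in> A" "\<forall>x\<in>S. x < y" "\<not> P (insert y S)" by blast
    with S have "?P (Suc n) (insert y S) \<and> ?Q n S (insert y S)" by blast
    then show "\<exists>T. ?P (Suc n) T \<and> ?Q n S T" by blast
  qed
  then obtain f where "\<forall>n. ?P n (f n) \<and> ?Q n (f n) (f (Suc n))" by (rule exE)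
  then have P: "finite (f n)" "f n \<subseteq> A" "\<not> \<rho> (f n)"
    and Q: "\<exists>y. (\<forall>x\<in>f n. x < y) \<and> f (Suc n) = insert y (f n)" for n
    by blast+
  have mono: "f m \<subseteq> f n" if "m \<le> n" for m n
    using that by (rule lift_Suc_mono_le[of f, rotated]) (use Q in blast)
  have "card (f n) \<ge> n" for n
  proof (induction n)
    case (Suc n)
    obtain y where "\<forall>x\<in>f n. x < y" "f (Suc n) = insert y (f n)" using Q by blast
    then have "card (f (Suc n)) = Suc (card (f n))" using P(1) by (metis card_insert_disjoint less_irrefl)
    with Suc show ?case by simp
  qed simp
  then have inf: "infinite (\<Union>n. f n)"
    by (metis UN_upper card_mono le_trans UNIV_I not_less_eq_eq)
  obtain b where b: "\<rho> ((\<Union>n. f n) \<inter> {..b})" using bar[OF _ inf] P(2) by blast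
  let ?S = "(\<Union>n. f n) \<inter> {..b}"
  have "\<forall>x\<in>?S. \<exists>n. x \<in> f n" by blast
  then obtain g where g: "\<And>x. x \<in> ?S \<Longrightarrow> x \<in> f (g x)" by metis
  let ?n = "\<Sum>x\<in>?S. g x"
  have "?S \<subseteq> f ?n"
  proof
    fix x assume x: "x \<in> ?S"
    have "g x \<le> ?n" using x by (intro member_le_sum) auto
    then show "x \<in> f ?n" using g[OF x] mono by blast
  qed
  then have "initial ?S (f ?n)" unfolding initial_def by (auto simp: not_le)
  with b have "\<rho> (f ?n)" using P(1) by (rule bar_initial)
  then show False using P(3) by blast
qed

text \<open>Truth in a least fixed point has to be built up from leaves, hence the bar induction; a
  monotone \<open>t\<close>, once true, stays true on the way to them.\<close>

lemma val_true:
  assumes "finite H" "H \<subseteq> A" and t: "\<And>S T. t S \<Longrightarrow> S \<subseteq> T \<Longrightarrow> t T"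
  shows "t H \<Longrightarrow> val U \<rho> t H"
proof -
  have "t H \<longrightarrow> val U \<rho> t H"
  proof (rule bar_induct[OF _ assms(1,2)])
    fix H assume H: "finite H" "H \<subseteq> A"
      and IH: "\<not> \<rho> H \<Longrightarrow> (\<And>y. y \<in> A \<Longrightarrow> \<forall>x\<in>H. x < y \<Longrightarrow> t (insert y H) \<longrightarrow> val U \<rho> t (insert y H))"
    show "t H \<longrightarrow> val U \<rho> t H"
    proof
      assume tH: "t H"
      show "val U \<rho> t H"
      proof (cases "\<rho> H")
        case True
        with tH show ?thesis by (simp add: val_leaf)
      next
        case False
        have "eventually (\<lambda>y. val U \<rho> t (insert y H)) U"
          using A_large eventually_above[OF H(1)]
          by eventually_elim (use IH[OF False] t[OF tH] in blast)
        with False show ?thesis by (simp add: val_node)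
      qed
    qed
  qed
  then show "t H \<Longrightarrow> val U \<rho> t H" by blast
qed

end

section \<open>Sets coded along a barrier\<close>

text \<open>
  The search for \<open>\<rho>\<close> above \<open>H\<close> inside \<open>D\<close> is cut off when \<open>\<rho>\<close> holds for the part of \<open>D\<close> alone, so
  that it terminates whatever \<open>H\<close> is.
\<close>

definition ring_at :: "(nat set \<Rightarrow> bool) \<Rightarrow> nat set \<Rightarrow> nat set \<Rightarrow> nat \<Rightarrow> nat" where
  "ring_at \<rho> D H x = (LEAST b. \<rho> (D \<inter> {x<..b}) \<or> \<rho> (H \<union> (D \<inter> {x<..b})))"

definition guess :: "(nat set \<Rightarrow> bool) \<Rightarrow> (nat \<Rightarrow> nat set \<Rightarrow> bool) \<Rightarrow> nat set \<Rightarrow> nat \<Rightarrow> nat set \<Rightarrow> nat \<Rightarrow> bool" where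
  "guess \<rho> hit D n H x \<longleftrightarrow> hit n (H \<union> (D \<inter> {x<..ring_at \<rho> D H x}))"

text \<open>The assumption \<open>cap\<close> repairs the cut-off in \<open>ring_at\<close>: if the
  part \<open>G\<close> taken from \<open>D\<close> satisfies \<open>\<rho>\<close> by itself and
  has listed \<open>Min H\<close>, then \<open>\<rho>\<close> also holds for
  \<open>H \<union> G\<close>, so the cut-off has not come too early.\<close>

locale coded_barrier = barrier +
  fixes hit :: "nat \<Rightarrow> nat set \<Rightarrow> bool" and B :: "nat set"
  assumes hit_mono: "\<And>n S T. hit n S \<Longrightarrow> S \<subseteq> T \<Longrightarrow> hit n T"
    and B_def: "B = {n. val U \<rho> (hit n) {}}"
    and B_subset: "B \<subseteq> A"
    and B_large: "eventually (\<lambda>y. y \<in> B) U"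
    and cap: "\<And>H G. finite H \<Longrightarrow> H \<noteq> {} \<Longrightarrow> finite G \<Longrightarrow> \<forall>x\<in>H. \<forall>y\<in>G. x < y \<Longrightarrow>
      hit (Min H) G \<Longrightarrow> \<rho> G \<Longrightarrow> \<rho> (H \<union> G)"
begin

abbreviation v :: "nat \<Rightarrow> nat set \<Rightarrow> bool" where
  "v n \<equiv> val U \<rho> (hit n)"

text \<open>Sets with \<open>\<rho> H\<close> are exempt: their value is already that of a leaf, and
  \<open>val_generic\<close> says nothing about them. For given \<open>x\<close> only finitely many
  pairs \<open>n\<close>, \<open>H\<close> remain, so \<open>U\<close>-almost every \<open>y\<close>
  meets all demands.\<close>

definition agree :: "nat \<Rightarrow> nat \<Rightarrow> bool" where
  "agree x y \<longleftrightarrow> (\<forall>n\<le>x. \<forall>H. H \<subseteq> B \<inter> {..x} \<longrightarrow> \<rho> H \<or> v n (insert y H) = v n H)"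

definition code :: "nat set" where
  "code = thin B agree"

lemma code_subset: "code \<subseteq> B"
  unfolding code_def by (rule thin_subset)

lemma eventually_agree: "eventually (agree x) U"
proof -
  have "eventually (\<lambda>y. \<forall>n\<in>{..x}. \<forall>H\<in>Pow (B \<inter> {..x}). \<rho> H \<or> v n (insert y H) = v n H) U"
  proof (intro eventually_ball_finite ballI)
    fix n H
    show "eventually (\<lambda>y. \<rho> H \<or> v n (insert y H) = v n H) U"
    proof (cases "\<rho> H")
      case False
      show ?thesis using val_generic[of \<rho> H "hit n", OF False] by (rule eventually_mono) blast
    qed simp
  qed auto
  then show ?thesis by (rule eventually_mono) (auto simp: agree_def)
qed

lemma infinite_code: "infinite code"
  unfolding code_def using proper large B_large eventually_agree by (intro infinite_thin) auto

text \<open>The elements of \<open>D\<close> are added one at a time. Each belongs to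
  \<open>code\<close>, so it agrees with the largest element \<open>z\<close> used before, and the
  set built so far lies in \<open>B \<inter> {..z}\<close>; agreement therefore preserves its value.
  That \<open>D\<close> omits elements of \<open>code\<close> does no harm.\<close>

lemma follow:
  assumes D: "D \<subseteq> code" and x: "x \<in> D" and n: "n \<le> x" and H: "H \<subseteq> B \<inter> {..x}"
    and nr: "\<And>c. c < b \<Longrightarrow> \<not> \<rho> (H \<union> (D \<inter> {x<..c}))"
  shows "v n (H \<union> (D \<inter> {x<..b})) = v n H"
  using nr
proof (induction b)
  case 0
  show ?case by simp
next
  case (Suc b)
  then have IH: "v n (H \<union> (D \<inter> {x<..b})) = v n H" by simp
  show ?case
  proof (cases "Suc b \<in> D \<and> x < Suc b")
    case False
    then have "D \<inter> {x<..Suc b} = D \<inter> {x<..b}" by (auto simp: le_Suc_eq)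
    with IH show ?thesis by simp
  next
    case True
    let ?G = "D \<inter> {x<..b}"
    have eq: "H \<union> (D \<inter> {x<..Suc b}) = insert (Suc b) (H \<union> ?G)" using True by auto
    define z where "z = Max (insert x ?G)"
    have zin: "z \<in> insert x ?G" unfolding z_def by (rule Max_in) auto
    have zge: "y \<le> z" if "y \<in> insert x ?G" for y unfolding z_def using that by (intro Max_ge) auto
    have "z \<in> code" using zin x D by auto
    moreover have "z < Suc b" using zin True by auto
    moreover have "Suc b \<in> code" using True D by auto
    ultimately have "agree z (Suc b)" unfolding code_def using in_thin_iff by blast
    moreover have "n \<le> z" using n zge[of x] by simp
    moreover have "H \<union> ?G \<subseteq> B \<inter> {..z}"
      using H zge D code_subset by fastforce
    moreover have "\<not> \<rho> (H \<union> ?G)" using Suc.prems[of b] by simp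
    ultimately have "v n (insert (Suc b) (H \<union> ?G)) = v n (H \<union> ?G)" unfolding agree_def by blast
    with IH eq show ?thesis by simp
  qed
qed

lemma ring_exists:
  assumes "D \<subseteq> A" "infinite D"
  shows "\<exists>b. \<rho> (D \<inter> {x<..b})"
proof -
  have "infinite (D \<inter> {x<..})"
  proof
    assume "finite (D \<inter> {x<..})"
    moreover have "D \<subseteq> (D \<inter> {x<..}) \<union> {..x}" by auto
    ultimately show False using assms(2) finite_subset by blast
  qed
  with bar[of "D \<inter> {x<..}"] assms(1) obtain b where "\<rho> (D \<inter> {x<..} \<inter> {..b})" by blast
  moreover have "D \<inter> {x<..} \<inter> {..b} = D \<inter> {x<..b}" by auto
  ultimately show ?thesis by auto
qed

theorem guess_correct:
  assumes D: "D \<subseteq> code" "infinite D" and x: "x \<in> D" and n: "n \<le> x" and H: "H \<subseteq> B \<inter> {..x}"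
  shows "guess \<rho> hit D n H x \<longleftrightarrow> v n H"
proof -
  have DA: "D \<subseteq> A" using D(1) code_subset B_subset by blast
  define b0 where "b0 = (LEAST b. \<rho> (D \<inter> {x<..b}))"
  have b0: "\<rho> (D \<inter> {x<..b0})" unfolding b0_def using ring_exists[OF DA D(2)] by (rule LeastI_ex)
  have b0_le: "b0 \<le> b" if "\<rho> (D \<inter> {x<..b})" for b
    using that unfolding b0_def by (rule Least_le)
  have fin: "finite H" using H finite_subset by blast
  have cap0: "\<rho> (H \<union> (D \<inter> {x<..b0}))"
  proof (cases "H = {}")
    case True
    with b0 show ?thesis by simp
  next
    case False
    \<comment> \<open>As \<open>?h \<in> B\<close>, its value at the empty set is true. Following
      \<open>D\<close> from the empty set until \<open>\<rho>\<close> holds turns this generic truth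
      into an actual hit, as \<open>cap\<close> demands.\<close>
    let ?h = "Min H"
    have h: "?h \<in> B" "?h \<le> x" using Min_in[OF fin False] H by auto
    have "v ?h ({} \<union> (D \<inter> {x<..b0})) = v ?h {}"
      using b0_le by (intro follow[OF D(1) x h(2)]) (auto simp: not_le[symmetric])
    with h(1) have "v ?h (D \<inter> {x<..b0})" by (simp add: B_def)
    then have "hit ?h (D \<inter> {x<..b0})" using val_leaf[of \<rho>, OF b0] by blast
    then show ?thesis using H b0 by (intro cap fin False) auto
  qed
  define b where "b = ring_at \<rho> D H x"
  have b: "\<rho> (D \<inter> {x<..b}) \<or> \<rho> (H \<union> (D \<inter> {x<..b}))"
    unfolding b_def ring_at_def by (rule LeastI[where k = b0]) (simp add: b0)
  have b_le: "b \<le> c" if "\<rho> (D \<inter> {x<..c}) \<or> \<rho> (H \<union> (D \<inter> {x<..c}))" for c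
    using that unfolding b_def ring_at_def by (rule Least_le)
  \<comment> \<open>A search stopped by the part of \<open>D\<close> alone stops exactly at
    \<open>b0\<close>, where \<open>cap0\<close> gives \<open>\<rho>\<close> for the union as
    well.\<close>
  have "b = b0" if "\<rho> (D \<inter> {x<..b})"
    using b0_le[OF that] b_le[of b0] b0 by simp
  with b cap0 have rb: "\<rho> (H \<union> (D \<inter> {x<..b}))" by auto
  have "v n (H \<union> (D \<inter> {x<..b})) = v n H"
    using b_le by (intro follow[OF D(1) x n H]) (auto simp: not_le[symmetric])
  then show ?thesis using val_leaf[of \<rho>, OF rb] unfolding guess_def b_def[symmetric] by blast
qed

end

text \<open>
  Either the elements of \<open>A\<close> are \<open>U\<close>-generically listed no later than some fixed \<open>n0 \<in> A\<close>, and then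
  \<open>n0\<close> serves as the clock; or each \<open>n \<in> A\<close> is listed before \<open>U\<close>-almost every element, and then the
  first element of a set is the clock.
\<close>

theorem coded_barrier_exists:
  fixes hit :: "nat \<Rightarrow> nat set \<Rightarrow> bool"
  assumes mono: "\<And>n S T. hit n S \<Longrightarrow> S \<subseteq> T \<Longrightarrow> hit n T"
    and cont: "\<And>n S. hit n S \<Longrightarrow> \<exists>b. hit n (S \<inter> {..b})"
    and total: "\<And>n D. n \<in> A \<Longrightarrow> D \<subseteq> A \<Longrightarrow> infinite D \<Longrightarrow> hit n D"
    and Y: "Y \<subseteq> A" "infinite Y" "\<And>n. n \<notin> A \<Longrightarrow> \<not> hit n Y"
  shows "\<exists>U \<rho> B. coded_barrier U A \<rho> hit B \<and>
    ((\<exists>n0. \<rho> = hit n0) \<or> \<rho> = (\<lambda>S. S \<noteq> {} \<and> hit (Min S) (S - {Min S})))"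
proof -
  obtain U where U: "free_ultrafilter U" and UY: "eventually (\<lambda>y. y \<in> Y) U"
    using exists_free_ultrafilter[OF Y(2)] by metis
  interpret free_ultrafilter U by fact
  have UA: "eventually (\<lambda>y. y \<in> A) U" using UY Y(1) by (auto elim: eventually_mono)
  have sound: "n \<in> A" if "val U \<rho> (hit n) {}" for \<rho> n
  proof (rule ccontr)
    assume "n \<notin> A"
    then have "\<not> hit n S" if "S \<subseteq> Y" for S using Y(3) mono that by blast
    then show False using val_false[OF UY _ \<open>val U \<rho> (hit n) {}\<close>] by blast
  qed
  have clock: "barrier U A (hit m)" if "m \<in> A" for m
  proof
    show "eventually (\<lambda>y. y \<in> A) U" by fact
    show "\<exists>b. hit m (D \<inter> {..b})" if "D \<subseteq> A" "infinite D" for D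
      using cont total \<open>m \<in> A\<close> that by blast
    show "hit m T" if "hit m S" "initial S T" for S T
      using mono that unfolding initial_def by blast
  qed
  show ?thesis
  proof (cases "\<exists>m\<in>A. eventually (\<lambda>y. val U (hit m) (hit y) {}) U")
    case True
    then obtain m where m: "m \<in> A" "eventually (\<lambda>y. val U (hit m) (hit y) {}) U" by blast
    interpret barrier U A "hit m" using clock[OF m(1)] .
    have "coded_barrier U A (hit m) hit {n. val U (hit m) (hit n) {}}"
    proof
      show "{n. val U (hit m) (hit n) {}} \<subseteq> A" using sound by blast
      show "eventually (\<lambda>y. y \<in> {n. val U (hit m) (hit n) {}}) U" using m(2) by simp
      show "hit m (H \<union> G)" if "hit m G" for H G using mono[OF that] by blast
    qed (use mono in auto)
    then show ?thesis by blast
  next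
    case False
    let ?\<rho> = "\<lambda>S. S \<noteq> {} \<and> hit (Min S) (S - {Min S})"
    interpret barrier U A ?\<rho>
    proof
      show "eventually (\<lambda>y. y \<in> A) U" by fact
      show "\<exists>b. D \<inter> {..b} \<noteq> {} \<and> hit (Min (D \<inter> {..b})) (D \<inter> {..b} - {Min (D \<inter> {..b})})"
        if D: "D \<subseteq> A" "infinite D" for D
      proof -
        define d where "d = (LEAST d. d \<in> D)"
        have d: "d \<in> D" unfolding d_def using D(2) by (metis LeastI ex_in_conv finite.emptyI)
        have "hit d (D - {d})" using total[of d "D - {d}"] d D by auto
        then obtain b where "hit d ((D - {d}) \<inter> {..b})" using cont by blast
        then have "hit d (D \<inter> {..max b d} - {d})" by (rule mono) auto
        moreover have "Min (D \<inter> {..max b d}) = d"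
          using d unfolding d_def by (intro Min_eqI) (auto intro: Least_le)
        ultimately show ?thesis using d by (intro exI[of _ "max b d"]) auto
      qed
      show "T \<noteq> {} \<and> hit (Min T) (T - {Min T})"
        if S: "S \<noteq> {} \<and> hit (Min S) (S - {Min S})" and ST: "initial S T" and T: "finite T" for S T
      proof -
        have sub: "S \<subseteq> T" and above: "\<And>x y. x \<in> T \<Longrightarrow> x \<notin> S \<Longrightarrow> y \<in> S \<Longrightarrow> y < x"
          using ST unfolding initial_def by blast+
        have fin: "finite S" using T sub by (rule finite_subset[rotated])
        have minS: "Min S \<in> S" using fin S by (intro Min_in) auto
        have "Min T = Min S"
        proof (rule Min_eqI[OF T])
          show "Min S \<in> T" using minS sub by blast
          show "Min S \<le> y" if "y \<in> T" for y
            using above[OF that _ minS] Min_le[OF fin, of y] by (cases "y \<in> S") auto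
        qed
        moreover have "hit (Min S) (T - {Min S})" using S sub mono by blast
        ultimately show ?thesis using S sub by auto
      qed
    qed
    \<comment> \<open>The assumption on values says that generically \<open>d\<close> is still
      unlisted when \<open>n\<close> gets listed. Hence the clock started by the first element
      \<open>d\<close> cannot stop before \<open>n\<close> is listed. With \<open>H\<close> empty,
      this applies to \<open>U\<close>-almost every \<open>d\<close>.\<close>
    have race: "val U ?\<rho> (hit n) (insert d H)"
      if n: "n \<in> A" and d: "d \<in> A" and H: "finite H" "H \<subseteq> A" and "\<forall>x\<in>H. d < x"
        and "\<not> val U (hit n) (hit d) H" for n d H
    proof -
      have "(\<forall>x\<in>H. d < x) \<longrightarrow> \<not> val U (hit n) (hit d) H \<longrightarrow> val U ?\<rho> (hit n) (insert d H)"
      proof (rule barrier.bar_induct[OF clock[OF n] _ H])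
        fix H assume H: "finite H" "H \<subseteq> A" and
          IH: "\<not> hit n H \<Longrightarrow> (\<And>y. y \<in> A \<Longrightarrow> \<forall>x\<in>H. x < y \<Longrightarrow> (\<forall>x\<in>insert y H. d < x) \<longrightarrow>
            \<not> val U (hit n) (hit d) (insert y H) \<longrightarrow> val U ?\<rho> (hit n) (insert d (insert y H)))"
        show "(\<forall>x\<in>H. d < x) \<longrightarrow> \<not> val U (hit n) (hit d) H \<longrightarrow> val U ?\<rho> (hit n) (insert d H)"
        proof (intro impI)
          assume above: "\<forall>x\<in>H. d < x" and nv: "\<not> val U (hit n) (hit d) H"
          show "val U ?\<rho> (hit n) (insert d H)"
          proof (cases "hit n H")
            case True
            have "hit n (insert d H)" using True by (rule mono) blast
            then show ?thesis using H d by (intro val_true) (auto intro: mono)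
          next
            case False
            have fin: "finite (insert d H)" using H(1) by simp
            have "Min (insert d H) = d" using H(1) above by (intro Min_eqI) (auto intro: less_imp_le)
            moreover have "insert d H - {d} = H" using above by auto
            moreover have "\<not> hit d H"
              using nv barrier.val_true[OF clock[OF n] H, of "hit d"] mono by blast
            ultimately have nr: "\<not> ?\<rho> (insert d H)" by simp
            have "\<not> eventually (\<lambda>y. val U (hit n) (hit d) (insert y H)) U"
              using nv val_node[of "hit n" H, OF False] by blast
            then have "eventually (\<lambda>y. \<not> val U (hit n) (hit d) (insert y H)) U"
              unfolding not_eventually_iff .
            then have "eventually (\<lambda>y. val U ?\<rho> (hit n) (insert y (insert d H))) U"
              using UA eventually_above[OF fin]
            proof (eventually_elim, goal_cases)
              case (1 y)
              with H have "\<forall>x\<in>insert d H. x < y" by simp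
              with 1 above IH[OF False, of y] show ?case by (simp add: insert_commute)
            qed
            with nr show ?thesis by (rule node)
          qed
        qed
      qed
      with that show ?thesis by blast
    qed
    have "val U ?\<rho> (hit n) {}" if n: "n \<in> A" for n
    proof -
      have "\<not> eventually (\<lambda>y. val U (hit n) (hit y) {}) U" using False n by blast
      then have "eventually (\<lambda>y. \<not> val U (hit n) (hit y) {}) U" unfolding not_eventually_iff .
      then have "eventually (\<lambda>y. val U ?\<rho> (hit n) (insert y {})) U"
        using UA by eventually_elim (rule race[OF n], auto)
      moreover have "\<not> ?\<rho> {}" by simp
      ultimately show ?thesis by (intro node)
    qed
    with sound have B: "{n. val U ?\<rho> (hit n) {}} = A" by blast
    have "coded_barrier U A ?\<rho> hit {n. val U ?\<rho> (hit n) {}}"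
    proof
      show "{n. val U ?\<rho> (hit n) {}} \<subseteq> A" unfolding B by simp
      show "eventually (\<lambda>y. y \<in> {n. val U ?\<rho> (hit n) {}}) U" unfolding B by fact
      show "H \<union> G \<noteq> {} \<and> hit (Min (H \<union> G)) (H \<union> G - {Min (H \<union> G)})"
        if HG: "finite H" "H \<noteq> {}" "finite G" "\<forall>x\<in>H. \<forall>y\<in>G. x < y" "hit (Min H) G" for H G
      proof -
        have minH: "Min H \<in> H" using HG(1,2) by (rule Min_in)
        have "Min H \<le> y" if "y \<in> H \<union> G" for y
          using that HG(4) minH Min_le[OF HG(1), of y] by (blast intro: less_imp_le)
        then have "Min (H \<union> G) = Min H"
          using HG(1,3) minH by (intro Min_eqI) auto
        moreover have "G \<subseteq> H \<union> G - {Min H}" using HG(4) minH by blast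
        then have "hit (Min H) (H \<union> G - {Min H})" using HG(5) mono by blast
        ultimately show ?thesis using HG(2) by auto
      qed
    qed (use mono in auto)
    then show ?thesis by blast
  qed
qed

section \<open>Decoding functionals\<close>

text \<open>The recursion tests only pairs \<open>x < y\<close> with \<open>y \<in> B\<close>; the
  tests recomputed from an oracle are shown to be correct just there.\<close>

lemma thin_cong:
  assumes "\<And>x y. x < y \<Longrightarrow> y \<in> B \<Longrightarrow> ok x y \<longleftrightarrow> ok' x y"
  shows "thin B ok = thin B ok'"
proof -
  have "thin_upto B ok y = thin_upto B ok' y" for y
  proof (induction y)
    case (Suc y)
    have "(\<forall>x\<in>thin_upto B ok' y. ok x y) \<longleftrightarrow> (\<forall>x\<in>thin_upto B ok' y. ok' x y)" if "y \<in> B"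
      using assms[OF thin_upto_less that] by blast
    with Suc show ?case by auto
  qed simp
  then show ?thesis unfolding thin_def by simp
qed

lemma set_decode_add_power:
  assumes "\<And>i. i \<in> set_decode r \<Longrightarrow> i < y"
  shows "set_decode (r + 2 ^ y) = insert y (set_decode r)"
proof -
  have "y \<notin> set_decode r" using assms by blast
  then have "set_encode (insert y (set_decode r)) = r + 2 ^ y" by (subst set_encode_insert) auto
  then show ?thesis by (metis finite_insert finite_set_decode set_encode_inverse)
qed

lemma computable_thin_code:
  assumes B: "decidable_on \<D> 1 (\<lambda>D xs. arg xs 0 \<in> B D)"
    and ok: "decidable_on \<D> 2 (\<lambda>D xs. ok D (arg xs 0) (arg xs 1))"
  shows "computable_on \<D> 1 (\<lambda>D xs. set_encode (thin (B D) (ok D) \<inter> {..<arg xs 0}))"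
proof -
  \<comment> \<open>The accumulator codes the set taken so far, whose elements are below
    \<open>y\<close>, so adding \<open>2 ^ y\<close> adjoins \<open>y\<close>.\<close>
  let ?step = "\<lambda>D y r. if y \<in> B D \<and> (\<forall>x<y. x \<in> set_decode r \<longrightarrow> ok D x y) then r + 2 ^ y else r"
  have rec: "rec_nat 0 (?step D) y = set_encode (thin (B D) (ok D) \<inter> {..<y})" for D y
  proof (induction y)
    case (Suc y)
    let ?T = "thin_upto (B D) (ok D) y"
    have fin: "finite ?T" by (simp add: thin_upto_eq)
    have dec: "set_decode (set_encode ?T) = ?T" by (simp add: fin)
    have "(\<forall>x<y. x \<in> ?T \<longrightarrow> ok D x y) \<longleftrightarrow> (\<forall>x\<in>?T. ok D x y)"
      using thin_upto_less by blast
    moreover have "set_encode (insert y ?T) = set_encode ?T + 2 ^ y"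
      using fin thin_upto_less[of y "B D" "ok D" y] by (subst set_encode_insert) auto
    ultimately have "rec_nat 0 (?step D) (Suc y) = set_encode (thin_upto (B D) (ok D) (Suc y))"
      using Suc dec by (simp add: thin_upto_eq[symmetric])
    then show ?case by (simp only: thin_upto_eq)
  qed simp
  have "decidable_on \<D> (Suc (Suc 1)) (\<lambda>D ys. arg ys 0 \<in> B D)"
    by (rule decidable_comp1[where P = "\<lambda>D x. x \<in> B D", OF B]) (auto intro: computable_arg)
  moreover have "decidable_on \<D> (Suc (Suc (Suc 1))) (\<lambda>D ys. ok D (arg ys 0) (arg ys 1))"
    by (rule decidable_comp2[where P = ok, OF ok]) (auto intro: computable_arg)
  ultimately have "computable_on \<D> 1 (\<lambda>D xs. rec_nat 0 (?step D) (arg xs 0))"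
    by (intro computable_rec computable_if decidable_conj decidable_ball_less decidable_imp
        computable_arg computable_const decidable_set_decode computable_add computable_power2)
      (auto intro: computable_arg)
  then show ?thesis unfolding rec .
qed

lemma decidable_thin:
  assumes B: "decidable_on \<D> 1 (\<lambda>D xs. arg xs 0 \<in> B D)"
    and ok: "decidable_on \<D> 2 (\<lambda>D xs. ok D (arg xs 0) (arg xs 1))"
  shows "decidable_on \<D> 1 (\<lambda>D xs. arg xs 0 \<in> thin (B D) (ok D))"
proof -
  have "computable_on \<D> 1 (\<lambda>D xs. set_encode (thin (B D) (ok D) \<inter> {..<Suc (arg xs 0)}))"
    by (rule computable_comp1[where F = "\<lambda>D x. set_encode (thin (B D) (ok D) \<inter> {..<x})",
        OF computable_thin_code[OF B ok]]) (auto intro!: comp_intros)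
  then have "decidable_on \<D> 1 (\<lambda>D xs. arg xs 0 \<in> set_decode (set_encode (thin (B D) (ok D) \<inter> {..<Suc (arg xs 0)})))"
    by (intro decidable_set_decode computable_arg) simp
  then show ?thesis by (simp add: lessThan_Suc_atMost)
qed

section \<open>Decidability of hits and of the two clocks\<close>

definition part :: "nat set \<Rightarrow> nat \<Rightarrow> nat \<Rightarrow> nat \<Rightarrow> nat set" where
  "part D H x b = set_decode H \<union> (D \<inter> {x<..b})"

lemma part_less: "i \<in> part D H x b \<Longrightarrow> i < H + b + 1"
  using set_decode_less[of i H] by (auto simp: part_def)

lemma decidable_part:
  assumes "computable_on \<D> k i" "computable_on \<D> k H" "computable_on \<D> k x" "computable_on \<D> k b"
  shows "decidable_on \<D> k (\<lambda>D xs. i D xs \<in> part D (H D xs) (x D xs) (b D xs))"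
proof -
  have "decidable_on \<D> k (\<lambda>D xs. i D xs \<in> set_decode (H D xs) \<or> (i D xs \<in> D \<and> x D xs < i D xs \<and> i D xs \<le> b D xs))"
    using assms by (intro comp_intros)
  then show ?thesis by (simp add: part_def)
qed

text \<open>The lower bound \<open>arg xs 4\<close> lets one statement serve both clocks: 0 keeps
  the whole set, and the successor of the minimum removes the minimum.\<close>

lemma decidable_hits:
  assumes F: "finite F" and q: "decidable_on UNIV 3 (\<lambda>D xs. q (arg xs 0) (arg xs 1) (arg xs 2))"
  shows "decidable_on \<D> 5 (\<lambda>D xs. hits F q (arg xs 0) (part D (arg xs 1) (arg xs 2) (arg xs 3) \<inter> {arg xs 4..}))"
proof -
  have q': "decidable_on \<D> k (\<lambda>D xs. q (s D xs) (n D xs) (E D xs))"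
    if "computable_on \<D> k s" "computable_on \<D> k n" "computable_on \<D> k E" for k s n E
    using decidable_comp3[where P = "\<lambda>D. q", OF decidable_on_mono[OF q]] that by blast
  have F': "decidable_on \<D> k (\<lambda>D xs. i D xs \<in> F)" if "computable_on \<D> k i" for k i
  proof -
    have "decidable_on \<D> k (\<lambda>D xs. i D xs \<in> set_decode (set_encode F))"
      using that by (intro comp_intros)
    with F show ?thesis by simp
  qed
  let ?S = "\<lambda>D xs. part D (arg xs 1) (arg xs 2) (arg xs 3)"
  have "decidable_on \<D> 5 (\<lambda>D xs. \<exists>e<arg xs 1 + arg xs 3 + 1. (e \<in> ?S D xs \<and> arg xs 4 \<le> e) \<and>
      (\<exists>E\<le>e. \<exists>s\<le>e. (\<forall>i<E. i \<in> set_decode E \<longrightarrow> i \<in> F \<or> (i \<in> ?S D xs \<and> arg xs 4 \<le> i)) \<and> q s (arg xs 0) E))"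
    by (auto intro!: comp_intros q' F' decidable_part simp: eval_nat_numeral)
  moreover have "(\<exists>e<H + b + 1. (e \<in> part D H x b \<and> z \<le> e) \<and>
      (\<exists>E\<le>e. \<exists>s\<le>e. (\<forall>i<E. i \<in> set_decode E \<longrightarrow> i \<in> F \<or> (i \<in> part D H x b \<and> z \<le> i)) \<and> q s n E))
      \<longleftrightarrow> hits F q n (part D H x b \<inter> {z..})" (is "?L \<longleftrightarrow> ?R") for D H b x z n
  proof -
    have eq: "(\<forall>i<E. i \<in> set_decode E \<longrightarrow> i \<in> F \<or> (i \<in> part D H x b \<and> z \<le> i)) \<longleftrightarrow>
        set_decode E \<subseteq> F \<union> (part D H x b \<inter> {z..})" for E
      using set_decode_less[of _ E] by auto
    have "(e \<in> part D H x b \<and> z \<le> e) \<longleftrightarrow> e < H + b + 1 \<and> e \<in> part D H x b \<inter> {z..}" for e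
      using part_less[of e D H x b] by auto
    then show ?thesis unfolding hits_def eq by blast
  qed
  ultimately show ?thesis by simp
qed

text \<open>The common property of the fixed clock and the first-element clock through which the
  decoding procedure uses \<open>\<rho>\<close>.\<close>

definition ring_decidable :: "(nat set \<Rightarrow> bool) \<Rightarrow> bool" where
  "ring_decidable \<rho> \<longleftrightarrow> (\<forall>\<D>. decidable_on \<D> 3 (\<lambda>D xs. \<rho> (part D (arg xs 0) (arg xs 1) (arg xs 2))))"

lemma ring_decidable_fixed:
  assumes "finite F" "decidable_on UNIV 3 (\<lambda>D xs. q (arg xs 0) (arg xs 1) (arg xs 2))"
  shows "ring_decidable (hits F q n)"
  unfolding ring_decidable_def
proof
  fix \<D>
  have "decidable_on \<D> 3 (\<lambda>D xs. hits F q n (part D (arg xs 0) (arg xs 1) (arg xs 2) \<inter> {0..}))"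
    by (rule decidable_comp5[where P = "\<lambda>D n H x b z. hits F q n (part D H x b \<inter> {z..})", OF decidable_hits[OF assms]])
      (auto intro!: comp_intros)
  then show "decidable_on \<D> 3 (\<lambda>D xs. hits F q n (part D (arg xs 0) (arg xs 1) (arg xs 2)))" by simp
qed

lemma ring_decidable_Min:
  assumes "finite F" "decidable_on UNIV 3 (\<lambda>D xs. q (arg xs 0) (arg xs 1) (arg xs 2))"
  shows "ring_decidable (\<lambda>S. S \<noteq> {} \<and> hits F q (Min S) (S - {Min S}))"
  unfolding ring_decidable_def
proof
  fix \<D>
  have hits: "decidable_on \<D> 4 (\<lambda>D xs. hits F q (arg xs 0) (part D (arg xs 1) (arg xs 2) (arg xs 3) \<inter> {Suc (arg xs 0)..}))"
    by (rule decidable_comp5[where P = "\<lambda>D n H x b z. hits F q n (part D H x b \<inter> {z..})", OF decidable_hits[OF assms]])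
      (auto intro!: comp_intros)
  have "decidable_on \<D> 3 (\<lambda>D xs. \<exists>m<arg xs 0 + arg xs 2 + 1. m \<in> part D (arg xs 0) (arg xs 1) (arg xs 2) \<and>
      (\<forall>i<m. i \<notin> part D (arg xs 0) (arg xs 1) (arg xs 2)) \<and>
      hits F q m (part D (arg xs 0) (arg xs 1) (arg xs 2) \<inter> {Suc m..}))"
    using hits by (auto intro!: comp_intros decidable_part simp: eval_nat_numeral)
  moreover have "(\<exists>m<H + b + 1. m \<in> part D H x b \<and> (\<forall>i<m. i \<notin> part D H x b) \<and>
      hits F q m (part D H x b \<inter> {Suc m..})) \<longleftrightarrow>
      part D H x b \<noteq> {} \<and> hits F q (Min (part D H x b)) (part D H x b - {Min (part D H x b)})" for D H b x
  proof -
    let ?S = "part D H x b"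
    have fin: "finite ?S" by (simp add: part_def)
    have m: "m = Min ?S \<and> ?S \<inter> {Suc m..} = ?S - {m}" if "m \<in> ?S" "\<forall>i<m. i \<notin> ?S" for m
    proof
      show "m = Min ?S" using that by (intro Min_eqI[OF fin, symmetric]) (auto simp: not_less[symmetric])
      show "?S \<inter> {Suc m..} = ?S - {m}" using that by (auto simp: Suc_le_eq) (metis linorder_neqE_nat)
    qed
    have least: "\<forall>i<Min ?S. i \<notin> ?S" using fin by (auto dest: Min_le)
    show ?thesis
    proof
      assume "\<exists>m<H + b + 1. m \<in> ?S \<and> (\<forall>i<m. i \<notin> ?S) \<and> hits F q m (?S \<inter> {Suc m..})"
      then obtain k where k: "k \<in> ?S" "\<forall>i<k. i \<notin> ?S" "hits F q k (?S \<inter> {Suc k..})" by blast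
      from m[OF k(1,2)] have "k = Min ?S" "?S \<inter> {Suc k..} = ?S - {k}" by blast+
      with k(1,3) show "?S \<noteq> {} \<and> hits F q (Min ?S) (?S - {Min ?S})" by auto
    next
      assume S: "?S \<noteq> {} \<and> hits F q (Min ?S) (?S - {Min ?S})"
      then have "Min ?S \<in> ?S" using fin by (intro Min_in) auto
      moreover from m[OF this least] have "?S \<inter> {Suc (Min ?S)..} = ?S - {Min ?S}" by blast
      ultimately show "\<exists>m<H + b + 1. m \<in> ?S \<and> (\<forall>i<m. i \<notin> ?S) \<and> hits F q m (?S \<inter> {Suc m..})"
        using S least part_less[of "Min ?S" D H x b] by (intro exI[of _ "Min ?S"]) simp
    qed
  qed
  ultimately show "decidable_on \<D> 3 (\<lambda>D xs. part D (arg xs 0) (arg xs 1) (arg xs 2) \<noteq> {} \<and>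
      hits F q (Min (part D (arg xs 0) (arg xs 1) (arg xs 2)))
       (part D (arg xs 0) (arg xs 1) (arg xs 2) - {Min (part D (arg xs 0) (arg xs 1) (arg xs 2))}))"
    by simp
qed

section \<open>Recovering the generic values from an oracle\<close>

definition next_in :: "nat set \<Rightarrow> nat \<Rightarrow> nat" where
  "next_in D m = (LEAST x. x \<in> D \<and> m \<le> x)"

lemma next_in:
  assumes "infinite D"
  shows "next_in D m \<in> D" "m \<le> next_in D m"
proof -
  have "\<exists>x. x \<in> D \<and> m \<le> x" using assms by (meson infinite_nat_iff_unbounded_le)
  from LeastI_ex[OF this] show "next_in D m \<in> D" "m \<le> next_in D m" by (simp_all add: next_in_def)
qed

lemma computable_next_in:
  assumes "\<And>D. D \<in> \<D> \<Longrightarrow> infinite D" "computable_on \<D> k f"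
  shows "computable_on \<D> k (\<lambda>D xs. next_in D (f D xs))"
proof (rule computable_comp1[OF _ assms(2)])
  show "computable_on \<D> 1 (\<lambda>D xs. next_in D (arg xs 0))"
    unfolding next_in_def
  proof (rule computable_Least)
    show "decidable_on \<D> (Suc 1) (\<lambda>D ys. arg ys 0 \<in> D \<and> arg (tl ys) 0 \<le> arg ys 0)"
      by (auto intro!: comp_intros)
    show "\<exists>n. n \<in> D \<and> arg xs 0 \<le> n" if "D \<in> \<D>" for D xs
      using assms(1)[OF that] by (meson infinite_nat_iff_unbounded_le)
  qed
qed

text \<open>An element of \<open>D\<close> that is at least \<open>n + H\<close> bounds
  \<open>n\<close> as well as all elements of the set coded by \<open>H\<close>, as
  \<open>guess_correct\<close> demands of its starting point.\<close>

definition estimate :: "(nat set \<Rightarrow> bool) \<Rightarrow> (nat \<Rightarrow> nat set \<Rightarrow> bool) \<Rightarrow> nat set \<Rightarrow> nat \<Rightarrow> nat \<Rightarrow> bool" where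
  "estimate \<rho> hit D n H \<longleftrightarrow> guess \<rho> hit D n (set_decode H) (next_in D (n + H))"

definition est_set :: "(nat set \<Rightarrow> bool) \<Rightarrow> (nat \<Rightarrow> nat set \<Rightarrow> bool) \<Rightarrow> nat set \<Rightarrow> nat set" where
  "est_set \<rho> hit D = {n. estimate \<rho> hit D n 0}"

text \<open>The counterpart of \<open>agree\<close> with \<open>B\<close> replaced by its estimate:
  codes below \<open>2 ^ Suc x\<close> are those of subsets of \<open>{..x}\<close>, and for such a
  code \<open>H\<close> adding \<open>2 ^ y\<close> adjoins \<open>y\<close> when
  \<open>x < y\<close>.\<close>

definition est_agree :: "(nat set \<Rightarrow> bool) \<Rightarrow> (nat \<Rightarrow> nat set \<Rightarrow> bool) \<Rightarrow> nat set \<Rightarrow> nat \<Rightarrow> nat \<Rightarrow> bool" where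
  "est_agree \<rho> hit D x y \<longleftrightarrow> (\<forall>n\<le>x. \<forall>H<2 ^ Suc x.
     (\<forall>i<H. i \<in> set_decode H \<longrightarrow> i \<le> x \<and> i \<in> est_set \<rho> hit D) \<longrightarrow>
     \<rho> (set_decode H) \<or> estimate \<rho> hit D n (H + 2 ^ y) = estimate \<rho> hit D n H)"

lemma decidable_ring:
  assumes "ring_decidable \<rho>" "computable_on \<D> k H" "computable_on \<D> k x" "computable_on \<D> k b"
  shows "decidable_on \<D> k (\<lambda>D xs. \<rho> (part D (H D xs) (x D xs) (b D xs)))"
  using decidable_comp3[where P = "\<lambda>D H x b. \<rho> (part D H x b)"] assms unfolding ring_decidable_def by blast

text \<open>The search in \<open>ring_at\<close> stops at the latest when the tail of
  \<open>D\<close> satisfies \<open>\<rho>\<close>, whatever \<open>H\<close> is. The estimate is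
  thus total on all of \<open>\<D>\<close>, including oracles on which it is wrong.\<close>

lemma decidable_estimate:
  assumes F: "finite F" and q: "decidable_on UNIV 3 (\<lambda>D xs. q (arg xs 0) (arg xs 1) (arg xs 2))"
    and \<rho>: "ring_decidable \<rho>"
    and \<D>: "\<And>D. D \<in> \<D> \<Longrightarrow> infinite D" "\<And>D x. D \<in> \<D> \<Longrightarrow> \<exists>b. \<rho> (D \<inter> {x<..b})"
    and nH: "computable_on \<D> k n" "computable_on \<D> k H"
  shows "decidable_on \<D> k (\<lambda>D xs. estimate \<rho> (hits F q) D (n D xs) (H D xs))"
proof (rule decidable_comp2[OF _ nH])
  have part0: "part D 0 x b = D \<inter> {x<..b}" for D x b by (simp add: part_def)
  have ring: "computable_on \<D> 2 (\<lambda>D xs. ring_at \<rho> D (set_decode (arg xs 0)) (arg xs 1))"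
  proof -
    have "computable_on \<D> 2 (\<lambda>D xs. LEAST b. \<rho> (part D 0 (arg xs 1) b) \<or> \<rho> (part D (arg xs 0) (arg xs 1) b))"
    proof (rule computable_Least)
      show "decidable_on \<D> (Suc 2) (\<lambda>D ys. \<rho> (part D 0 (arg (tl ys) 1) (arg ys 0)) \<or>
          \<rho> (part D (arg (tl ys) 0) (arg (tl ys) 1) (arg ys 0)))"
        by (intro decidable_disj decidable_ring \<rho> computable_const computable_arg) (auto intro!: comp_intros)
      show "\<exists>b. \<rho> (part D 0 (arg xs 1) b) \<or> \<rho> (part D (arg xs 0) (arg xs 1) b)" if "D \<in> \<D>" for D xs
        using \<D>(2)[OF that, of "arg xs 1"] unfolding part0 by blast
    qed
    then show ?thesis unfolding ring_at_def part_def by simp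
  qed
  have nxt: "computable_on \<D> 2 (\<lambda>D xs. next_in D (arg xs 0 + arg xs 1))"
    using \<D>(1) by (intro computable_next_in computable_add computable_arg) auto
  have "computable_on \<D> 2 (\<lambda>D xs. ring_at \<rho> D (set_decode (arg xs 1)) (next_in D (arg xs 0 + arg xs 1)))"
    by (rule computable_comp2[where F = "\<lambda>D H x. ring_at \<rho> D (set_decode H) x", OF ring computable_arg nxt]) simp
  then have "decidable_on \<D> 2 (\<lambda>D xs. hits F q (arg xs 0) (part D (arg xs 1) (next_in D (arg xs 0 + arg xs 1))
      (ring_at \<rho> D (set_decode (arg xs 1)) (next_in D (arg xs 0 + arg xs 1))) \<inter> {0..}))"
    by (intro decidable_comp5[where P = "\<lambda>D n H x b z. hits F q n (part D H x b \<inter> {z..})", OF decidable_hits[OF F q]]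
        nxt computable_const computable_arg) auto
  then show "decidable_on \<D> 2 (\<lambda>D xs. estimate \<rho> (hits F q) D (arg xs 0) (arg xs 1))"
    unfolding estimate_def guess_def part_def by simp
qed

lemma decidable_decoding:
  assumes F: "finite F" and q: "decidable_on UNIV 3 (\<lambda>D xs. q (arg xs 0) (arg xs 1) (arg xs 2))"
    and \<rho>: "ring_decidable \<rho>"
    and \<D>: "\<And>D. D \<in> \<D> \<Longrightarrow> infinite D" "\<And>D x. D \<in> \<D> \<Longrightarrow> \<exists>b. \<rho> (D \<inter> {x<..b})"
  shows "decidable_on \<D> 1 (\<lambda>D xs. arg xs 0 \<in> thin (est_set \<rho> (hits F q) D) (est_agree \<rho> (hits F q) D))"
proof (rule decidable_thin)
  note est = decidable_estimate[OF F q \<rho> \<D>]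
  show "decidable_on \<D> 1 (\<lambda>D xs. arg xs 0 \<in> est_set \<rho> (hits F q) D)"
    unfolding est_set_def mem_Collect_eq by (intro est computable_arg computable_const) auto
  \<comment> \<open>The interval from 0 to 0 is empty, so this is \<open>\<rho>\<close> of the coded
    set alone.\<close>
  have "decidable_on \<D> k (\<lambda>D xs. \<rho> (part D (H D xs) 0 0))" if "computable_on \<D> k H" for k H
    by (intro decidable_ring \<rho> that computable_const)
  then have \<rho>': "decidable_on \<D> k (\<lambda>D xs. \<rho> (set_decode (H D xs)))" if "computable_on \<D> k H" for k H
    using that by (simp add: part_def)
  show "decidable_on \<D> 2 (\<lambda>D xs. est_agree \<rho> (hits F q) D (arg xs 0) (arg xs 1))"
    unfolding est_agree_def est_set_def mem_Collect_eq
    by (intro decidable_ball_le decidable_ball_less decidable_imp decidable_disj decidable_conj decidable_iff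
        decidable_set_decode decidable_le est \<rho>' computable_add computable_power2 computable_Suc
        computable_const computable_arg)
      (auto intro!: comp_intros)
qed

section \<open>Correctness of the decoding\<close>

context coded_barrier
begin

lemma estimate_correct:
  assumes "D \<subseteq> code" "infinite D" "set_decode H \<subseteq> B"
  shows "estimate \<rho> hit D n H \<longleftrightarrow> v n (set_decode H)"
proof -
  let ?x = "next_in D (n + H)"
  have x: "?x \<in> D" "n + H \<le> ?x" using next_in[OF assms(2)] by blast+
  have "set_decode H \<subseteq> B \<inter> {..?x}"
    using assms(3) x(2) set_decode_less[of _ H] by fastforce
  with x show ?thesis unfolding estimate_def
    by (intro guess_correct[OF assms(1,2)]) auto
qed

lemma est_set_correct: "D \<subseteq> code \<Longrightarrow> infinite D \<Longrightarrow> est_set \<rho> hit D = B"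
  unfolding est_set_def using estimate_correct[of D 0] by (simp add: B_def)

lemma est_agree_correct:
  assumes D: "D \<subseteq> code" "infinite D" and xy: "x < y" "y \<in> B"
  shows "est_agree \<rho> hit D x y \<longleftrightarrow> agree x y"
proof -
  have insert: "estimate \<rho> hit D n (H + 2 ^ y) \<longleftrightarrow> v n (insert y (set_decode H))"
    if H: "set_decode H \<subseteq> B \<inter> {..x}" for n H
  proof -
    have eq: "set_decode (H + 2 ^ y) = insert y (set_decode H)"
      using H xy(1) by (intro set_decode_add_power) auto
    have "set_decode (H + 2 ^ y) \<subseteq> B" unfolding eq using H xy(2) by blast
    from estimate_correct[OF D this] show ?thesis unfolding eq .
  qed
  have sub: "(\<forall>i<H. i \<in> set_decode H \<longrightarrow> i \<le> x \<and> i \<in> est_set \<rho> hit D) \<longleftrightarrow> set_decode H \<subseteq> B \<inter> {..x}" for H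
    unfolding est_set_correct[OF D] using set_decode_less[of _ H] by auto
  show ?thesis
  proof
    assume est: "est_agree \<rho> hit D x y"
    show "agree x y"
      unfolding agree_def
    proof (intro allI impI)
      fix n H assume n: "n \<le> x" and H: "H \<subseteq> B \<inter> {..x}"
      have fin: "finite H" using H finite_subset by blast
      have "set_encode H \<le> (\<Sum>i<Suc x. 2 ^ i)"
        unfolding set_encode_def using H by (intro sum_mono2) auto
      also have "\<dots> < 2 ^ Suc x" using sum_power2[of "Suc x"] by (simp add: lessThan_atLeast0)
      finally have "set_encode H < 2 ^ Suc x" .
      moreover have dec: "set_decode (set_encode H) = H" using fin by simp
      ultimately have "\<rho> H \<or> estimate \<rho> hit D n (set_encode H + 2 ^ y) = estimate \<rho> hit D n (set_encode H)"
        using est n H sub[of "set_encode H"] unfolding est_agree_def by metis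
      moreover have "estimate \<rho> hit D n (set_encode H) \<longleftrightarrow> v n H"
        using estimate_correct[OF D, of "set_encode H" n] H unfolding dec by blast
      moreover have "estimate \<rho> hit D n (set_encode H + 2 ^ y) \<longleftrightarrow> v n (insert y H)"
        using insert[of "set_encode H" n] H unfolding dec by blast
      ultimately show "\<rho> H \<or> v n (insert y H) = v n H" by blast
    qed
  next
    assume ag: "agree x y"
    show "est_agree \<rho> hit D x y"
      unfolding est_agree_def sub
    proof (intro allI impI)
      fix n H assume n: "n \<le> x" and H: "set_decode H \<subseteq> B \<inter> {..x}"
      have "\<rho> (set_decode H) \<or> v n (insert y (set_decode H)) = v n (set_decode H)"
        using ag n H unfolding agree_def by blast
      moreover have "estimate \<rho> hit D n H \<longleftrightarrow> v n (set_decode H)"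
        using estimate_correct[OF D, of H n] H by blast
      ultimately show "\<rho> (set_decode H) \<or> estimate \<rho> hit D n (H + 2 ^ y) = estimate \<rho> hit D n H"
        using insert[OF H] by blast
    qed
  qed
qed

theorem decoding_correct:
  assumes "D \<subseteq> code" "infinite D"
  shows "thin (est_set \<rho> hit D) (est_agree \<rho> hit D) = code"
proof -
  have "thin B (est_agree \<rho> hit D) = thin B agree"
    by (rule thin_cong) (rule est_agree_correct[OF assms])
  then show ?thesis unfolding est_set_correct[OF assms] by (simp only: code_def)
qed

end

text \<open>The two oracle classes differ on purpose: \<open>dec\<close> is decided, hence total, on
  \<open>infinite_subsets A\<close>, but correct only on \<open>infinite_subsets R\<close>. Totality
  on the larger class is what later makes the class of coded sets arithmetical.\<close>

theorem exists_self_decoding: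
  assumes "introenumerable A"
  shows "\<exists>R dec. R \<subseteq> A \<and> infinite R \<and>
    decidable_on (infinite_subsets A) 1 (\<lambda>D xs. arg xs 0 \<in> dec D) \<and> (\<forall>D\<in>infinite_subsets R. dec D = R)"
proof -
  from universal_hits[OF assms] obtain F q Y where
    *: "finite F \<and> decidable_on UNIV 3 (\<lambda>D xs. q (arg xs 0) (arg xs 1) (arg xs 2)) \<and>
      (\<forall>n\<in>A. \<forall>D. D \<subseteq> A \<longrightarrow> infinite D \<longrightarrow> hits F q n D) \<and>
      Y \<subseteq> A \<and> infinite Y \<and> (\<forall>n. n \<notin> A \<longrightarrow> \<not> hits F q n Y)"
    by (elim exE)
  from * have F: "finite F" by (rule conjunct1)
  from * have q: "decidable_on UNIV 3 (\<lambda>D xs. q (arg xs 0) (arg xs 1) (arg xs 2))" by (elim conjE)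
  have hits: "\<And>n D. n \<in> A \<Longrightarrow> D \<subseteq> A \<Longrightarrow> infinite D \<Longrightarrow> hits F q n D"
    and Y: "Y \<subseteq> A" "infinite Y" "\<And>n. n \<notin> A \<Longrightarrow> \<not> hits F q n Y"
    using * by simp_all
  have "\<exists>U \<rho> B. coded_barrier U A \<rho> (hits F q) B \<and>
      ((\<exists>n0. \<rho> = hits F q n0) \<or> \<rho> = (\<lambda>S. S \<noteq> {} \<and> hits F q (Min S) (S - {Min S})))"
  proof (rule coded_barrier_exists)
    show "hits F q n T" if "hits F q n S" "S \<subseteq> T" for n S T using that by (rule hits_mono)
    show "\<exists>b. hits F q n (S \<inter> {..b})" if "hits F q n S" for n S using that by (rule hits_cont)
    show "hits F q n D" if "n \<in> A" "D \<subseteq> A" "infinite D" for n D using that by (rule hits)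
    show "\<not> hits F q n Y" if "n \<notin> A" for n using that by (rule Y(3))
  qed (fact Y)+
  then obtain U \<rho> B where
    **: "coded_barrier U A \<rho> (hits F q) B \<and>
      ((\<exists>n0. \<rho> = hits F q n0) \<or> \<rho> = (\<lambda>S. S \<noteq> {} \<and> hits F q (Min S) (S - {Min S})))"
    by (elim exE)
  from ** have cb: "coded_barrier U A \<rho> (hits F q) B" by (rule conjunct1)
  from ** have \<rho>: "(\<exists>n0. \<rho> = hits F q n0) \<or> \<rho> = (\<lambda>S. S \<noteq> {} \<and> hits F q (Min S) (S - {Min S}))"
    by (rule conjunct2)
  interpret coded_barrier U A \<rho> "hits F q" B by fact
  have rd: "ring_decidable \<rho>"
    using \<rho> ring_decidable_fixed[OF F q] ring_decidable_Min[OF F q] by blast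
  let ?dec = "\<lambda>D. thin (est_set \<rho> (hits F q) D) (est_agree \<rho> (hits F q) D)"
  have "decidable_on (infinite_subsets A) 1 (\<lambda>D xs. arg xs 0 \<in> ?dec D)"
    by (rule decidable_decoding[OF F q rd]) (auto simp: infinite_subsets_def intro: ring_exists)
  moreover have "\<forall>D\<in>infinite_subsets code. ?dec D = code"
    using decoding_correct by (simp add: infinite_subsets_def)
  ultimately show ?thesis using infinite_code code_subset B_subset
    by (intro exI[of _ code] exI[of _ ?dec]) blast
qed

text \<open>
  Once \<open>R\<close> is computed from all of its infinite subsets, a sufficiently sparse \<open>S \<subseteq> R\<close> also bounds the
  stages at which \<open>R\<close> enumerates \<open>A\<close>.
\<close>

theorem exists_uniform_functionals:
  assumes "introenumerable A"
  shows "\<exists>S dA dS. S \<subseteq> A \<and> infinite S \<and>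
    decidable_on (infinite_subsets A) 1 (\<lambda>D xs. arg xs 0 \<in> dA D) \<and>
    decidable_on (infinite_subsets A) 1 (\<lambda>D xs. arg xs 0 \<in> dS D) \<and>
    (\<forall>D\<in>infinite_subsets S. dA D = A \<and> dS D = S)"
proof -
  let ?\<D> = "infinite_subsets A"
  obtain R dec where R: "R \<subseteq> A" "infinite R" and dec: "decidable_on ?\<D> 1 (\<lambda>D xs. arg xs 0 \<in> dec D)"
    and dec_R: "\<And>D. D \<in> infinite_subsets R \<Longrightarrow> dec D = R"
    using exists_self_decoding[OF assms] by metis
  obtain e where e: "W e R = A"
    using assms R unfolding introenumerable_def infinite_subsets_def ce_in_def by blast
  obtain t where t: "simulates t e 1" using simulation_exists by blast
  have inf: "infinite D" if "D \<in> ?\<D>" for D using that by (simp add: infinite_subsets_def)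
  define found where "found P n y \<longleftrightarrow> t y (set_encode (P \<inter> {..<y})) [n] \<noteq> 0" for P n y
  have found_sound: "n \<in> A" if "found R n y" for n y
  proof -
    obtain z where "t y (set_encode (R \<inter> {..<y})) [n] = Suc z"
      using \<open>found R n y\<close> unfolding found_def by (meson not0_implies_Suc)
    then have "computes R e [n] z"
      by (intro simulates_sound[OF t]) auto
    with e show ?thesis unfolding W_def by blast
  qed
  have found_complete: "eventually (\<lambda>y. found R n y) at_top" if "n \<in> A" for n
  proof -
    from that e obtain z where z: "computes R e [n] z" unfolding W_def by blast
    have l: "length [n] = 1" by simp
    obtain s0 where s0: "\<And>s x. s \<ge> s0 \<Longrightarrow> R \<inter> {..<s} = set_decode x \<inter> {..<s} \<Longrightarrow> t s x [n] = Suc z"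
      using simulates_complete[OF t l z] by metis
    show ?thesis unfolding eventually_at_top_linorder found_def
    proof (intro exI[of _ s0] allI impI)
      fix y assume "y \<ge> s0"
      then have "t y (set_encode (R \<inter> {..<y})) [n] = Suc z" by (rule s0) auto
      then show "t y (set_encode (R \<inter> {..<y})) [n] \<noteq> 0" by simp
    qed
  qed
  \<comment> \<open>Two successive elements \<open>x < y\<close> of \<open>D\<close> with
    \<open>n \<le> x\<close> are used: if both lie in \<open>S\<close>, stage \<open>y\<close> has
    settled all numbers up to \<open>x\<close>.\<close>
  define dA where "dA D = {n. found (dec D) n (next_in D (Suc (next_in D n)))}" for D
  define settled where "settled P Q x y \<longleftrightarrow> (\<forall>n\<le>x. n \<in> P \<longrightarrow> found Q n y)" for P Q x y
  define S where "S = thin R (settled A R)"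
  \<comment> \<open>Once \<open>R\<close> and \<open>A\<close> are known from \<open>D\<close>, the
    thinning that defines \<open>S\<close> can be repeated.\<close>
  define dS where "dS D = thin (dec D) (settled (dA D) (dec D))" for D
  have "infinite S" unfolding S_def
  proof (rule infinite_thin)
    \<comment> \<open>No generic values are at stake here: by \<open>found_complete\<close> every
      sufficiently large element of \<open>R\<close> passes the test.\<close>
    let ?U = "inf at_top (principal R) :: nat filter"
    show "?U \<noteq> bot" unfolding trivial_limit_def
      using R(2) by (auto simp: eventually_inf_principal eventually_at_top_linorder infinite_nat_iff_unbounded_le)
    show "eventually (\<lambda>y. m < y) ?U" for m
      unfolding eventually_inf_principal
      by (rule eventually_mono[OF eventually_gt_at_top[of m]]) simp
    show "eventually (\<lambda>y. y \<in> R) ?U" by (simp add: eventually_inf_principal)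
    show "eventually (settled A R x) ?U" for x
    proof -
      have "eventually (\<lambda>y. \<forall>n\<in>{..x} \<inter> A. found R n y) at_top"
        using found_complete by (intro eventually_ball_finite) auto
      then show ?thesis unfolding eventually_inf_principal
        by (rule eventually_mono) (auto simp: settled_def)
    qed
  qed
  have SR: "S \<subseteq> R" unfolding S_def by (rule thin_subset)
  have correct: "dA D = A \<and> dS D = S" if D: "D \<in> infinite_subsets S" for D
  proof
    have inf: "infinite D" and DS: "D \<subseteq> S" using D by (auto simp: infinite_subsets_def)
    have d: "dec D = R" using D SR by (intro dec_R) (auto simp: infinite_subsets_def)
    show dA: "dA D = A"
    proof
      show "dA D \<subseteq> A" unfolding dA_def d using found_sound by blast
      show "A \<subseteq> dA D"
      proof
        fix n assume n: "n \<in> A"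
        let ?x = "next_in D n"
        let ?y = "next_in D (Suc ?x)"
        have "?x \<in> S" "?y \<in> S" "?x < ?y" "n \<le> ?x"
          using next_in[OF inf, of n] next_in[OF inf, of "Suc ?x"] DS by auto
        then have "settled A R ?x ?y" unfolding S_def using in_thin_iff by blast
        then show "n \<in> dA D" using n \<open>n \<le> ?x\<close> unfolding settled_def dA_def d by blast
      qed
    qed
    show "dS D = S" unfolding dS_def S_def d dA ..
  qed
  have found: "decidable_on ?\<D> k (\<lambda>D xs. found (dec D) (n D xs) (y D xs))"
    if n: "computable_on ?\<D> k n" and y: "computable_on ?\<D> k y" for k n y
  proof -
    \<comment> \<open>Thinning by a trivial test lets \<open>computable_thin_code\<close> turn the
      decision procedure for \<open>dec D\<close> into codes of its initial segments.\<close>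
    have thin_all: "thin P (\<lambda>x y. True) = P" for P
      using in_thin_iff[of _ P "\<lambda>x y. True"] by blast
    have "computable_on ?\<D> 1 (\<lambda>D xs. set_encode (dec D \<inter> {..<arg xs 0}))"
      using computable_thin_code[OF dec, of "\<lambda>D x y. True"] unfolding thin_all by (simp add: decidable_const)
    then have c: "computable_on ?\<D> k (\<lambda>D xs. set_encode (dec D \<inter> {..<y D xs}))"
      by (rule computable_comp1[where F = "\<lambda>D y. set_encode (dec D \<inter> {..<y})"]) (rule y)
    have "computable_on ?\<D> k (\<lambda>D xs. t (y D xs) (set_encode (dec D \<inter> {..<y D xs})) (map (\<lambda>g. g D xs) [n]))"
      using n by (intro simulates_computable[OF t] y c) auto
    then show ?thesis unfolding found_def
      by (intro decidable_not decidable_eq computable_const) simp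
  qed
  have dA: "decidable_on ?\<D> 1 (\<lambda>D xs. arg xs 0 \<in> dA D)"
    unfolding dA_def mem_Collect_eq
    by (intro found computable_next_in computable_Suc computable_arg inf) auto
  have "decidable_on ?\<D> 2 (\<lambda>D xs. settled (dA D) (dec D) (arg xs 0) (arg xs 1))"
    unfolding settled_def
    by (intro decidable_ball_le decidable_imp found decidable_comp1[where P = "\<lambda>D x. x \<in> dA D", OF dA] computable_arg)
      (auto intro!: computable_arg)
  then have "decidable_on ?\<D> 1 (\<lambda>D xs. arg xs 0 \<in> dS D)"
    unfolding dS_def by (intro decidable_thin dec)
  with dA correct \<open>infinite S\<close> SR R(1) show ?thesis by (intro exI[of _ S] exI[of _ dA] exI[of _ dS]) auto
qed

section \<open>Arithmetical definability\<close>

text \<open>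
  The function parameter \<open>f\<close> takes the role of the beta function: \<open>coder f\<close> says that every finite
  sequence is of the form \<open>i \<mapsto> f (pair b i)\<close> for some \<open>b\<close>.
\<close>

definition pair :: "nat \<Rightarrow> nat \<Rightarrow> nat" where
  "pair b i = (b + i) * (b + i) + b"

definition coder :: "(nat \<Rightarrow> nat) \<Rightarrow> bool" where
  "coder f \<longleftrightarrow> (\<forall>a i x. \<exists>b. f (pair b i) = x \<and> (\<forall>j<i. f (pair b j) = f (pair a j)))"

text \<open>The next square exceeds the square of \<open>b + i\<close> by more than
  \<open>b\<close>, so the value determines \<open>b + i\<close> and then \<open>b\<close>. Being a
  polynomial, \<open>pair\<close> is available as a term of the language.\<close>

lemma pair_inject: "pair b i = pair c j \<longleftrightarrow> b = c \<and> i = j"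
proof
  assume eq: "pair b i = pair c j"
  have less: "pair b i < pair c j" if "b + i < c + j" for b i c j
  proof -
    have "pair b i < (b + i + 1) * (b + i + 1)" by (simp add: pair_def)
    also have "\<dots> \<le> (c + j) * (c + j)" using that by (intro mult_le_mono) auto
    finally show ?thesis by (simp add: pair_def)
  qed
  have "b + i = c + j"
    using less[of b i c j] less[of c j b i] eq by (metis less_irrefl linorder_neqE_nat)
  with eq show "b = c \<and> i = j" by (simp add: pair_def)
qed simp

lemma coder_exists: "\<exists>f. coder f"
proof -
  define f where "f z = (let (b, i) = (SOME (b, i). z = pair b i) in
    (if i < length (list_decode b) then list_decode b ! i else 0))" for z
  have f: "f (pair b i) = (if i < length (list_decode b) then list_decode b ! i else 0)" for b i
  proof -
    have "(SOME (c, j). pair b i = pair c j) = (b, i)"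
      by (rule some_equality) (auto simp: pair_inject)
    then show ?thesis by (simp add: f_def)
  qed
  have "coder f"
    unfolding coder_def
  proof (intro allI)
    fix a i x
    let ?xs = "map (\<lambda>j. f (pair a j)) [0..<i] @ [x]"
    have len: "length (list_decode (list_encode ?xs)) = Suc i" by simp
    have "f (pair (list_encode ?xs) j) = ?xs ! j" if "j < Suc i" for j
      unfolding f using that by simp
    then show "\<exists>b. f (pair b i) = x \<and> (\<forall>j<i. f (pair b j) = f (pair a j))"
      by (intro exI[of _ "list_encode ?xs"]) (auto simp: nth_append)
  qed
  then show ?thesis by blast
qed

text \<open>\<open>coder\<close> only lets a coded sequence of length \<open>i\<close> be continued
  by one more value, which is first-order expressible; iteration produces all finite
  sequences.\<close>

lemma coder_sequence:
  assumes "coder f"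
  shows "\<exists>b. \<forall>i\<le>n. f (pair b i) = r i"
proof (induction n)
  case 0
  obtain b where "f (pair b 0) = r 0" using assms unfolding coder_def by metis
  then show ?case by auto
next
  case (Suc n)
  then obtain a where "\<forall>i\<le>n. f (pair a i) = r i" by blast
  moreover obtain b where "f (pair b (Suc n)) = r (Suc n)" "\<forall>j<Suc n. f (pair b j) = f (pair a j)"
    using assms unfolding coder_def by blast
  ultimately show ?case by (intro exI[of _ b]) (auto simp: le_Suc_eq)
qed

section \<open>Substitution and closure properties of definability\<close>

primrec tsubst :: "(nat \<Rightarrow> arith_term) \<Rightarrow> arith_term \<Rightarrow> arith_term" where
  "tsubst \<sigma> (Var i) = \<sigma> i"
| "tsubst \<sigma> Zer = Zer"
| "tsubst \<sigma> (Suc_of t) = Suc_of (tsubst \<sigma> t)"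
| "tsubst \<sigma> (Plus t u) = Plus (tsubst \<sigma> t) (tsubst \<sigma> u)"
| "tsubst \<sigma> (Times t u) = Times (tsubst \<sigma> t) (tsubst \<sigma> u)"
| "tsubst \<sigma> (Fun_f t) = Fun_f (tsubst \<sigma> t)"

primrec fsubst :: "(nat \<Rightarrow> arith_term) \<Rightarrow> arith_formula \<Rightarrow> arith_formula" where
  "fsubst \<sigma> (Eq t u) = Eq (tsubst \<sigma> t) (tsubst \<sigma> u)"
| "fsubst \<sigma> (In_R t) = In_R (tsubst \<sigma> t)"
| "fsubst \<sigma> (In_A t) = In_A (tsubst \<sigma> t)"
| "fsubst \<sigma> (Neg \<phi>) = Neg (fsubst \<sigma> \<phi>)"
| "fsubst \<sigma> (Conj \<phi> \<psi>) = Conj (fsubst \<sigma> \<phi>) (fsubst \<sigma> \<psi>)"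
| "fsubst \<sigma> (Exists \<phi>) = Exists (fsubst (case_nat (Var 0) (\<lambda>i. tsubst (\<lambda>j. Var (Suc j)) (\<sigma> i))) \<phi>)"

lemma term_val_tsubst: "term_val f s (tsubst \<sigma> t) = term_val f (\<lambda>i. term_val f s (\<sigma> i)) t"
  by (induction t) auto

lemma sat_fsubst: "sat R f A s (fsubst \<sigma> \<phi>) \<longleftrightarrow> sat R f A (\<lambda>i. term_val f s (\<sigma> i)) \<phi>"
proof (induction \<phi> arbitrary: s \<sigma>)
  case (Exists \<phi>)
  have "(\<lambda>i. term_val f (case_nat n s) (case_nat (Var 0) (\<lambda>i. tsubst (\<lambda>j. Var (Suc j)) (\<sigma> i)) i)) =
      case_nat n (\<lambda>i. term_val f s (\<sigma> i))" for n
    by (auto simp: term_val_tsubst split: nat.split)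
  then show ?case by (simp add: Exists.IH)
qed (auto simp: term_val_tsubst)

text \<open>The formula has to be right only for those \<open>f\<close> that satisfy
  \<open>C\<close>; with \<open>C\<close> being \<open>coder\<close> it may use \<open>f\<close> to
  quantify over finite sequences.\<close>

definition definable ::
    "((nat \<Rightarrow> nat) \<Rightarrow> bool) \<Rightarrow> (nat set \<Rightarrow> (nat \<Rightarrow> nat) \<Rightarrow> nat set \<Rightarrow> (nat \<Rightarrow> nat) \<Rightarrow> bool) \<Rightarrow> bool" where
  "definable C P \<longleftrightarrow> (\<exists>\<phi>. \<forall>R f A s. C f \<longrightarrow> sat R f A s \<phi> = P R f A s)"

lemma definable_cong:
  assumes "definable C P" "\<And>R f A s. C f \<Longrightarrow> P R f A s = Q R f A s"
  shows "definable C Q"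
  using assms unfolding definable_def by simp

lemma definable_eq: "definable C (\<lambda>R f A s. term_val f s t = term_val f s u)"
  unfolding definable_def by (rule exI[of _ "Eq t u"]) simp

lemma definable_in_R: "definable C (\<lambda>R f A s. term_val f s t \<in> R)"
  unfolding definable_def by (rule exI[of _ "In_R t"]) simp

lemma definable_in_A: "definable C (\<lambda>R f A s. term_val f s t \<in> A)"
  unfolding definable_def by (rule exI[of _ "In_A t"]) simp

lemma definable_not:
  assumes "definable C P"
  shows "definable C (\<lambda>R f A s. \<not> P R f A s)"
proof -
  from assms obtain \<phi> where "\<And>R f A s. C f \<Longrightarrow> sat R f A s \<phi> = P R f A s"
    unfolding definable_def by blast
  then show ?thesis unfolding definable_def by (intro exI[of _ "Neg \<phi>"]) simp
qed

lemma definable_conj: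
  assumes "definable C P" "definable C Q"
  shows "definable C (\<lambda>R f A s. P R f A s \<and> Q R f A s)"
proof -
  from assms obtain \<phi> \<psi> where "\<And>R f A s. C f \<Longrightarrow> sat R f A s \<phi> = P R f A s"
    "\<And>R f A s. C f \<Longrightarrow> sat R f A s \<psi> = Q R f A s"
    unfolding definable_def by blast
  then show ?thesis unfolding definable_def by (intro exI[of _ "Conj \<phi> \<psi>"]) simp
qed

text \<open>Later statements keep unreduced abstractions applied to
  \<open>R f A (case_nat n s)\<close>, so that this rule and its relatives unify with them.\<close>

lemma definable_ex:
  assumes "definable C P"
  shows "definable C (\<lambda>R f A s. \<exists>n. P R f A (case_nat n s))"
proof -
  from assms obtain \<phi> where "\<And>R f A s. C f \<Longrightarrow> sat R f A s \<phi> = P R f A s"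
    unfolding definable_def by blast
  then show ?thesis unfolding definable_def by (intro exI[of _ "Exists \<phi>"]) simp
qed

lemma definable_subst:
  assumes "definable C P"
  shows "definable C (\<lambda>R f A s. P R f A (\<lambda>i. term_val f s (\<sigma> i)))"
proof -
  from assms obtain \<phi> where "\<And>R f A s. C f \<Longrightarrow> sat R f A s \<phi> = P R f A s"
    unfolding definable_def by blast
  then show ?thesis unfolding definable_def by (intro exI[of _ "fsubst \<sigma> \<phi>"]) (simp add: sat_fsubst)
qed

lemma definable_disj:
  assumes "definable C P" "definable C Q"
  shows "definable C (\<lambda>R f A s. P R f A s \<or> Q R f A s)"
  by (rule definable_cong[OF definable_not[OF definable_conj[OF definable_not[OF assms(1)] definable_not[OF assms(2)]]]]) simp

lemma definable_imp:
  assumes "definable C P" "definable C Q"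
  shows "definable C (\<lambda>R f A s. P R f A s \<longrightarrow> Q R f A s)"
  by (rule definable_cong[OF definable_disj[OF definable_not[OF assms(1)] assms(2)]]) blast

lemma definable_all:
  assumes "definable C P"
  shows "definable C (\<lambda>R f A s. \<forall>n. P R f A (case_nat n s))"
  by (rule definable_cong[OF definable_not[OF definable_ex[OF definable_not[OF assms]]]]) simp

lemma definable_False: "definable C (\<lambda>R f A s. False)"
  using definable_eq[of C Zer "Suc_of Zer"] by simp

lemma definable_less: "definable C (\<lambda>R f A s. term_val f s t < term_val f s u)"
proof -
  have "definable C (\<lambda>R f A s. \<exists>d. (\<lambda>R f A s. term_val f s (Var 2) = term_val f s (Suc_of (Plus (Var 1) (Var 0)))) R f A (case_nat d s))"
    by (rule definable_ex[OF definable_eq])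
  then have "definable C (\<lambda>R f A s. s 0 < s 1)"
    by (rule definable_cong) (auto simp: less_iff_Suc_add numeral_2_eq_2)
  from definable_subst[OF this, of "case_nat t (\<lambda>_. u)"] show ?thesis by simp
qed

lemma definable_ball:
  assumes "definable C P"
  shows "definable C (\<lambda>R f A s. \<forall>n<term_val f s t. P R f A (case_nat n s))"
proof -
  have "definable C (\<lambda>R f A s. \<forall>n. (\<lambda>R f A s. term_val f s (Var 0) < term_val f s (tsubst (\<lambda>j. Var (Suc j)) t) \<longrightarrow> P R f A s)
      R f A (case_nat n s))"
    by (intro definable_all definable_imp definable_less assms)
  then show ?thesis by (simp add: term_val_tsubst)
qed

lemma definable_ball_fixed:
  fixes m :: nat
  assumes "\<And>i. i < m \<Longrightarrow> definable C (P i)"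
  shows "definable C (\<lambda>R f A s. \<forall>i<m. P i R f A s)"
  using assms
proof (induction m)
  case 0
  show ?case using definable_not[OF definable_False] by simp
next
  case (Suc m)
  then have "definable C (\<lambda>R f A s. P m R f A s \<and> (\<forall>i<m. P i R f A s))"
    by (intro definable_conj) auto
  then show ?case by (rule definable_cong) (auto simp: less_Suc_eq)
qed

primrec env_append :: "nat list \<Rightarrow> (nat \<Rightarrow> nat) \<Rightarrow> nat \<Rightarrow> nat" where
  "env_append [] s = s"
| "env_append (y # ys) s = case_nat y (env_append ys s)"

lemma env_append_less: "i < length ys \<Longrightarrow> env_append ys s i = ys ! i"
  by (induction ys arbitrary: i) (auto simp: nth_Cons split: nat.split)

lemma env_append_add: "env_append ys s (length ys + i) = s i"
  by (induction ys) auto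

lemma definable_ex_list:
  assumes "definable C P"
  shows "definable C (\<lambda>R f A s. \<exists>ys. length ys = m \<and> P R f A (env_append ys s))"
  using assms
proof (induction m arbitrary: P)
  case 0
  then show ?case by simp
next
  case (Suc m)
  have "definable C (\<lambda>R f A s. \<exists>ys. length ys = m \<and> (\<exists>n. P R f A (case_nat n (env_append ys s))))"
    using Suc.IH[OF definable_ex[OF Suc.prems]] .
  then show ?case
  proof (rule definable_cong)
    fix R f A s
    show "(\<exists>ys. length ys = m \<and> (\<exists>n. P R f A (case_nat n (env_append ys s)))) \<longleftrightarrow>
        (\<exists>ys. length ys = Suc m \<and> P R f A (env_append ys s))"
    proof
      assume "\<exists>ys. length ys = m \<and> (\<exists>n. P R f A (case_nat n (env_append ys s)))"
      then obtain ys n where "length ys = m" "P R f A (case_nat n (env_append ys s))" by blast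
      then show "\<exists>ys. length ys = Suc m \<and> P R f A (env_append ys s)"
        by (intro exI[of _ "n # ys"]) simp
    next
      assume "\<exists>ys. length ys = Suc m \<and> P R f A (env_append ys s)"
      then obtain y ys where "length ys = m" "P R f A (env_append (y # ys) s)"
        by (metis length_Suc_conv)
      then show "\<exists>ys. length ys = m \<and> (\<exists>n. P R f A (case_nat n (env_append ys s)))" by auto
    qed
  qed
qed

section \<open>Graphs of oracle programs\<close>

definition graph :: "prog \<Rightarrow> nat \<Rightarrow> nat set \<Rightarrow> (nat \<Rightarrow> nat) \<Rightarrow> nat set \<Rightarrow> (nat \<Rightarrow> nat) \<Rightarrow> bool" where
  "graph p k R f A s \<longleftrightarrow> computes R p (map s [0..<k]) (s k)"

lemma graph_subst:
  assumes "definable C (graph p k)"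
  shows "definable C (\<lambda>R f A s. computes R p (map (\<lambda>i. term_val f s (\<sigma> i)) [0..<k]) (term_val f s (\<sigma> k)))"
  using definable_subst[OF assms, of \<sigma>] by (simp add: graph_def comp_def)

text \<open>Recursion becomes the existence of the sequence of intermediate values, which a coder
  turns into a number quantifier.\<close>

lemma computes_PrimRec_iff:
  "computes D (PrimRec g h) (n # xs) z \<longleftrightarrow>
     (\<exists>r. computes D g xs (r 0) \<and> (\<forall>i<n. computes D h (i # r i # xs) (r (Suc i))) \<and> r n = z)"
proof
  assume "computes D (PrimRec g h) (n # xs) z"
  then show "\<exists>r. computes D g xs (r 0) \<and> (\<forall>i<n. computes D h (i # r i # xs) (r (Suc i))) \<and> r n = z"
  proof (induction n arbitrary: z)
    case 0
    then show ?case by (intro exI[of _ "\<lambda>_. z"]) (auto elim: computes_PrimRecE)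
  next
    case (Suc n)
    then obtain y where y: "computes D (PrimRec g h) (n # xs) y" "computes D h (n # y # xs) z"
      by (auto elim: computes_PrimRecE)
    from Suc.IH[OF y(1)] obtain r where "computes D g xs (r 0)"
      "\<forall>i<n. computes D h (i # r i # xs) (r (Suc i))" "r n = y" by blast
    with y(2) show ?case
      by (intro exI[of _ "r(Suc n := z)"]) (auto simp: less_Suc_eq)
  qed
next
  assume "\<exists>r. computes D g xs (r 0) \<and> (\<forall>i<n. computes D h (i # r i # xs) (r (Suc i))) \<and> r n = z"
  then obtain r where r: "computes D g xs (r 0)" "\<forall>i<n. computes D h (i # r i # xs) (r (Suc i))" "r n = z" by blast
  have "i \<le> n \<Longrightarrow> computes D (PrimRec g h) (i # xs) (r i)" for i
    by (induction i) (use r in \<open>auto intro: computes.primrec_0 computes.primrec_Suc\<close>)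
  with r(3) show "computes D (PrimRec g h) (n # xs) z" by blast
qed

lemma definable_graph_Comp:
  assumes h: "definable C (graph h (length gs))" and g: "\<And>g. g \<in> set gs \<Longrightarrow> definable C (graph g k)"
  shows "definable C (graph (Comp h gs) k)"
proof -
  let ?m = "length gs"
  \<comment> \<open>Conditionals such as \<open>if k < k\<close> keep the shape of
    \<open>graph_subst\<close>, where one substitution covers arguments and result: the last index
    is that of the result.\<close>
  have "definable C (\<lambda>R f A s. \<exists>ys. length ys = ?m \<and>
      (\<lambda>R f A s. (\<forall>i<?m. computes R (gs ! i) (map (\<lambda>j. term_val f s (Var (if j < k then ?m + j else i))) [0..<k])
          (term_val f s (Var (if k < k then ?m + k else i)))) \<and>
        computes R h (map (\<lambda>j. term_val f s (Var (if j < ?m then j else ?m + k))) [0..<?m])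
          (term_val f s (Var (if ?m < ?m then ?m else ?m + k)))) R f A (env_append ys s))"
    using g by (intro definable_ex_list definable_conj definable_ball_fixed graph_subst h) auto
  then show ?thesis
  proof (rule definable_cong)
    fix R f A s
    have xs: "map (\<lambda>j. env_append ys s (if j < k then ?m + j else i)) [0..<k] = map s [0..<k]"
      if "length ys = ?m" for ys i
      using that by (intro map_cong) (auto simp: env_append_add[of ys, unfolded that])
    have ys: "map (\<lambda>j. env_append ys s (if j < ?m then j else ?m + k)) [0..<?m] = ys" if "length ys = ?m" for ys
      using that by (intro nth_equalityI) (auto simp: env_append_less)
    have z: "env_append ys s (?m + k) = s k" if "length ys = ?m" for ys
      using env_append_add[of ys s k] that by simp
    have "(\<exists>ys. length ys = ?m \<and> (\<forall>i<?m. computes R (gs ! i) (map s [0..<k]) (ys ! i)) \<and> computes R h ys (s k)) \<longleftrightarrow>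
        computes R (Comp h gs) (map s [0..<k]) (s k)"
      by (auto simp: list_all2_conv_all_nth elim!: computes_CompE intro!: computes.comp)
    then show "(\<exists>ys. length ys = ?m \<and>
      (\<lambda>R f A s. (\<forall>i<?m. computes R (gs ! i) (map (\<lambda>j. term_val f s (Var (if j < k then ?m + j else i))) [0..<k])
          (term_val f s (Var (if k < k then ?m + k else i)))) \<and>
        computes R h (map (\<lambda>j. term_val f s (Var (if j < ?m then j else ?m + k))) [0..<?m])
          (term_val f s (Var (if ?m < ?m then ?m else ?m + k)))) R f A (env_append ys s)) = graph (Comp h gs) k R f A s"
      by (simp add: graph_def xs ys z env_append_less cong: conj_cong)
  qed
qed

lemma definable_graph_PrimRec:
  assumes g: "definable coder (graph g k)" and h: "definable coder (graph h (Suc (Suc k)))"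
  shows "definable coder (graph (PrimRec g h) (Suc k))"
proof -
  let ?pair = "\<lambda>b i. Fun_f (Plus (Times (Plus b i) (Plus b i)) b)"
  \<comment> \<open>Below the quantifier for \<open>b\<close>, the recursion argument is variable 1
    and the parameters start at 2. Below the further quantifier for \<open>i\<close>, used by
    \<open>?\<sigma>h\<close>, \<open>b\<close> is variable 1 and the parameters start at 3.\<close>
  let ?\<sigma>g = "\<lambda>j. if j < k then Var (j + 2) else ?pair (Var 0) Zer"
  let ?\<sigma>h = "\<lambda>j. if j = 0 then Var 0 else if j = 1 then ?pair (Var 1) (Var 0)
    else if j < k + 2 then Var (j + 1) else ?pair (Var 1) (Suc_of (Var 0))"
  have "definable coder (\<lambda>R f A s. \<exists>b. (\<lambda>R f A s.
      computes R g (map (\<lambda>j. term_val f s (?\<sigma>g j)) [0..<k]) (term_val f s (?\<sigma>g k)) \<and>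
      (\<forall>i<term_val f s (Var 1). (\<lambda>R f A s. computes R h (map (\<lambda>j. term_val f s (?\<sigma>h j)) [0..<Suc (Suc k)])
          (term_val f s (?\<sigma>h (Suc (Suc k))))) R f A (case_nat i s)) \<and>
      term_val f s (?pair (Var 0) (Var 1)) = term_val f s (Var (k + 2))) R f A (case_nat b s))"
    by (intro definable_ex definable_conj definable_ball definable_eq graph_subst g h)
  then show ?thesis
  proof (rule definable_cong)
    fix R A :: "nat set" and f s :: "nat \<Rightarrow> nat" assume f: "coder f"
    let ?xs = "map (\<lambda>j. s (Suc j)) [0..<k]"
    have args: "map s [0..<Suc k] = s 0 # ?xs"
      by (simp add: upt_conv_Cons map_Suc_upt[symmetric] del: upt_Suc)
    have hargs: "map F [0..<Suc (Suc k)] = F 0 # F 1 # map (\<lambda>j. F (Suc (Suc j))) [0..<k]" for F :: "nat \<Rightarrow> nat"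
      by (simp add: upt_conv_Cons map_Suc_upt[symmetric] comp_def del: upt_Suc)
    have gmap: "map (\<lambda>j. term_val f (case_nat b s) (?\<sigma>g j)) [0..<k] = ?xs" for b
      by (intro map_cong) auto
    have hmap: "map (\<lambda>j. term_val f (case_nat i (case_nat b s)) (?\<sigma>h (Suc (Suc j)))) [0..<k] = ?xs" for b i
      by (intro map_cong) auto
    have "computes R (PrimRec g h) (s 0 # ?xs) (s (Suc k)) \<longleftrightarrow>
      (\<exists>b. computes R g ?xs (f (pair b 0)) \<and>
        (\<forall>i<s 0. computes R h (i # f (pair b i) # ?xs) (f (pair b (Suc i)))) \<and> f (pair b (s 0)) = s (Suc k))"
    proof
      assume "computes R (PrimRec g h) (s 0 # ?xs) (s (Suc k))"
      then obtain r where r: "computes R g ?xs (r 0)" "\<forall>i<s 0. computes R h (i # r i # ?xs) (r (Suc i))"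
        "r (s 0) = s (Suc k)" unfolding computes_PrimRec_iff by blast
      obtain b where "\<forall>i\<le>s 0. f (pair b i) = r i" using coder_sequence[OF f] by blast
      with r show "\<exists>b. computes R g ?xs (f (pair b 0)) \<and>
        (\<forall>i<s 0. computes R h (i # f (pair b i) # ?xs) (f (pair b (Suc i)))) \<and> f (pair b (s 0)) = s (Suc k)"
        by (intro exI[of _ b]) auto
    next
      assume "\<exists>b. computes R g ?xs (f (pair b 0)) \<and>
        (\<forall>i<s 0. computes R h (i # f (pair b i) # ?xs) (f (pair b (Suc i)))) \<and> f (pair b (s 0)) = s (Suc k)"
      then obtain b where "computes R g ?xs (f (pair b 0))"
        "\<forall>i<s 0. computes R h (i # f (pair b i) # ?xs) (f (pair b (Suc i)))" "f (pair b (s 0)) = s (Suc k)" by blast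
      then show "computes R (PrimRec g h) (s 0 # ?xs) (s (Suc k))"
        unfolding computes_PrimRec_iff by (intro exI[of _ "\<lambda>i. f (pair b i)"]) simp
    qed
    then show "(\<exists>b. (\<lambda>R f A s.
      computes R g (map (\<lambda>j. term_val f s (?\<sigma>g j)) [0..<k]) (term_val f s (?\<sigma>g k)) \<and>
      (\<forall>i<term_val f s (Var 1). (\<lambda>R f A s. computes R h (map (\<lambda>j. term_val f s (?\<sigma>h j)) [0..<Suc (Suc k)])
          (term_val f s (?\<sigma>h (Suc (Suc k))))) R f A (case_nat i s)) \<and>
      term_val f s (?pair (Var 0) (Var 1)) = term_val f s (Var (k + 2))) R f A (case_nat b s)) =
      graph (PrimRec g h) (Suc k) R f A s"
      unfolding graph_def args hargs gmap hmap by (simp add: pair_def)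
  qed
qed

lemma definable_graph_Mu:
  assumes g: "definable C (graph g (Suc k))"
  shows "definable C (graph (Mu g) k)"
proof -
  \<comment> \<open>Variable \<open>k\<close> holds the result of the search and becomes the first
    argument of \<open>g\<close>. In \<open>?\<sigma>1\<close>, variables 0 and 1 are the value
    \<open>y\<close> and the smaller candidate \<open>m\<close>.\<close>
  let ?\<sigma>0 = "\<lambda>j. if j = 0 then Var k else if j < Suc k then Var (j - 1) else Zer"
  let ?\<sigma>1 = "\<lambda>j. if j = 0 then Var 1 else if j < Suc k then Var (j + 1) else Suc_of (Var 0)"
  have "definable C (\<lambda>R f A s. computes R g (map (\<lambda>j. term_val f s (?\<sigma>0 j)) [0..<Suc k]) (term_val f s (?\<sigma>0 (Suc k))) \<and>
     (\<forall>m<term_val f s (Var k). (\<lambda>R f A s. \<exists>y. (\<lambda>R f A s.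
        computes R g (map (\<lambda>j. term_val f s (?\<sigma>1 j)) [0..<Suc k]) (term_val f s (?\<sigma>1 (Suc k)))) R f A (case_nat y s))
        R f A (case_nat m s)))"
    by (intro definable_conj definable_ball definable_ex graph_subst g)
  then show ?thesis
  proof (rule definable_cong)
    fix R A :: "nat set" and f s :: "nat \<Rightarrow> nat"
    have args: "map F [0..<Suc k] = F 0 # map (\<lambda>j. F (Suc j)) [0..<k]" for F :: "nat \<Rightarrow> nat"
      by (simp add: upt_conv_Cons map_Suc_upt[symmetric] comp_def del: upt_Suc)
    have map0: "map (\<lambda>j. term_val f s (?\<sigma>0 (Suc j))) [0..<k] = map s [0..<k]"
      by (intro map_cong) auto
    have map1: "map (\<lambda>j. term_val f (case_nat y (case_nat m s)) (?\<sigma>1 (Suc j))) [0..<k] = map s [0..<k]" for y m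
      by (intro map_cong) auto
    have "computes R (Mu g) (map s [0..<k]) (s k) \<longleftrightarrow> computes R g (s k # map s [0..<k]) 0 \<and>
      (\<forall>m<s k. \<exists>y. computes R g (m # map s [0..<k]) (Suc y))"
      by (auto elim: computes_MuE intro: computes.mu)
    then show "(computes R g (map (\<lambda>j. term_val f s (?\<sigma>0 j)) [0..<Suc k]) (term_val f s (?\<sigma>0 (Suc k))) \<and>
     (\<forall>m<term_val f s (Var k). (\<lambda>R f A s. \<exists>y. (\<lambda>R f A s.
        computes R g (map (\<lambda>j. term_val f s (?\<sigma>1 j)) [0..<Suc k]) (term_val f s (?\<sigma>1 (Suc k)))) R f A (case_nat y s))
        R f A (case_nat m s))) = graph (Mu g) k R f A s"
      unfolding graph_def args map0 map1 by simp
  qed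
qed

lemma definable_graph: "definable coder (graph p k)"
proof (induction p arbitrary: k)
  case Zero
  have "definable coder (\<lambda>R f A s. term_val f s (Var k) = term_val f s Zer)" by (rule definable_eq)
  then show ?case by (rule definable_cong) (auto simp: graph_def intro: computes.zero elim: computes_ZeroE)
next
  case Succ
  show ?case
  proof (cases k)
    case 0
    show ?thesis using definable_False
      by (rule definable_cong) (auto simp: graph_def 0 elim: computes_SuccE)
  next
    case (Suc m)
    have "definable coder (\<lambda>R f A s. term_val f s (Var k) = term_val f s (Suc_of (Var 0)))" by (rule definable_eq)
    then show ?thesis
      by (rule definable_cong)
        (auto simp: graph_def Suc upt_conv_Cons simp del: upt_Suc intro: computes.succ elim: computes_SuccE)
  qed
next
  case (Proj i)
  show ?case
  proof (cases "i < k")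
    case False
    show ?thesis using definable_False
      by (rule definable_cong) (use False in \<open>auto simp: graph_def elim: computes_ProjE\<close>)
  next
    case True
    have "definable coder (\<lambda>R f A s. term_val f s (Var k) = term_val f s (Var i))" by (rule definable_eq)
    then show ?thesis
    proof (rule definable_cong)
      fix R A :: "nat set" and f s :: "nat \<Rightarrow> nat"
      show "(term_val f s (Var k) = term_val f s (Var i)) = graph (Proj i) k R f A s"
        using True computes.proj[of i "map s [0..<k]" R] by (auto simp: graph_def elim: computes_ProjE)
    qed
  qed
next
  case Query
  show ?case
  proof (cases k)
    case 0
    show ?thesis using definable_False
      by (rule definable_cong) (auto simp: graph_def 0 elim: computes_QueryE)
  next
    case (Suc m)
    have "definable coder (\<lambda>R f A s. (term_val f s (Var 0) \<in> R \<and> term_val f s (Var k) = term_val f s (Suc_of Zer)) \<or>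
      (\<not> term_val f s (Var 0) \<in> R \<and> term_val f s (Var k) = term_val f s Zer))"
      by (intro definable_disj definable_conj definable_not definable_in_R definable_eq)
    then show ?thesis
    proof (rule definable_cong)
      fix R A :: "nat set" and f s :: "nat \<Rightarrow> nat"
      have "map s [0..<k] = s 0 # map s [1..<k]" by (simp add: Suc upt_conv_Cons del: upt_Suc)
      moreover have "computes R Query (s 0 # xs) z \<longleftrightarrow> z = (if s 0 \<in> R then 1 else 0)" for xs z
        using computes.query[of R "s 0" xs] by (auto elim: computes_QueryE)
      ultimately show "((term_val f s (Var 0) \<in> R \<and> term_val f s (Var k) = term_val f s (Suc_of Zer)) \<or>
        (\<not> term_val f s (Var 0) \<in> R \<and> term_val f s (Var k) = term_val f s Zer)) = graph Query k R f A s"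
        unfolding graph_def by simp
    qed
  qed
next
  case (Comp h gs)
  then show ?case by (intro definable_graph_Comp) auto
next
  case (PrimRec g h)
  show ?case
  proof (cases k)
    case 0
    show ?thesis using definable_False
      by (rule definable_cong) (auto simp: graph_def 0 elim: computes_PrimRecE)
  next
    case (Suc m)
    then show ?thesis using definable_graph_PrimRec PrimRec.IH by blast
  qed
next
  case (Mu g)
  then show ?case by (intro definable_graph_Mu) auto
qed

lemma definable_coder: "definable (\<lambda>_. True) (\<lambda>R f A s. coder f)"
proof -
  let ?pair = "\<lambda>b i. Fun_f (Plus (Times (Plus b i) (Plus b i)) b)"
  have "definable (\<lambda>_. True) (\<lambda>R f A s. \<forall>a. (\<lambda>R f A s. \<forall>i. (\<lambda>R f A s. \<forall>x. (\<lambda>R f A s. \<exists>b. (\<lambda>R f A s.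
      term_val f s (?pair (Var 0) (Var 2)) = term_val f s (Var 1) \<and>
      (\<forall>j<term_val f s (Var 2). (\<lambda>R f A s. term_val f s (?pair (Var 1) (Var 0)) = term_val f s (?pair (Var 4) (Var 0)))
        R f A (case_nat j s)))
      R f A (case_nat b s)) R f A (case_nat x s)) R f A (case_nat i s)) R f A (case_nat a s))"
    by (intro definable_all definable_ex definable_conj definable_ball definable_eq)
  then show ?thesis
    by (rule definable_cong) (simp add: coder_def pair_def eval_nat_numeral)
qed

text \<open>\<open>P\<close> does not depend on \<open>f\<close>, so every coder evaluates the
  formula correctly, and coders exist. The quantifier over \<open>f\<close> may therefore be used to
  provide one.\<close>

theorem Sigma11_class_definable:
  assumes "definable coder (\<lambda>R f A s. P R A)"
  shows "Sigma11_class A {R. P R A}"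
proof -
  obtain \<phi> where \<phi>: "\<And>R f A s. coder f \<Longrightarrow> sat R f A s \<phi> = P R A"
    using assms unfolding definable_def by blast
  obtain \<psi> where \<psi>: "\<And>R f A s. sat R f A s \<psi> = coder f"
    using definable_coder unfolding definable_def by blast
  have "{R. P R A} = {R. \<exists>f. sat R f A (\<lambda>_. 0) (Conj \<psi> \<phi>)}"
    using coder_exists by (auto simp: \<phi> \<psi>)
  then show ?thesis unfolding Sigma11_class_def by blast
qed

section \<open>The class of coded sets\<close>

lemma W_of_decidable:
  assumes "decidable_on \<D> 2 (\<lambda>D xs. P D (arg xs 0) (arg xs 1))"
  shows "\<exists>e. \<forall>D\<in>\<D>. W e D = {z. \<exists>w. P D w z}"
proof -
  have "computable_on \<D> 2 (\<lambda>D xs. of_bool (\<not> P D (arg xs 0) (arg xs 1)))"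
    using assms by (intro comp_intros)
  then obtain p where "\<And>D xs. D \<in> \<D> \<Longrightarrow> length xs = 2 \<Longrightarrow>
      computes D p xs (of_bool (\<not> P D (arg xs 0) (arg xs 1)))"
    unfolding computable_on_def by blast
  from this[of _ "[w, z]" for w z]
  have p: "computes D p [w, z] (of_bool (\<not> P D w z))" if "D \<in> \<D>" for D w z
    using that by simp
  have "W (Mu p) D = {z. \<exists>w. P D w z}" if D: "D \<in> \<D>" for D
  proof (intro set_eqI iffI)
    fix z assume "z \<in> W (Mu p) D"
    then obtain w where "computes D p [w, z] 0" unfolding W_def by (auto elim: computes_MuE)
    with p[OF D, of w z] have "of_bool (\<not> P D w z) = (0 :: nat)" by (metis computes_functional)
    then have "P D w z" by (simp split: split_of_bool_asm)
    then show "z \<in> {z. \<exists>w. P D w z}" by blast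
  next
    fix z assume "z \<in> {z. \<exists>w. P D w z}"
    then have ex: "\<exists>w. P D w z" by blast
    let ?w = "LEAST w. P D w z"
    have "computes D p [?w, z] 0" using p[OF D, of ?w z] LeastI_ex[OF ex] by simp
    moreover have "\<forall>m<?w. \<exists>y. computes D p [m, z] (Suc y)"
    proof (intro allI impI)
      fix m assume "m < ?w"
      then have "\<not> P D m z" by (rule not_less_Least)
      then show "\<exists>y. computes D p [m, z] (Suc y)" using p[OF D, of m z] by auto
    qed
    ultimately have "computes D (Mu p) [z] ?w" by (rule computes.mu)
    then show "z \<in> W (Mu p) D" unfolding W_def by blast
  qed
  then show ?thesis by blast
qed

text \<open>By the successor convention of simulations, the values 2 and 1 stand for the outputs 1
  and 0. Only number quantifiers occur, over codes of finite subsets of \<open>R\<close>.\<close>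

definition consistent :: "(nat \<Rightarrow> nat \<Rightarrow> nat list \<Rightarrow> nat) \<Rightarrow> nat set \<Rightarrow> nat set \<Rightarrow> bool" where
  "consistent t R P \<longleftrightarrow> (\<forall>s x n. set_decode x \<subseteq> R \<longrightarrow>
     t s x [n] = 0 \<or> (n \<in> P \<and> t s x [n] = 2) \<or> (n \<notin> P \<and> t s x [n] = 1))"

lemma consistentD:
  assumes "consistent t R P" "set_decode x \<subseteq> R" "t s x [n] = Suc y"
  shows "y = (if n \<in> P then 1 else 0)"
proof -
  have "t s x [n] = 0 \<or> (n \<in> P \<and> t s x [n] = 2) \<or> (n \<notin> P \<and> t s x [n] = 1)"
    using assms(1,2) unfolding consistent_def by blast
  with assms(3) show ?thesis by auto
qed

text \<open>Whatever a total computation from \<open>D\<close> outputs already comes from a finite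
  part of \<open>D\<close>, and consistency makes that output correct.\<close>

lemma consistent_imp_functional_eq:
  assumes t: "simulates t \<Phi> 1" and c: "consistent t R P" and D: "D \<subseteq> R"
    and total: "\<And>n. \<exists>y. computes D \<Phi> [n] y"
  shows "functional_eq \<Phi> D P"
  unfolding functional_eq_def
proof
  fix n
  obtain y where y: "computes D \<Phi> [n] y" using total by blast
  have l: "length [n] = 1" by simp
  obtain s where s: "\<And>r x. r \<ge> s \<Longrightarrow> D \<inter> {..<r} = set_decode x \<inter> {..<r} \<Longrightarrow> t r x [n] = Suc y"
    using simulates_complete[OF t l y] by metis
  let ?x = "set_encode (D \<inter> {..<s})"
  have dec: "set_decode ?x = D \<inter> {..<s}" by simp
  have "t s ?x [n] = Suc y" by (rule s) (auto simp: dec)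
  moreover have "set_decode ?x \<subseteq> R" using D dec by blast
  ultimately have "y = (if n \<in> P then 1 else 0)" using consistentD[OF c] by blast
  with y show "computes D \<Phi> [n] (if n \<in> P then 1 else 0)" by simp
qed

lemma functional_eq_imp_consistent:
  assumes t: "simulates t \<Phi> 1" and R: "infinite R"
    and f: "\<And>D. D \<in> infinite_subsets R \<Longrightarrow> functional_eq \<Phi> D P"
  shows "consistent t R P"
  unfolding consistent_def
proof (intro allI impI)
  fix s x n assume x: "set_decode x \<subseteq> R"
  show "t s x [n] = 0 \<or> (n \<in> P \<and> t s x [n] = 2) \<or> (n \<notin> P \<and> t s x [n] = 1)"
  proof (cases "t s x [n]")
    case (Suc y)
    \<comment> \<open>The run reads \<open>x\<close> only below \<open>s\<close>. Continued by the
      elements of \<open>R\<close> from \<open>s\<close> on, this part becomes an infinite subset of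
      \<open>R\<close> with the same run, where the output is known to be right.\<close>
    let ?D = "(set_decode x \<inter> {..<s}) \<union> {z\<in>R. s \<le> z}"
    have "R \<subseteq> ?D \<union> {..<s}" by auto
    then have "infinite ?D" using R by (meson finite_Un finite_lessThan finite_subset)
    then have "?D \<in> infinite_subsets R" using x by (auto simp: infinite_subsets_def)
    from f[OF this] have out: "computes ?D \<Phi> [n] (if n \<in> P then 1 else 0)"
      unfolding functional_eq_def by blast
    have "computes ?D \<Phi> [n] y"
      by (rule simulates_sound[OF t _ Suc]) auto
    from computes_functional[OF this out] have "y = (if n \<in> P then 1 else 0)" .
    with Suc show ?thesis by auto
  qed simp
qed

text \<open>Both the simulation and membership in a coded set are computable without help from the
  oracle, so \<open>definable_graph\<close> for their programs makes them arithmetical.\<close>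

lemma definable_consistent:
  assumes t: "simulates t \<Phi> 1" and P: "\<And>u. definable coder (\<lambda>R f A s. term_val f s u \<in> P R A)"
  shows "definable coder (\<lambda>R f A s. consistent t R (P R A))"
proof -
  have "computable_on UNIV (Suc (Suc 1)) (\<lambda>D ys. t (arg ys 0) (arg ys 1) (tl (tl ys)))"
    using t unfolding simulates_def by blast
  then obtain p where p: "\<And>D ys. length ys = Suc (Suc 1) \<Longrightarrow> computes D p ys (t (arg ys 0) (arg ys 1) (tl (tl ys)))"
    unfolding computable_on_def by blast
  have p_iff: "computes D p [a, b, c] z \<longleftrightarrow> t a b [c] = z" for D a b c z
    using p[of "[a, b, c]" D] computes_functional by (auto simp: numeral_2_eq_2)
  have upt3: "[0..<3] = [0, 1, 2 :: nat]" by (simp add: upt_rec)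
  have T: "definable coder (\<lambda>R f A s. t (s 2) (s 1) [s 0] = term_val f s u)" for u
    using graph_subst[OF definable_graph[of p 3], of "case_nat (Var 2) (case_nat (Var 1) (case_nat (Var 0) (\<lambda>_. u)))"]
    by (simp add: upt3 p_iff numeral_2_eq_2 numeral_3_eq_3)
  have "decidable_on UNIV 2 (\<lambda>D xs. arg xs 0 \<in> set_decode (arg xs 1))"
    by (auto intro!: comp_intros)
  then obtain d where d: "\<And>D xs. length xs = 2 \<Longrightarrow> computes D d xs (of_bool (arg xs 0 \<in> set_decode (arg xs 1)))"
    unfolding decidable_on_def computable_on_def by blast
  have d_iff: "computes D d [i, x] (Suc 0) \<longleftrightarrow> i \<in> set_decode x" for D i x
  proof -
    have d': "computes D d [i, x] (of_bool (i \<in> set_decode x))" using d[of "[i, x]" D] by simp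
    show ?thesis
    proof
      assume "computes D d [i, x] (Suc 0)"
      from computes_functional[OF this d'] show "i \<in> set_decode x" by (simp split: split_of_bool_asm)
    next
      assume "i \<in> set_decode x"
      with d' show "computes D d [i, x] (Suc 0)" by simp
    qed
  qed
  have upt2: "[0..<2] = [0, 1 :: nat]" by (simp add: upt_rec)
  have sub0: "definable coder (\<lambda>R f A s. s 0 \<in> set_decode (s 2))"
    using graph_subst[OF definable_graph[of d 2], of "case_nat (Var 0) (case_nat (Var 2) (\<lambda>_. Suc_of Zer))"]
    by (simp add: upt2 d_iff numeral_2_eq_2)
  have "definable coder (\<lambda>R f A s. \<forall>i. (\<lambda>R f A s. s 0 \<in> set_decode (s 2) \<longrightarrow> term_val f s (Var 0) \<in> R) R f A (case_nat i s))"
    by (intro definable_all definable_imp sub0 definable_in_R)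
  then have sub: "definable coder (\<lambda>R f A s. set_decode (s 1) \<subseteq> R)"
    by (rule definable_cong) (auto simp: numeral_2_eq_2)
  have "definable coder (\<lambda>R f A s. \<forall>a. (\<lambda>R f A s. \<forall>x. (\<lambda>R f A s. \<forall>n. (\<lambda>R f A s. set_decode (s 1) \<subseteq> R \<longrightarrow>
      t (s 2) (s 1) [s 0] = term_val f s Zer \<or>
      (term_val f s (Var 0) \<in> P R A \<and> t (s 2) (s 1) [s 0] = term_val f s (Suc_of (Suc_of Zer))) \<or>
      (\<not> term_val f s (Var 0) \<in> P R A \<and> t (s 2) (s 1) [s 0] = term_val f s (Suc_of Zer)))
      R f A (case_nat n s)) R f A (case_nat x s)) R f A (case_nat a s))"
    by (intro definable_all definable_imp definable_disj definable_conj definable_not sub T P)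
  then show ?thesis
    by (rule definable_cong) (simp add: consistent_def numeral_2_eq_2)
qed

lemma definable_subset_infinite: "definable C (\<lambda>R f A s. R \<subseteq> A \<and> infinite R)"
proof -
  have "definable C (\<lambda>R f A s. (\<forall>x. (\<lambda>R f A s. term_val f s (Var 0) \<in> R \<longrightarrow> term_val f s (Var 0) \<in> A) R f A (case_nat x s)) \<and>
     (\<forall>m. (\<lambda>R f A s. \<exists>y. (\<lambda>R f A s. term_val f s (Var 1) < term_val f s (Var 0) \<and> term_val f s (Var 0) \<in> R)
       R f A (case_nat y s)) R f A (case_nat m s)))"
    by (intro definable_conj definable_all definable_ex definable_imp definable_in_R definable_in_A definable_less)
  then show ?thesis
    by (rule definable_cong) (auto simp: infinite_nat_iff_unbounded)
qed

text \<open>The finite set \<open>E\<close> serves as the entire oracle, so the operator is positive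
  although \<open>\<Theta>\<close> also acts on negative answers. That supersets of \<open>E\<close>
  might compute otherwise is harmless where finite subsets never give wrong values.\<close>

lemma enumeration_operator_of_functional:
  "enumeration_operator {(E, n). finite E \<and> computes E \<Theta> [n] 1}" (is "enumeration_operator ?\<Lambda>")
proof -
  obtain t where t: "simulates t \<Theta> 1" using simulation_exists by blast
  have t_iff: "computes (set_decode x) \<Theta> [n] 1 \<longleftrightarrow> (\<exists>s. t s x [n] = 2)" for x n
  proof
    assume c: "computes (set_decode x) \<Theta> [n] 1"
    have l: "length [n] = 1" by simp
    show "\<exists>s. t s x [n] = 2" using simulates_complete[OF t l c] by (metis Suc_1 order_refl)
  next
    assume "\<exists>s. t s x [n] = 2"
    then obtain s where "t s x [n] = 2" by blast
    then have "t s x [n] = Suc 1" by simp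
    from simulates_sound[OF t _ this] show "computes (set_decode x) \<Theta> [n] 1" by simp
  qed
  have t': "computable_on UNIV k (\<lambda>D xs. t (s D xs) (x D xs) [n D xs])"
    if "computable_on UNIV k s" "computable_on UNIV k x" "computable_on UNIV k n" for k s x n
    using simulates_computable[OF t, of "[n]" UNIV k s x] that by simp
  \<comment> \<open>One number bounds the stage, the code and \<open>n\<close>, because
    \<open>W_of_decidable\<close> offers a single search variable.\<close>
  have "decidable_on UNIV 2 (\<lambda>D xs. \<exists>s\<le>arg xs 0. \<exists>x\<le>arg xs 0. \<exists>n\<le>arg xs 0.
      prod_encode (x, n) = arg xs 1 \<and> t s x [n] = 2)"
    by (auto intro!: comp_intros t')
  from W_of_decidable[where P = "\<lambda>D w z. \<exists>s\<le>w. \<exists>x\<le>w. \<exists>n\<le>w. prod_encode (x, n) = z \<and> t s x [n] = 2", OF this]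
  obtain e where "\<forall>D\<in>UNIV. W e D = {z. \<exists>w. \<exists>s\<le>w. \<exists>x\<le>w. \<exists>n\<le>w. prod_encode (x, n) = z \<and> t s x [n] = 2}"
    by (rule exE)
  then have "W e {} = {z. \<exists>w. \<exists>s\<le>w. \<exists>x\<le>w. \<exists>n\<le>w. prod_encode (x, n) = z \<and> t s x [n] = 2}"
    by (rule bspec) simp
  also have "\<dots> = (\<lambda>(F, n). prod_encode (set_encode F, n)) ` ?\<Lambda>"
  proof (intro set_eqI iffI)
    fix z assume "z \<in> {z. \<exists>w. \<exists>s\<le>w. \<exists>x\<le>w. \<exists>n\<le>w. prod_encode (x, n) = z \<and> t s x [n] = 2}"
    then obtain x n where z: "z = prod_encode (x, n)" and "\<exists>s. t s x [n] = 2" by blast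
    then have "(set_decode x, n) \<in> ?\<Lambda>" using t_iff[of x n] by simp
    then show "z \<in> (\<lambda>(F, n). prod_encode (set_encode F, n)) ` ?\<Lambda>"
      by (rule rev_image_eqI) (simp add: z)
  next
    fix z assume "z \<in> (\<lambda>(F, n). prod_encode (set_encode F, n)) ` ?\<Lambda>"
    then obtain F n where F: "finite F" "computes F \<Theta> [n] 1" and z: "z = prod_encode (set_encode F, n)" by auto
    then have "computes (set_decode (set_encode F)) \<Theta> [n] 1" by simp
    then obtain s where "t s (set_encode F) [n] = 2" unfolding t_iff by blast
    moreover have "s \<le> s + set_encode F + n" "set_encode F \<le> s + set_encode F + n" "n \<le> s + set_encode F + n"
      by auto
    ultimately show "z \<in> {z. \<exists>w. \<exists>s\<le>w. \<exists>x\<le>w. \<exists>n\<le>w. prod_encode (x, n) = z \<and> t s x [n] = 2}"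
      unfolding z by blast
  qed
  finally show ?thesis unfolding enumeration_operator_def ce_in_def by auto
qed

theorem corollary6p3:
  fixes A :: "nat set"
  assumes "introenumerable A"
  shows "(\<exists>R \<subseteq> A. uniformly_introenumerable R) \<and>
    (\<exists>K \<Psi> \<Theta>.
       Sigma11_class A K \<and> K \<noteq> {} \<and> K \<subseteq> infinite_subsets A \<and>
       (\<forall>R \<in> K. \<forall>D \<in> infinite_subsets R. functional_eq \<Psi> D A \<and> functional_eq \<Theta> D R) \<and>
       (\<exists>\<Lambda>. enumeration_operator \<Lambda> \<and>
          (\<forall>R \<in> K. \<forall>D \<in> infinite_subsets R. enum_apply \<Lambda> D = R)))"
proof -
  let ?\<D> = "infinite_subsets A"
  obtain S dA dS where S: "S \<subseteq> A" "infinite S"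
    and dA: "decidable_on ?\<D> 1 (\<lambda>D xs. arg xs 0 \<in> dA D)"
    and dS: "decidable_on ?\<D> 1 (\<lambda>D xs. arg xs 0 \<in> dS D)"
    and correct: "\<And>D. D \<in> infinite_subsets S \<Longrightarrow> dA D = A \<and> dS D = S"
    using exists_uniform_functionals[OF assms] by metis
  have sub\<D>: "infinite_subsets R \<subseteq> ?\<D>" if "R \<subseteq> A" for R
    using that by (auto simp: infinite_subsets_def)
  have functional: "\<exists>\<Phi>. \<forall>D\<in>?\<D>. functional_eq \<Phi> D (d D)"
    if "decidable_on ?\<D> 1 (\<lambda>D xs. arg xs 0 \<in> d D)" for d
  proof -
    from that obtain \<Phi> where \<Phi>: "\<And>D xs. D \<in> ?\<D> \<Longrightarrow> length xs = 1 \<Longrightarrow> computes D \<Phi> xs (of_bool (arg xs 0 \<in> d D))"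
      unfolding decidable_on_def computable_on_def by blast
    have "functional_eq \<Phi> D (d D)" if "D \<in> ?\<D>" for D
      using \<Phi>[OF that, of "[n]" for n] by (simp add: functional_eq_def of_bool_def)
    then show ?thesis by blast
  qed
  obtain \<Psi> where \<Psi>: "\<And>D. D \<in> ?\<D> \<Longrightarrow> functional_eq \<Psi> D (dA D)" using functional[OF dA] by blast
  obtain \<Theta> where \<Theta>: "\<And>D. D \<in> ?\<D> \<Longrightarrow> functional_eq \<Theta> D (dS D)" using functional[OF dS] by blast
  obtain u where u: "simulates u \<Psi> 1" using simulation_exists by blast
  obtain t where t: "simulates t \<Theta> 1" using simulation_exists by blast
  define K where "K = {R. (R \<subseteq> A \<and> infinite R) \<and> consistent u R A \<and> consistent t R R}"
  have Sigma: "Sigma11_class A K"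
    unfolding K_def
    by (intro Sigma11_class_definable[where P = "\<lambda>R A. (R \<subseteq> A \<and> infinite R) \<and> consistent u R A \<and> consistent t R R"]
        definable_conj[OF definable_subset_infinite definable_conj]
        definable_consistent[where P = "\<lambda>R A. A", OF u definable_in_A]
        definable_consistent[where P = "\<lambda>R A. R", OF t definable_in_R])
  have SK: "S \<in> K"
    unfolding K_def
  proof (intro CollectI conjI S)
    show "consistent u S A"
      by (rule functional_eq_imp_consistent[OF u S(2)]) (use \<Psi> sub\<D>[OF S(1)] correct in fastforce)
    show "consistent t S S"
      by (rule functional_eq_imp_consistent[OF t S(2)]) (use \<Theta> sub\<D>[OF S(1)] correct in fastforce)
  qed
  have KA: "K \<subseteq> ?\<D>" by (auto simp: K_def infinite_subsets_def)
  have eq: "functional_eq \<Psi> D A \<and> functional_eq \<Theta> D R" if R: "R \<in> K" and D: "D \<in> infinite_subsets R" for R D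
  proof
    have D': "D \<in> ?\<D>" using R D KA by (auto simp: infinite_subsets_def)
    have DR: "D \<subseteq> R" using D by (simp add: infinite_subsets_def)
    have c: "consistent u R A" "consistent t R R" using R by (auto simp: K_def)
    show "functional_eq \<Psi> D A"
      by (rule consistent_imp_functional_eq[OF u c(1) DR]) (use \<Psi>[OF D'] in \<open>auto simp: functional_eq_def\<close>)
    show "functional_eq \<Theta> D R"
      by (rule consistent_imp_functional_eq[OF t c(2) DR]) (use \<Theta>[OF D'] in \<open>auto simp: functional_eq_def\<close>)
  qed
  let ?\<Lambda> = "{(E, n). finite E \<and> computes E \<Theta> [n] 1}"
  have \<Lambda>: "enum_apply ?\<Lambda> D = R" if R: "R \<in> K" and D: "D \<in> infinite_subsets R" for R D
  proof (intro set_eqI iffI)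
    fix n assume "n \<in> enum_apply ?\<Lambda> D"
    then obtain E where E: "finite E" "E \<subseteq> D" "computes E \<Theta> [n] 1" unfolding enum_apply_def by blast
    have l: "length [n] = 1" by simp
    obtain s where s: "\<And>r x. r \<ge> s \<Longrightarrow> E \<inter> {..<r} = set_decode x \<inter> {..<r} \<Longrightarrow> t r x [n] = Suc 1"
      using simulates_complete[OF t l E(3)] by metis
    have "t s (set_encode E) [n] = Suc 1" using s[of s "set_encode E"] E(1) by simp
    \<comment> \<open>\<open>E\<close> need not be an initial part of \<open>D\<close>; consistency
      applies because it tests all finite subsets of \<open>R\<close>.\<close>
    moreover have "set_decode (set_encode E) \<subseteq> R" using E(1,2) D by (auto simp: infinite_subsets_def)
    moreover have "consistent t R R" using R by (simp add: K_def)
    ultimately have "1 = (if n \<in> R then 1 else 0 :: nat)" by (metis consistentD)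
    then show "n \<in> R" by (simp split: if_splits)
  next
    fix n assume "n \<in> R"
    with eq[OF R D] have "computes D \<Theta> [n] 1" unfolding functional_eq_def by metis
    then obtain s where s: "\<And>E. E \<inter> {..<s} = D \<inter> {..<s} \<Longrightarrow> computes E \<Theta> [n] 1"
      using computes_use by metis
    have "computes (D \<inter> {..<s}) \<Theta> [n] 1" by (rule s) blast
    then show "n \<in> enum_apply ?\<Lambda> D" unfolding enum_apply_def by blast
  qed
  have "uniformly_introenumerable S"
  proof -
    \<comment> \<open>Membership is padded with a dummy search variable to fit
      \<open>W_of_decidable\<close>, giving one index for all oracles.\<close>
    have "decidable_on ?\<D> 2 (\<lambda>D xs. arg xs 1 \<in> dS D)"
      by (rule decidable_comp1[where P = "\<lambda>D x. x \<in> dS D", OF dS]) (auto intro: computable_arg)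
    from W_of_decidable[where P = "\<lambda>D w z. z \<in> dS D", OF this] obtain e where e: "\<And>D. D \<in> ?\<D> \<Longrightarrow> W e D = dS D" by auto
    have "W e D = S" if "D \<in> infinite_subsets S" for D
      using e[of D] correct[OF that] sub\<D>[OF S(1)] that by blast
    with S(2) show ?thesis unfolding uniformly_introenumerable_def by blast
  qed
  moreover have "\<exists>K \<Psi> \<Theta>. Sigma11_class A K \<and> K \<noteq> {} \<and> K \<subseteq> infinite_subsets A \<and>
       (\<forall>R \<in> K. \<forall>D \<in> infinite_subsets R. functional_eq \<Psi> D A \<and> functional_eq \<Theta> D R) \<and>
       (\<exists>\<Lambda>. enumeration_operator \<Lambda> \<and>
          (\<forall>R \<in> K. \<forall>D \<in> infinite_subsets R. enum_apply \<Lambda> D = R))"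
  proof (rule exI[of _ K], rule exI[of _ \<Psi>], rule exI[of _ \<Theta>], intro conjI)
    show "Sigma11_class A K" "K \<subseteq> infinite_subsets A" by fact+
    show "K \<noteq> {}" using SK by blast
    show "\<forall>R\<in>K. \<forall>D\<in>infinite_subsets R. functional_eq \<Psi> D A \<and> functional_eq \<Theta> D R"
      using eq by blast
    show "\<exists>\<Lambda>. enumeration_operator \<Lambda> \<and> (\<forall>R\<in>K. \<forall>D\<in>infinite_subsets R. enum_apply \<Lambda> D = R)"
      using enumeration_operator_of_functional \<Lambda> by (intro exI[of _ ?\<Lambda>]) simp
  qed
  ultimately show ?thesis using S(1) by blast
qed

end
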